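(* Let $G$ be a torus acting smoothly on a manifold $M$, and let $A\colon X\mapsto A(X)$ be an assignment on $M$. Then there exists an abstract moment map $\Psi\colon M\to\mathfrak g^*$ which is associated with $A$, i.e., such that $\Psi^{\mathfrak g_X}(X)=A(X)$ in $\mathfrak g_X^*$ for every infinitesimal orbit type stratum $X$ of $M$.
   Context: $\mathfrak g$ is the Lie algebra of $G$, and $\xi_M$ is the vector field on $M$ generated by $\xi\in\mathfrak g$. For a subgroup $H\subseteq G$ with Lie algebra $\mathfrak h$ and a map $\Psi\colon M\to\mathfrak g^*$, both $\Psi^H$ and $\Psi^{\mathfrak h}$ denote the composition of $\Psi$ with the restriction map $\mathfrak g^*\to\mathfrak h^*$. An abstract moment map on $M$ is a smooth $G$-equivariant map $\Psi\colon M\to\mathfrak g^*$ (for a torus: a $G$-invariant one) such that for every (Lie) subgroup $H\subseteq G$ the map $\Psi^H\colon M\to\mathfrak h^*$ is locally constant on the fixed point set $M^H$. The infinitesimal stabilizer of $m\in M$ is $\mathfrak g_m=\{\xi\in\mathfrak g : \xi_M|_m=0\}$. The infinitesimal orbit type strata of $M$ are the connected components of the sets $\{m\in M:\mathfrak g_m=\mathfrak h\}$, for subalgebras $\mathfrak h\subseteq\mathfrak g$. For a stratum $X$, $\mathfrak g_X$ denotes the common infinitesimal stabilizer of its points. An assignment on $M$ is a function $A$ associating to each infinitesimal orbit type stratum $X$ an element $A(X)\in\mathfrak g_X^*$ such that, whenever $X$ is contained in the closure of $Y$, $A(Y)$ is the image of $A(X)$ under the restriction map $\mathfrak g_X^*\to\mathfrak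 g_Y^*$. For an abstract moment map $\Psi$, $\Psi^{\mathfrak g_X}$ is constant on each stratum $X$; this constant value is denoted $\Psi^{\mathfrak g_X}(X)$. *)

theory Defs
  imports "HOL-Analysis.Analysis" "HOL-Algebra.Group"
begin

section \<open>Smooth maps between subsets of Euclidean spaces\<close>

text \<open>\<open>Ck_on k U f\<close> is used for open \<open>U\<close> only.\<close>

primrec Ck_on :: "nat \<Rightarrow> 'a::euclidean_space set \<Rightarrow> ('a \<Rightarrow> 'b::euclidean_space) \<Rightarrow> bool" where
  "Ck_on 0 U f \<longleftrightarrow> continuous_on U f"
| "Ck_on (Suc k) U f \<longleftrightarrow>
     (\<forall>x\<in>U. f differentiable (at x)) \<and> (\<forall>v. Ck_on k U (\<lambda>x. frechet_derivative f (at x) v))"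

text \<open>
  A map on an arbitrary set \<open>S\<close> is smooth if it extends smoothly near each point. On open sets
  this is the usual notion. It is also the usual one on relatively open subsets of a linear
  subspace, which is how it is used below.
\<close>

definition smooth_on :: "'a::euclidean_space set \<Rightarrow> ('a \<Rightarrow> 'b::euclidean_space) \<Rightarrow> bool" where
  "smooth_on S f \<longleftrightarrow>
     (\<forall>x\<in>S. \<exists>U F. open U \<and> x \<in> U \<and> (\<forall>k. Ck_on k U F) \<and> (\<forall>y\<in>S \<inter> U. F y = f y))"


section \<open>Smooth manifolds\<close>

text \<open>
  Charts take values in a fixed linear subspace (the model) of a Euclidean space, whose dimension
  is the dimension of the manifold. A subspace is used rather than the whole type because types of
  class \<^class>\<open>euclidean_space\<close> have positive dimension, whereas manifolds and tori may
  have dimension zero.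
\<close>

record ('m, 'e) mfd =
  mf_top :: "'m topology"
  model :: "'e set"
  atlas :: "('m set \<times> ('m \<Rightarrow> 'e)) set"

abbreviation points :: "('m, 'e) mfd \<Rightarrow> 'm set" where
  "points M \<equiv> topspace (mf_top M)"

definition smooth_manifold :: "('m, 'e::euclidean_space) mfd \<Rightarrow> bool" where
  "smooth_manifold M \<longleftrightarrow>
     Hausdorff_space (mf_top M) \<and> second_countable (mf_top M) \<and> subspace (model M) \<and>
     (\<Union>(U, \<phi>)\<in>atlas M. U) = points M \<and>
     (\<forall>(U, \<phi>)\<in>atlas M.
        openin (mf_top M) U \<and> openin (top_of_set (model M)) (\<phi> ` U) \<and>
        homeomorphic_map (subtopology (mf_top M) U) (top_of_set (\<phi> ` U)) \<phi>) \<and>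
     (\<forall>(U, \<phi>)\<in>atlas M. \<forall>(V, \<psi>)\<in>atlas M.
        smooth_on (\<phi> ` (U \<inter> V)) (\<psi> \<circ> inv_into U \<phi>))"

definition euclid :: "'e::euclidean_space set \<Rightarrow> ('e, 'e) mfd" where
  "euclid E = \<lparr>mf_top = top_of_set E, model = E, atlas = {(E, id)}\<rparr>"

abbreviation real_line :: "(real, real) mfd" where
  "real_line \<equiv> euclid UNIV"

definition prod_mfd ::
    "('m, 'e::euclidean_space) mfd \<Rightarrow> ('n, 'f::euclidean_space) mfd \<Rightarrow> ('m \<times> 'n, 'e \<times> 'f) mfd"
  where
  "prod_mfd M N =
     \<lparr>mf_top = prod_topology (mf_top M) (mf_top N),
      model = model M \<times> model N,
      atlas = {(U \<times> V, map_prod \<phi> \<psi>) | U \<phi> V \<psi>. (U, \<phi>) \<in> atlas M \<and> (V, \<psi>) \<in> atlas N}\<rparr>"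

text \<open>Smoothness on an open subset \<open>W\<close> of \<open>M\<close>.\<close>

definition smooth_map_on ::
    "'m set \<Rightarrow> ('m, 'e::euclidean_space) mfd \<Rightarrow> ('n, 'f::euclidean_space) mfd \<Rightarrow> ('m \<Rightarrow> 'n) \<Rightarrow> bool"
  where
  "smooth_map_on W M N f \<longleftrightarrow>
     f ` W \<subseteq> points N \<and>
     (\<forall>x\<in>W. \<exists>(U, \<phi>)\<in>atlas M. \<exists>(V, \<psi>)\<in>atlas N. \<exists>S.
        openin (mf_top M) S \<and> x \<in> S \<and> S \<subseteq> U \<inter> W \<and> f ` S \<subseteq> V \<and>
        smooth_on (\<phi> ` S) (\<psi> \<circ> f \<circ> inv_into U \<phi>))"

abbreviation smooth_map ::
    "('m, 'e::euclidean_space) mfd \<Rightarrow> ('n, 'f::euclidean_space) mfd \<Rightarrow> ('m \<Rightarrow> 'n) \<Rightarrow> bool"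
  where
  "smooth_map M N f \<equiv> smooth_map_on (points M) M N f"


section \<open>Tori and their Lie algebras\<close>

definition lie_group :: "('g, 'r) monoid_scheme \<Rightarrow> ('g, 'e::euclidean_space) mfd \<Rightarrow> bool" where
  "lie_group G \<G> \<longleftrightarrow>
     group G \<and> smooth_manifold \<G> \<and> points \<G> = carrier G \<and>
     smooth_map (prod_mfd \<G> \<G>) \<G> (\<lambda>(x, y). x \<otimes>\<^bsub>G\<^esub> y) \<and>
     smooth_map \<G> \<G> (\<lambda>x. inv\<^bsub>G\<^esub> x)"

definition int_span :: "'e::real_vector set \<Rightarrow> 'e set" where
  "int_span B = {\<Sum>b\<in>B. of_int (k b) *\<^sub>R b | k :: 'e \<Rightarrow> int. True}"

text \<open>
  A torus is a Lie group isomorphic to \<open>E / \<Lambda>\<close>, where \<open>E\<close> is a finite-dimensional real vector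
  space and \<open>\<Lambda>\<close> is the lattice generated by a basis of \<open>E\<close> (so, to \<open>\<real>\<^sup>n / \<int>\<^sup>n\<close>, \<open>n \<ge> 0\<close>). The isomorphism
  is given as its composition \<open>\<pi>\<close> with the quotient map: \<open>\<pi>\<close> is a smooth surjective homomorphism
  with kernel \<open>\<Lambda>\<close>, and smoothness of the inverse \<open>G \<rightarrow> E / \<Lambda>\<close> says that \<open>\<pi>\<close> has smooth local
  sections.
\<close>

definition torus :: "('g, 'r) monoid_scheme \<Rightarrow> ('g, 'e::euclidean_space) mfd \<Rightarrow> bool" where
  "torus G \<G> \<longleftrightarrow>
     lie_group G \<G> \<and>
     (\<exists>B \<pi>. independent B \<and> span B = model \<G> \<and>
        smooth_map (euclid (model \<G>)) \<G> \<pi> \<and>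
        (\<forall>x\<in>model \<G>. \<forall>y\<in>model \<G>. \<pi> (x + y) = \<pi> x \<otimes>\<^bsub>G\<^esub> \<pi> y) \<and>
        \<pi> ` model \<G> = carrier G \<and>
        {x \<in> model \<G>. \<pi> x = \<one>\<^bsub>G\<^esub>} = int_span B \<and>
        (\<forall>g\<in>carrier G. \<exists>V \<sigma>. openin (mf_top \<G>) V \<and> g \<in> V \<and>
           smooth_map_on V \<G> (euclid (model \<G>)) \<sigma> \<and> (\<forall>h\<in>V. \<pi> (\<sigma> h) = h)))"

text \<open>
  An element \<open>\<xi>\<close> of the Lie algebra is represented by its one-parameter subgroup
  \<open>t \<mapsto> exp (t \<xi>)\<close>. The vector space operations given here are the right ones for abelian \<open>G\<close>.
  The bracket is then zero, so the subalgebras are the linear subspaces.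
\<close>

definition lie_alg ::
    "('g, 'r) monoid_scheme \<Rightarrow> ('g, 'e::euclidean_space) mfd \<Rightarrow> (real \<Rightarrow> 'g) set" where
  "lie_alg G \<G> = {\<xi>. smooth_map real_line \<G> \<xi> \<and> (\<forall>s t. \<xi> (s + t) = \<xi> s \<otimes>\<^bsub>G\<^esub> \<xi> t)}"

definition la_zero :: "('g, 'r) monoid_scheme \<Rightarrow> real \<Rightarrow> 'g" where
  "la_zero G = (\<lambda>t. \<one>\<^bsub>G\<^esub>)"

definition la_add :: "('g, 'r) monoid_scheme \<Rightarrow> (real \<Rightarrow> 'g) \<Rightarrow> (real \<Rightarrow> 'g) \<Rightarrow> real \<Rightarrow> 'g" where
  "la_add G \<xi> \<eta> = (\<lambda>t. \<xi> t \<otimes>\<^bsub>G\<^esub> \<eta> t)"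

definition la_scale :: "real \<Rightarrow> (real \<Rightarrow> 'g) \<Rightarrow> real \<Rightarrow> 'g" where
  "la_scale c \<xi> = (\<lambda>t. \<xi> (c * t))"

definition subalgebra ::
    "('g, 'r) monoid_scheme \<Rightarrow> ('g, 'e::euclidean_space) mfd \<Rightarrow> (real \<Rightarrow> 'g) set \<Rightarrow> bool" where
  "subalgebra G \<G> \<hh> \<longleftrightarrow>
     \<hh> \<subseteq> lie_alg G \<G> \<and> la_zero G \<in> \<hh> \<and>
     (\<forall>\<xi>\<in>\<hh>. \<forall>\<eta>\<in>\<hh>. la_add G \<xi> \<eta> \<in> \<hh>) \<and> (\<forall>c. \<forall>\<xi>\<in>\<hh>. la_scale c \<xi> \<in> \<hh>)"

text \<open>The Lie algebra of a subgroup \<open>H\<close>: all \<open>\<xi>\<close> with \<open>exp (t \<xi>) \<in> H\<close> for all \<open>t\<close>.\<close>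

definition lie_alg_sub ::
    "('g, 'r) monoid_scheme \<Rightarrow> ('g, 'e::euclidean_space) mfd \<Rightarrow> 'g set \<Rightarrow> (real \<Rightarrow> 'g) set" where
  "lie_alg_sub G \<G> H = {\<xi> \<in> lie_alg G \<G>. range \<xi> \<subseteq> H}"

text \<open>
  Functionals on \<open>\<hh>\<close> are extensional, so that elements of the dual are equal iff they agree
  on \<open>\<hh>\<close>, and the restriction map to the dual of a smaller subalgebra is \<^const>\<open>restrict\<close>.
\<close>

definition dual_space ::
    "('g, 'r) monoid_scheme \<Rightarrow> (real \<Rightarrow> 'g) set \<Rightarrow> ((real \<Rightarrow> 'g) \<Rightarrow> real) set" where
  "dual_space G \<hh> = {\<alpha> \<in> extensional \<hh>.
     (\<forall>\<xi>\<in>\<hh>. \<forall>\<eta>\<in>\<hh>. \<alpha> (la_add G \<xi> \<eta>) = \<alpha> \<xi> + \<alpha> \<eta>) \<and>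
     (\<forall>c. \<forall>\<xi>\<in>\<hh>. \<alpha> (la_scale c \<xi>) = c * \<alpha> \<xi>)}"


section \<open>Actions and infinitesimal orbit type strata\<close>

definition smooth_action ::
    "('g, 'r) monoid_scheme \<Rightarrow> ('g, 'e::euclidean_space) mfd \<Rightarrow> ('m, 'f::euclidean_space) mfd \<Rightarrow>
     ('g \<Rightarrow> 'm \<Rightarrow> 'm) \<Rightarrow> bool" where
  "smooth_action G \<G> M \<rho> \<longleftrightarrow>
     smooth_map (prod_mfd \<G> M) M (\<lambda>(g, m). \<rho> g m) \<and>
     (\<forall>m\<in>points M. \<rho> \<one>\<^bsub>G\<^esub> m = m) \<and>
     (\<forall>g\<in>carrier G. \<forall>h\<in>carrier G. \<forall>m\<in>points M. \<rho> (g \<otimes>\<^bsub>G\<^esub> h) m = \<rho> g (\<rho> h m))"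

definition fixed_points ::
    "('m, 'f) mfd \<Rightarrow> ('g \<Rightarrow> 'm \<Rightarrow> 'm) \<Rightarrow> 'g set \<Rightarrow> 'm set" where
  "fixed_points M \<rho> H = {m \<in> points M. \<forall>h\<in>H. \<rho> h m = m}"

text \<open>
  The value \<open>\<xi>\<^sub>M|\<^sub>m = d/dt|\<^sub>0 exp (t \<xi>) \<cdot> m\<close> of the generated vector field, as a derivation acting on
  smooth functions \<open>f\<close> on \<open>M\<close>.
\<close>

definition gen_field :: "('g \<Rightarrow> 'm \<Rightarrow> 'm) \<Rightarrow> (real \<Rightarrow> 'g) \<Rightarrow> 'm \<Rightarrow> ('m \<Rightarrow> real) \<Rightarrow> real" where
  "gen_field \<rho> \<xi> m f = deriv (\<lambda>t. f (\<rho> (\<xi> t) m)) 0"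

definition inf_stab ::
    "('g, 'r) monoid_scheme \<Rightarrow> ('g, 'e::euclidean_space) mfd \<Rightarrow> ('m, 'f::euclidean_space) mfd \<Rightarrow>
     ('g \<Rightarrow> 'm \<Rightarrow> 'm) \<Rightarrow> 'm \<Rightarrow> (real \<Rightarrow> 'g) set" where
  "inf_stab G \<G> M \<rho> m =
     {\<xi> \<in> lie_alg G \<G>. \<forall>f. smooth_map M real_line f \<longrightarrow> gen_field \<rho> \<xi> m f = 0}"

definition strata ::
    "('g, 'r) monoid_scheme \<Rightarrow> ('g, 'e::euclidean_space) mfd \<Rightarrow> ('m, 'f::euclidean_space) mfd \<Rightarrow>
     ('g \<Rightarrow> 'm \<Rightarrow> 'm) \<Rightarrow> 'm set set" where
  "strata G \<G> M \<rho> =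
     (\<Union>\<hh>\<in>Collect (subalgebra G \<G>).
        connected_components_of (subtopology (mf_top M) {m \<in> points M. inf_stab G \<G> M \<rho> m = \<hh>}))"

definition stratum_stab ::
    "('g, 'r) monoid_scheme \<Rightarrow> ('g, 'e::euclidean_space) mfd \<Rightarrow> ('m, 'f::euclidean_space) mfd \<Rightarrow>
     ('g \<Rightarrow> 'm \<Rightarrow> 'm) \<Rightarrow> 'm set \<Rightarrow> (real \<Rightarrow> 'g) set" where
  "stratum_stab G \<G> M \<rho> X = (THE \<hh>. \<forall>m\<in>X. inf_stab G \<G> M \<rho> m = \<hh>)"


section \<open>Assignments and abstract moment maps\<close>

definition assignment ::
    "('g, 'r) monoid_scheme \<Rightarrow> ('g, 'e::euclidean_space) mfd \<Rightarrow> ('m, 'f::euclidean_space) mfd \<Rightarrow>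
     ('g \<Rightarrow> 'm \<Rightarrow> 'm) \<Rightarrow> ('m set \<Rightarrow> (real \<Rightarrow> 'g) \<Rightarrow> real) \<Rightarrow> bool" where
  "assignment G \<G> M \<rho> A \<longleftrightarrow>
     (\<forall>X\<in>strata G \<G> M \<rho>. A X \<in> dual_space G (stratum_stab G \<G> M \<rho> X)) \<and>
     (\<forall>X\<in>strata G \<G> M \<rho>. \<forall>Y\<in>strata G \<G> M \<rho>.
        X \<subseteq> mf_top M closure_of Y \<longrightarrow> A Y = restrict (A X) (stratum_stab G \<G> M \<rho> Y))"

definition locally_constant_on :: "'m topology \<Rightarrow> 'm set \<Rightarrow> ('m \<Rightarrow> 'b) \<Rightarrow> bool" where
  "locally_constant_on T S f \<longleftrightarrow>
     (\<forall>m\<in>S. \<exists>U. openin (subtopology T S) U \<and> m \<in> U \<and> (\<forall>x\<in>U. f x = f m))"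

text \<open>
  The dual of the Lie algebra is finite-dimensional, so a map into it is smooth iff its
  evaluations at all Lie algebra elements are. Equivariance is invariance, the coadjoint action
  of a torus being trivial. The subgroup \<open>H\<close> is arbitrary, which includes all Lie subgroups.
\<close>

definition abstract_moment_map ::
    "('g, 'r) monoid_scheme \<Rightarrow> ('g, 'e::euclidean_space) mfd \<Rightarrow> ('m, 'f::euclidean_space) mfd \<Rightarrow>
     ('g \<Rightarrow> 'm \<Rightarrow> 'm) \<Rightarrow> ('m \<Rightarrow> (real \<Rightarrow> 'g) \<Rightarrow> real) \<Rightarrow> bool" where
  "abstract_moment_map G \<G> M \<rho> \<Psi> \<longleftrightarrow>
     (\<forall>m\<in>points M. \<Psi> m \<in> dual_space G (lie_alg G \<G>)) \<and>
     (\<forall>\<xi>\<in>lie_alg G \<G>. smooth_map M real_line (\<lambda>m. \<Psi> m \<xi>)) \<and>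
     (\<forall>g\<in>carrier G. \<forall>m\<in>points M. \<Psi> (\<rho> g m) = \<Psi> m) \<and>
     (\<forall>H. subgroup H G \<longrightarrow>
        locally_constant_on (mf_top M) (fixed_points M \<rho> H)
          (\<lambda>m. restrict (\<Psi> m) (lie_alg_sub G \<G> H)))"

definition associated ::
    "('g, 'r) monoid_scheme \<Rightarrow> ('g, 'e::euclidean_space) mfd \<Rightarrow> ('m, 'f::euclidean_space) mfd \<Rightarrow>
     ('g \<Rightarrow> 'm \<Rightarrow> 'm) \<Rightarrow> ('m \<Rightarrow> (real \<Rightarrow> 'g) \<Rightarrow> real) \<Rightarrow> ('m set \<Rightarrow> (real \<Rightarrow> 'g) \<Rightarrow> real) \<Rightarrow> bool"
  where
  "associated G \<G> M \<rho> \<Psi> A \<longleftrightarrow>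
     (\<forall>X\<in>strata G \<G> M \<rho>. \<forall>m\<in>X. restrict (\<Psi> m) (stratum_stab G \<G> M \<rho> X) = A X)"

end

theory Submission
  imports Defs
begin

text \<open>
  Let \<open>m\<close> be a point, \<open>X\<close> its stratum, and extend \<open>A(X)\<close> to a functional \<open>\<alpha>\<close> on the whole Lie algebra.
  Near \<open>m\<close> the constant map \<open>\<alpha>\<close> is associated with \<open>A\<close>, because every stratum \<open>Y\<close> that comes close to \<open>m\<close>
  has a stabilizer contained in that of \<open>X\<close> and contains all of \<open>X\<close> in its closure
  (\<open>stratum_subset_closure\<close>), so that \<open>A(Y)\<close> is the restriction of \<open>A(X)\<close>. These constants are glued by a
  \<open>G\<close>-invariant partition of unity. All of them that contribute at a point \<open>x\<close> restrict to the same functional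
  \<open>A(stratum x)\<close> on the stabilizer of \<open>x\<close>, hence so does their convex combination \<open>\<Psi>(x)\<close>. If \<open>x\<close> is
  fixed by \<open>H\<close>, the Lie algebra of \<open>H\<close> lies in the stabilizer of \<open>x\<close>; the same comparison of strata
  near \<open>m\<close> then shows that the restriction of \<open>\<Psi>\<close> is locally constant on the fixed points of \<open>H\<close>.

  The heart of the matter is the frontier condition for the strata. It comes from coordinates around
  \<open>m\<close> with values in a convex set, in which the stabilizer of \<open>m\<close> acts linearly and accounts for all
  infinitesimal symmetries of nearby points (\<open>linearization\<close>). A segment from a point of the stratum
  of \<open>m\<close> to a point \<open>x\<close> then has constant stabilizer, except at its starting point, so the stratum of
  \<open>x\<close> reaches the stratum of \<open>m\<close>.

  The coordinates are made of weight functions: smooth complex functions which the torus multiplies by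
  a character. Fourier series along the circles that generate the torus decompose any smooth function
  into weight functions, so these separate tangent vectors at \<open>m\<close>. Take finitely many weight functions
  \<open>h\<close> whose differentials \<open>D\<^sub>h\<close> at \<open>m\<close> have no common kernel, and let \<open>\<psi>\<close> be the sum of the functions
  \<open>D\<^sub>h\<^sup>* h\<close>. Its differential at \<open>m\<close> is the sum of the \<open>D\<^sub>h\<^sup>* D\<^sub>h\<close>, which is positive definite, and \<open>\<psi>\<close>
  is equivariant under the stabilizer of \<open>m\<close> because the adjoints \<open>D\<^sub>h\<^sup>*\<close> turn the characters into the
  transposed isotropy representation. Moreover, an \<open>h\<close> that does not vanish at \<open>m\<close> does not vanish
  nearby, and then its character is trivial on every subgroup that fixes a nearby point; this is why
  stabilizers do not grow near \<open>m\<close>. Finally, squared moduli of weight functions are invariant, which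
  yields the invariant partition of unity.
\<close>

section \<open>Calculus of smooth maps on open sets\<close>

definition Cinf :: "'a::euclidean_space set \<Rightarrow> ('a \<Rightarrow> 'b::euclidean_space) \<Rightarrow> bool" where
  "Cinf U f \<longleftrightarrow> (\<forall>k. Ck_on k U f)"

lemma Ck_on_cong:
  assumes "Ck_on k U f" "open U" "\<And>x. x \<in> U \<Longrightarrow> f x = g x"
  shows "Ck_on k U g"
  using assms
proof (induction k arbitrary: f g)
  case 0
  then show ?case by (auto cong: continuous_on_cong)
next
  case (Suc k)
  have der: "(g has_derivative frechet_derivative f (at x)) (at x)" if "x \<in> U" for x
  proof -
    have "(f has_derivative frechet_derivative f (at x)) (at x)"
      using Suc.prems(1) that by (simp add: frechet_derivative_works)
    then show ?thesis
      by (rule has_derivative_transform_within_open[OF _ Suc.prems(2) that])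
         (use Suc.prems(3) in auto)
  qed
  then have eq: "frechet_derivative g (at x) = frechet_derivative f (at x)" if "x \<in> U" for x
    using that frechet_derivative_at by metis
  show ?case
    unfolding Ck_on.simps
  proof (intro conjI ballI allI)
    fix x assume "x \<in> U"
    then show "g differentiable at x" using der differentiable_def by blast
  next
    fix v
    have "Ck_on k U (\<lambda>x. frechet_derivative f (at x) v)" using Suc.prems(1) by simp
    then show "Ck_on k U (\<lambda>x. frechet_derivative g (at x) v)"
      by (rule Suc.IH) (use Suc.prems(2) eq in auto)
  qed
qed

lemma Ck_on_subset: "Ck_on k U f \<Longrightarrow> V \<subseteq> U \<Longrightarrow> Ck_on k V f"
  by (induction k arbitrary: f) (auto intro: continuous_on_subset)

lemma Ck_on_local:
  assumes "\<And>x. x \<in> U \<Longrightarrow> \<exists>W. open W \<and> x \<in> W \<and> Ck_on k W f"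
  shows "Ck_on k U f"
  using assms
proof (induction k arbitrary: f)
  case 0
  then show ?case
    by (metis Ck_on.simps(1) continuous_at_imp_continuous_on continuous_on_eq_continuous_at)
next
  case (Suc k)
  show ?case
    unfolding Ck_on.simps
  proof (intro conjI ballI allI)
    fix x assume "x \<in> U"
    then show "f differentiable at x" using Suc.prems by (metis Ck_on.simps(2))
  next
    fix v
    show "Ck_on k U (\<lambda>x. frechet_derivative f (at x) v)"
      by (rule Suc.IH) (metis Ck_on.simps(2) Suc.prems)
  qed
qed

lemma Ck_on_SucI:
  assumes "open U" "\<And>x. x \<in> U \<Longrightarrow> (f has_derivative f' x) (at x)"
    and "\<And>v. Ck_on k U (\<lambda>x. f' x v)"
  shows "Ck_on (Suc k) U f"
  unfolding Ck_on.simps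
proof (intro conjI ballI allI)
  fix x assume "x \<in> U"
  then show "f differentiable at x" using assms(2) differentiable_def by blast
next
  fix v
  show "Ck_on k U (\<lambda>x. frechet_derivative f (at x) v)"
    by (rule Ck_on_cong[OF assms(3)[of v] assms(1)]) (metis assms(2) frechet_derivative_at)
qed

lemma Ck_on_has_derivative:
  "Ck_on (Suc k) U f \<Longrightarrow> x \<in> U \<Longrightarrow> (f has_derivative frechet_derivative f (at x)) (at x)"
  by (simp add: frechet_derivative_works)

lemma Ck_on_Suc_imp: "Ck_on (Suc k) U f \<Longrightarrow> Ck_on k U f"
proof (induction k arbitrary: f)
  case 0
  then show ?case
    by (auto intro!: continuous_at_imp_continuous_on differentiable_imp_continuous_within)
next
  case (Suc k)
  then show ?case by (metis Ck_on.simps(2))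
qed

lemma Ck_on_const: "Ck_on k U (\<lambda>x. c)"
  by (induction k arbitrary: c) (auto simp: frechet_derivative_const)

lemma Ck_on_bounded_linear:
  assumes "bounded_linear f" shows "Ck_on k U f"
proof (cases k)
  case 0
  then show ?thesis using assms by (simp add: linear_continuous_on)
next
  case (Suc j)
  have d: "(f has_derivative f) (at x)" for x
    using assms by (rule bounded_linear_imp_has_derivative)
  then have "frechet_derivative f (at x) = f" for x
    using frechet_derivative_at by metis
  moreover have "f differentiable at x" for x using d differentiable_def by blast
  ultimately show ?thesis using Suc by (simp add: Ck_on_const)
qed

lemma Ck_on_add:
  assumes "open U" "Ck_on k U f" "Ck_on k U g"
  shows "Ck_on k U (\<lambda>x. f x + g x)"
  using assms(2,3)
proof (induction k arbitrary: f g)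
  case 0
  then show ?case by (auto intro: continuous_intros)
next
  case (Suc k)
  show ?case
  proof (rule Ck_on_SucI[OF assms(1)])
    fix x assume x: "x \<in> U"
    show "((\<lambda>x. f x + g x) has_derivative
        (\<lambda>v. frechet_derivative f (at x) v + frechet_derivative g (at x) v)) (at x)"
      by (intro has_derivative_add Ck_on_has_derivative[OF _ x]) (use Suc.prems in blast)+
  next
    fix v show "Ck_on k U (\<lambda>x. frechet_derivative f (at x) v + frechet_derivative g (at x) v)"
      using Suc by auto
  qed
qed

lemma Ck_on_sum:
  assumes "open U" "\<And>i. i \<in> I \<Longrightarrow> Ck_on k U (f i)"
  shows "Ck_on k U (\<lambda>x. \<Sum>i\<in>I. f i x)"
  using assms(2)
  by (induction I rule: infinite_finite_induct) (auto simp: Ck_on_const intro: Ck_on_add[OF assms(1)])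

lemma Ck_on_bilinear:
  assumes bil: "bounded_bilinear mul" and U: "open U" and "Ck_on k U f" "Ck_on k U g"
  shows "Ck_on k U (\<lambda>x. mul (f x) (g x))"
  using assms(3,4)
proof (induction k arbitrary: f g)
  case 0
  then show ?case using bounded_bilinear.continuous_on[OF bil] by auto
next
  case (Suc k)
  show ?case
  proof (rule Ck_on_SucI[OF U])
    fix x assume x: "x \<in> U"
    show "((\<lambda>x. mul (f x) (g x)) has_derivative
       (\<lambda>v. mul (f x) (frechet_derivative g (at x) v) + mul (frechet_derivative f (at x) v) (g x))) (at x)"
      by (intro bounded_bilinear.FDERIV[OF bil] Ck_on_has_derivative[OF _ x]) (use Suc.prems in blast)+
  next
    fix v
    show "Ck_on k U (\<lambda>x. mul (f x) (frechet_derivative g (at x) v) + mul (frechet_derivative f (at x) v) (g x))"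
      by (intro Ck_on_add[OF U] Suc.IH) (use Suc.prems Ck_on_Suc_imp in auto)
  qed
qed

text \<open>The direction in which \<open>g\<close> is differentiated in the chain rule varies with the point. Expanding it in
  a basis reduces to derivatives of \<open>g\<close> in constant directions, to which the induction hypothesis applies.\<close>

lemma Ck_on_compose:
  assumes U: "open U" and "Ck_on k U f" "Ck_on k V g" "f ` U \<subseteq> V"
  shows "Ck_on k U (\<lambda>x. g (f x))"
  using assms(2-4)
proof (induction k arbitrary: g)
  case 0
  then show ?case using continuous_on_compose2 by auto
next
  case (Suc k)
  let ?f' = "\<lambda>x. frechet_derivative f (at x)" and ?g' = "\<lambda>y. frechet_derivative g (at y)"
  have lin: "linear (?g' (f x))" if "x \<in> U" for x
    using Ck_on_has_derivative[OF Suc.prems(2)] that Suc.prems(3)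
    by (meson has_derivative_bounded_linear bounded_linear.linear image_subset_iff)
  have eq: "?g' (f x) (?f' x v) = (\<Sum>b\<in>Basis. (?f' x v \<bullet> b) *\<^sub>R ?g' (f x) b)" if "x \<in> U" for x v
    by (subst euclidean_representation[of "?f' x v", symmetric])
       (simp add: linear_sum[OF lin[OF that]] linear_cmul[OF lin[OF that]])
  show ?case
  proof (rule Ck_on_SucI[OF U])
    fix x assume x: "x \<in> U"
    show "((\<lambda>x. g (f x)) has_derivative (\<lambda>v. \<Sum>b\<in>Basis. (?f' x v \<bullet> b) *\<^sub>R ?g' (f x) b)) (at x)"
      using has_derivative_compose[OF Ck_on_has_derivative[OF Suc.prems(1) x]
          Ck_on_has_derivative[OF Suc.prems(2), of "f x"]] x Suc.prems(3)
      by (auto simp: eq[OF x])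
  next
    fix v
    have "Ck_on k U (\<lambda>x. ?g' (f x) b)" for b
      by (rule Suc.IH) (use Suc.prems Ck_on_Suc_imp[OF Suc.prems(1)] in auto)
    moreover have "Ck_on k U (\<lambda>x. ?f' x v \<bullet> b)" for b
      by (rule Ck_on_bilinear[OF bounded_bilinear_inner U _ Ck_on_const]) (use Suc.prems in auto)
    ultimately show "Ck_on k U (\<lambda>x. \<Sum>b\<in>Basis. (?f' x v \<bullet> b) *\<^sub>R ?g' (f x) b)"
      by (intro Ck_on_sum[OF U] Ck_on_bilinear[OF bounded_bilinear_scaleR U])
  qed
qed

lemma Cinf_cong: "Cinf U f \<Longrightarrow> open U \<Longrightarrow> (\<And>x. x \<in> U \<Longrightarrow> f x = g x) \<Longrightarrow> Cinf U g"
  unfolding Cinf_def by (blast intro: Ck_on_cong)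

lemma Cinf_subset: "Cinf U f \<Longrightarrow> V \<subseteq> U \<Longrightarrow> Cinf V f"
  unfolding Cinf_def by (blast intro: Ck_on_subset)

lemma Cinf_local: "(\<And>x. x \<in> U \<Longrightarrow> \<exists>W. open W \<and> x \<in> W \<and> Cinf W f) \<Longrightarrow> Cinf U f"
  unfolding Cinf_def by (meson Ck_on_local)

lemma Cinf_const: "Cinf U (\<lambda>x. c)"
  by (simp add: Cinf_def Ck_on_const)

lemma Cinf_bounded_linear: "bounded_linear f \<Longrightarrow> Cinf U f"
  by (simp add: Cinf_def Ck_on_bounded_linear)

lemma Cinf_id: "Cinf U (\<lambda>x. x)"
  by (simp add: Cinf_bounded_linear)

lemma Cinf_add: "open U \<Longrightarrow> Cinf U f \<Longrightarrow> Cinf U g \<Longrightarrow> Cinf U (\<lambda>x. f x + g x)"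
  by (simp add: Cinf_def Ck_on_add)

lemma Cinf_sum: "open U \<Longrightarrow> (\<And>i. i \<in> I \<Longrightarrow> Cinf U (f i)) \<Longrightarrow> Cinf U (\<lambda>x. \<Sum>i\<in>I. f i x)"
  by (simp add: Cinf_def Ck_on_sum)

lemma Cinf_bilinear:
  "bounded_bilinear mul \<Longrightarrow> open U \<Longrightarrow> Cinf U f \<Longrightarrow> Cinf U g \<Longrightarrow> Cinf U (\<lambda>x. mul (f x) (g x))"
  by (simp add: Cinf_def Ck_on_bilinear)

lemmas Cinf_scaleR = Cinf_bilinear[OF bounded_bilinear_scaleR]
lemmas Cinf_mult = Cinf_bilinear[OF bounded_bilinear_mult]
lemmas Cinf_inner = Cinf_bilinear[OF bounded_bilinear_inner]

lemma Cinf_compose: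
  "open U \<Longrightarrow> Cinf U f \<Longrightarrow> Cinf V g \<Longrightarrow> f ` U \<subseteq> V \<Longrightarrow> Cinf U (\<lambda>x. g (f x))"
  unfolding Cinf_def by (blast intro: Ck_on_compose)

lemma Cinf_linear_compose:
  "bounded_linear l \<Longrightarrow> open U \<Longrightarrow> Cinf U f \<Longrightarrow> Cinf U (\<lambda>x. l (f x))"
  by (rule Cinf_compose[OF _ _ Cinf_bounded_linear[of l UNIV]]) auto

lemma Cinf_diff: "open U \<Longrightarrow> Cinf U f \<Longrightarrow> Cinf U g \<Longrightarrow> Cinf U (\<lambda>x. f x - g x)"
  using Cinf_add[of U f "\<lambda>x. - g x"] Cinf_linear_compose[of uminus U g]
  by (simp add: bounded_linear_minus)

lemma Cinf_Pair:
  assumes "open U" "Cinf U f" "Cinf U g" shows "Cinf U (\<lambda>x. (f x, g x))"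
proof -
  have 1: "bounded_linear (\<lambda>y::'b. (y, 0::'c))" and 2: "bounded_linear (\<lambda>z::'c. (0::'b, z))"
    by (intro bounded_linear_Pair bounded_linear_zero bounded_linear_ident)+
  show ?thesis
    using Cinf_add[OF assms(1) Cinf_linear_compose[OF 1 assms(1,2)] Cinf_linear_compose[OF 2 assms(1,3)]]
    by simp
qed

lemma Cinf_frechet_derivative: "Cinf U f \<Longrightarrow> Cinf U (\<lambda>x. frechet_derivative f (at x) v)"
  unfolding Cinf_def by (metis Ck_on.simps(2))

lemma Cinf_has_derivative:
  "Cinf U f \<Longrightarrow> x \<in> U \<Longrightarrow> (f has_derivative frechet_derivative f (at x)) (at x)"
  unfolding Cinf_def by (meson Ck_on_has_derivative)

lemma Cinf_continuous_on: "Cinf U f \<Longrightarrow> continuous_on U f"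
  unfolding Cinf_def by (metis Ck_on.simps(1))

lemma Cinf_induct_SucI:
  assumes "Ck_on 0 U f" "\<And>k. Ck_on k U f \<Longrightarrow> Ck_on (Suc k) U f"
  shows "Cinf U f"
  unfolding Cinf_def
proof
  fix k show "Ck_on k U f" by (induction k) (use assms in auto)
qed

lemma Cinf_inverse: "Cinf (- {0}) (inverse :: real \<Rightarrow> real)"
proof (rule Cinf_induct_SucI)
  show "Ck_on 0 (- {0}) (inverse :: real \<Rightarrow> real)"
    by (auto intro!: continuous_intros)
next
  fix k assume k: "Ck_on k (- {0}) (inverse :: real \<Rightarrow> real)"
  have o: "open (- {0::real})" by auto
  show "Ck_on (Suc k) (- {0}) (inverse :: real \<Rightarrow> real)"
  proof (rule Ck_on_SucI[OF o])
    fix x :: real assume "x \<in> - {0}"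
    then show "(inverse has_derivative (\<lambda>v. - (inverse x * v * inverse x))) (at x)"
      using has_derivative_inverse'[of x UNIV] by auto
  next
    fix v
    have "Ck_on k (- {0}) (\<lambda>x::real. (- v) * (inverse x * inverse x))"
      by (intro Ck_on_bilinear[OF bounded_bilinear_mult o] k Ck_on_const)
    then show "Ck_on k (- {0}) (\<lambda>x::real. - (inverse x * v * inverse x))"
      by (simp add: mult_ac)
  qed
qed

lemma Cinf_cis_linear: "Cinf UNIV (\<lambda>t::real. cis (a * t))"
proof (rule Cinf_induct_SucI)
  show "Ck_on 0 UNIV (\<lambda>t. cis (a * t))"
    by (auto intro!: continuous_intros)
next
  fix k assume k: "Ck_on k UNIV (\<lambda>t. cis (a * t))"
  show "Ck_on (Suc k) UNIV (\<lambda>t. cis (a * t))"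
  proof (rule Ck_on_SucI)
    fix x :: real
    show "((\<lambda>t. cis (a * t)) has_derivative (\<lambda>v. v *\<^sub>R (a *\<^sub>R (\<i> * cis (a * x))))) (at x)"
      by (auto intro!: derivative_eq_intros simp: algebra_simps)
  next
    fix v
    show "Ck_on k UNIV (\<lambda>x. v *\<^sub>R (a *\<^sub>R (\<i> * cis (a * x))))"
      by (intro Ck_on_bilinear[OF bounded_bilinear_scaleR] Ck_on_bilinear[OF bounded_bilinear_mult] k
          Ck_on_const open_UNIV)
  qed auto
qed

section \<open>A smooth cutoff function\<close>

text \<open>The functions \<open>p (1/x) e\<^bsup>-1/x\<^esup>\<close>, \<open>p\<close> a polynomial, are closed under differentiation, and tend to
  \<open>0\<close> faster than \<open>x\<close> at the origin. This is why \<open>e\<^bsup>-1/x\<^esup>\<close> extends smoothly by zero.\<close>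

definition flat :: "real poly \<Rightarrow> real \<Rightarrow> real" where
  "flat p x = (if x > 0 then poly p (inverse x) * exp (- inverse x) else 0)"

lemma flat_tendsto_0: "(flat p \<longlongrightarrow> 0) (at_right 0)"
proof -
  have "((\<lambda>y. poly p y * exp (- y)) \<longlongrightarrow> 0) at_top"
  proof -
    have "((\<lambda>y. \<Sum>i\<le>degree p. coeff p i * (y ^ i / exp y)) \<longlongrightarrow> (\<Sum>i\<le>degree p. coeff p i * 0)) at_top"
      by (intro tendsto_intros tendsto_power_div_exp_0)
    then show ?thesis
      by (simp add: poly_altdef sum_distrib_right exp_minus divide_inverse mult.assoc)
  qed
  then have "((\<lambda>x. poly p (inverse x) * exp (- inverse x)) \<longlongrightarrow> 0) (at_right (0::real))"
    by (rule filterlim_compose[OF _ filterlim_inverse_at_top_right])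
  moreover have "eventually (\<lambda>x. poly p (inverse x) * exp (- inverse x) = flat p x) (at_right (0::real))"
    by (auto simp: eventually_at_filter flat_def)
  ultimately show ?thesis by (rule Lim_transform_eventually)
qed

lemma flat_tendsto_0_left: "(flat p \<longlongrightarrow> 0) (at_left 0)"
proof -
  have "eventually (\<lambda>x. 0 = flat p x) (at_left (0::real))"
    by (auto simp: eventually_at_filter flat_def)
  then show ?thesis by (rule Lim_transform_eventually[OF tendsto_const])
qed

lemma flat_has_real_derivative:
  "(flat p has_real_derivative flat (pCons 0 (pCons 0 (p - pderiv p))) x) (at x)"
proof -
  consider "x < 0" | "x = 0" | "x > 0" by linarith
  then show ?thesis
  proof cases
    case 1
    have "((\<lambda>x. 0) has_real_derivative 0) (at x)" by simp
    then have "(flat p has_real_derivative 0) (at x)"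
      by (rule has_field_derivative_transform_within_open[of _ _ _ "{..<0}"]) (use 1 in \<open>auto simp: flat_def\<close>)
    then show ?thesis using 1 by (simp add: flat_def)
  next
    case 2
    have "((\<lambda>h. flat p h / h) \<longlongrightarrow> 0) (at 0)"
    proof (rule filterlim_split_at)
      show "((\<lambda>h. flat p h / h) \<longlongrightarrow> 0) (at_right 0)"
        by (rule Lim_transform_eventually[OF flat_tendsto_0[of "pCons 0 p"]])
           (auto simp: eventually_at_filter flat_def field_simps)
      show "((\<lambda>h. flat p h / h) \<longlongrightarrow> 0) (at_left 0)"
        by (rule Lim_transform_eventually[OF flat_tendsto_0_left[of "pCons 0 p"]])
           (auto simp: eventually_at_filter flat_def field_simps)
    qed
    then show ?thesis using 2 by (simp add: DERIV_def flat_def)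
  next
    case 3
    have "((\<lambda>x. poly p (inverse x) * exp (- inverse x)) has_real_derivative
        flat (pCons 0 (pCons 0 (p - pderiv p))) x) (at x)"
      using 3 by (auto intro!: derivative_eq_intros simp: flat_def field_simps power2_eq_square)
    then show ?thesis
      by (rule has_field_derivative_transform_within_open[of _ _ _ "{0<..}"]) (use 3 in \<open>auto simp: flat_def\<close>)
  qed
qed

lemma Cinf_flat: "Cinf UNIV (flat p)"
proof -
  have "Ck_on k UNIV (flat p)" for k
  proof (induction k arbitrary: p)
    case 0
    then show ?case
      by (auto intro!: continuous_at_imp_continuous_on DERIV_isCont flat_has_real_derivative)
  next
    case (Suc k)
    show ?case
    proof (rule Ck_on_SucI)
      fix x show "(flat p has_derivative (\<lambda>v. v * flat (pCons 0 (pCons 0 (p - pderiv p))) x)) (at x)"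
        using flat_has_real_derivative[of p x] by (simp add: has_field_derivative_def mult_commute_abs)
    next
      fix v show "Ck_on k UNIV (\<lambda>x. v * flat (pCons 0 (pCons 0 (p - pderiv p))) x)"
        by (intro Ck_on_bilinear[OF bounded_bilinear_mult] Suc Ck_on_const open_UNIV)
    qed auto
  qed
  then show ?thesis by (simp add: Cinf_def)
qed

definition cutoff :: "real \<Rightarrow> real" where
  "cutoff = flat 1"

lemma Cinf_cutoff: "Cinf UNIV cutoff"
  by (simp add: cutoff_def Cinf_flat)

lemma cutoff_pos_iff: "cutoff x > 0 \<longleftrightarrow> x > 0" and cutoff_nonneg: "cutoff x \<ge> 0"
  and cutoff_eq_0_iff: "cutoff x = 0 \<longleftrightarrow> x \<le> 0"
  by (auto simp: cutoff_def flat_def)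

section \<open>Integrals depending smoothly on a parameter\<close>

text \<open>Differentiation under the integral sign. The Leibniz rule asks for a convex domain and for a derivative
  that is continuous as an operator; the first is met by passing to a ball, the second by checking
  continuity on basis vectors.\<close>

lemma integral_has_derivative_parameter:
  fixes H :: "real \<times> 'a::euclidean_space \<Rightarrow> 'b::euclidean_space"
  assumes U: "open U" and H: "Ck_on (Suc k) (UNIV \<times> U) H" and u: "u \<in> U"
  shows "((\<lambda>u. integral {0..1} (\<lambda>t. H (t, u))) has_derivative
           (\<lambda>v. integral {0..1} (\<lambda>t. frechet_derivative H (at (t, u)) (0, v)))) (at u)"
proof -
  obtain e where e: "e > 0" "ball u e \<subseteq> U" using U u open_contains_ball by blast
  let ?D = "\<lambda>x t. Blinfun (\<lambda>v. frechet_derivative H (at (t, x)) (0, v))"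
  have der: "(H has_derivative frechet_derivative H (at (t, x))) (at (t, x))" if "x \<in> U" for x t
    by (rule Ck_on_has_derivative[OF H]) (use that in auto)
  have bl: "bounded_linear (\<lambda>v. frechet_derivative H (at (t, x)) (0, v))" if "x \<in> U" for x t
    using bounded_linear_compose[OF has_derivative_bounded_linear[OF der[OF that]],
        of "\<lambda>v. (0, v)"] bounded_linear_Pair[OF bounded_linear_zero bounded_linear_ident] by blast
  have app: "blinfun_apply (?D x t) v = frechet_derivative H (at (t, x)) (0, v)" if "x \<in> U" for x t v
    using bl[OF that] by (simp add: bounded_linear_Blinfun_apply)
  then have appf: "blinfun_apply (?D x t) = (\<lambda>v. frechet_derivative H (at (t, x)) (0, v))" if "x \<in> U" for x t
    using that by blast
  have cont: "continuous_on (UNIV \<times> U) (\<lambda>p. frechet_derivative H (at p) w)" for w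
  proof -
    have "Ck_on k (UNIV \<times> U) (\<lambda>p. frechet_derivative H (at p) w)" using H by (metis Ck_on.simps(2))
    then have "Ck_on 0 (UNIV \<times> U) (\<lambda>p. frechet_derivative H (at p) w)"
      by (induction k) (auto simp: Ck_on_Suc_imp simp del: Ck_on.simps)
    then show ?thesis by simp
  qed
  have cont': "continuous_on (ball u e \<times> cbox 0 1) (\<lambda>(x, t). frechet_derivative H (at (t, x)) w)" for w
    unfolding case_prod_unfold
    by (rule continuous_on_compose2[OF cont[of w]]) (use e in \<open>auto intro!: continuous_intros\<close>)
  have contH: "continuous_on (UNIV \<times> U) H"
    by (auto intro!: continuous_at_imp_continuous_on has_derivative_continuous der)
  have "((\<lambda>x. integral (cbox 0 1) (\<lambda>t. H (t, x))) has_derivative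
          blinfun_apply (integral (cbox 0 1) (?D u))) (at u within ball u e)"
  proof (rule leibniz_rule)
    fix x and t :: real assume x: "x \<in> ball u e"
    have "((\<lambda>x. H (t, x)) has_derivative (\<lambda>v. frechet_derivative H (at (t, x)) (0, v))) (at x)"
      by (rule has_derivative_compose[of "Pair t" "Pair 0" x UNIV H, OF _ der])
         (use x e in \<open>auto intro!: derivative_eq_intros\<close>)
    then show "((\<lambda>x. H (t, x)) has_derivative blinfun_apply (?D x t)) (at x within ball u e)"
      unfolding appf[OF subsetD[OF e(2) x]] by (rule has_derivative_at_withinI)
  next
    fix x assume "x \<in> ball u e"
    then show "(\<lambda>t. H (t, x)) integrable_on cbox 0 1"
      using e by (intro integrable_continuous continuous_on_compose2[OF contH]) (auto intro!: continuous_intros)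
  next
    show "continuous_on (ball u e \<times> cbox 0 1) (\<lambda>(x, t). ?D x t)"
    proof (rule continuous_on_blinfun_componentwise)
      fix i :: 'a assume "i \<in> Basis"
      have "\<And>p. p \<in> ball u e \<times> cbox 0 1 \<Longrightarrow>
          (case p of (x, t) \<Rightarrow> frechet_derivative H (at (t, x)) (0, i)) = blinfun_apply (case p of (x, t) \<Rightarrow> ?D x t) i"
        using e app by (auto simp: subset_iff)
      then show "continuous_on (ball u e \<times> cbox 0 1) (\<lambda>p. blinfun_apply (case p of (x, t) \<Rightarrow> ?D x t) i)"
        using cont'[of "(0, i)"] by (subst (asm) continuous_on_cong) auto
    qed
  qed (use e in auto)
  moreover have "blinfun_apply (integral (cbox 0 1) (?D u))
      = (\<lambda>v. integral (cbox 0 1) (\<lambda>t. frechet_derivative H (at (t, u)) (0, v)))"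
  proof
    fix v
    have "continuous_on (cbox 0 1) (?D u)"
    proof (rule continuous_on_blinfun_componentwise)
      fix i :: 'a assume "i \<in> Basis"
      show "continuous_on (cbox 0 1) (\<lambda>t. blinfun_apply (?D u t) i)"
        unfolding app[OF u] by (intro continuous_on_compose2[OF cont]) (use u in \<open>auto intro!: continuous_intros\<close>)
    qed
    then show "blinfun_apply (integral (cbox 0 1) (?D u)) v
      = integral (cbox 0 1) (\<lambda>t. frechet_derivative H (at (t, u)) (0, v))"
      using integral_linear[OF integrable_continuous bounded_linear_apply_blinfun, of 0 1 "?D u" v]
      by (simp add: o_def app[OF u])
  qed
  ultimately show ?thesis
    using e(1) at_within_open[of u "ball u e"] by simp
qed

lemma Ck_on_integral_parameter:
  fixes H :: "real \<times> 'a::euclidean_space \<Rightarrow> 'b::euclidean_space"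
  assumes U: "open U"
  shows "Ck_on k (UNIV \<times> U) H \<Longrightarrow> Ck_on k U (\<lambda>u. integral {0..1} (\<lambda>t. H (t, u)))"
proof (induction k arbitrary: H)
  case 0
  have "continuous_on (U \<times> cbox 0 1) (\<lambda>(u, t). H (t, u))"
    unfolding case_prod_unfold
    by (rule continuous_on_compose2[of "UNIV \<times> U" H]) (use 0 in \<open>auto intro!: continuous_intros\<close>)
  then show ?case
    using integral_continuous_on_param[of U 0 1 "\<lambda>u t. H (t, u)"] by simp
next
  case (Suc k)
  show ?case
  proof (rule Ck_on_SucI[OF U integral_has_derivative_parameter[OF U Suc.prems]])
    fix v show "Ck_on k U (\<lambda>x. integral {0..1} (\<lambda>t. frechet_derivative H (at (t, x)) (0, v)))"
      using Suc.prems by (intro Suc.IH) auto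
  qed
qed

lemma Cinf_integral_parameter:
  fixes H :: "real \<times> 'a::euclidean_space \<Rightarrow> 'b::euclidean_space"
  shows "open U \<Longrightarrow> Cinf (UNIV \<times> U) H \<Longrightarrow> Cinf U (\<lambda>u. integral {0..1} (\<lambda>t. H (t, u)))"
  by (simp add: Cinf_def Ck_on_integral_parameter)

section \<open>Fourier coefficients of continuous periodic functions\<close>

lemma integral_periodic_shift:
  fixes p :: "real \<Rightarrow> 'a::euclidean_space"
  assumes cont: "continuous_on UNIV p" and per: "\<And>t. p (t + 1) = p t"
  shows "integral {0..1} (\<lambda>t. p (t + s)) = integral {0..1} p"
proof -
  have int: "p integrable_on {a..b}" for a b
    using cont by (intro integrable_continuous_real) (auto intro: continuous_on_subset)
  have shift: "integral {a..b} (\<lambda>t. p (t + c)) = integral {a + c..b + c} p" for a b c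
    using integral_shift[of a c b p] cont by (simp add: o_def algebra_simps continuous_on_subset)
  have unit: "integral {a..a + 1} p = integral {0..1} p" if "0 \<le> a" "a < 1" for a :: real
  proof -
    have "integral {a..1} p + integral {1..a + 1} p = integral {a..a + 1} p"
      by (rule Henstock_Kurzweil_Integration.integral_combine) (use that int in auto)
    moreover have "integral {0..a} p + integral {a..1} p = integral {0..1} p"
      by (rule Henstock_Kurzweil_Integration.integral_combine) (use that int in auto)
    moreover have "integral {1..a + 1} p = integral {0..a} p"
      using shift[of 0 a 1] per by (simp add: add.commute)
    ultimately show ?thesis by (metis add.commute)
  qed
  \<comment> \<open>By periodicity the shift may be taken in \<open>[0, 1)\<close>, where the interval is cut at \<open>1\<close>.\<close>
  have per_int: "p (t + of_int n) = p t" for t n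
  proof (induction n rule: int_induct[where k = 0])
    case base show ?case by simp
  next
    case (step1 i) show ?case using per[of "t + of_int i"] step1 by (simp add: add.assoc)
  next
    case (step2 i) show ?case using per[of "t + of_int (i - 1)"] step2 by (simp add: algebra_simps)
  qed
  have "integral {0..1} (\<lambda>t. p (t + s)) = integral {0..1} (\<lambda>t. p (t + frac s))"
    using per_int[of "t + frac s" "\<lfloor>s\<rfloor>" for t] by (simp add: frac_def algebra_simps)
  also have "\<dots> = integral {frac s..frac s + 1} p"
    using shift[of 0 1 "frac s"] by (simp add: add.commute)
  also have "\<dots> = integral {0..1} p"
    by (rule unit) (auto simp: frac_lt_1)
  finally show ?thesis .
qed

text \<open>The characters of the circle \<open>\<real>/\<int>\<close>.\<close>

definition ecirc :: "int \<Rightarrow> real \<Rightarrow> complex" where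
  "ecirc k t = cis (2 * pi * of_int k * t)"

lemma ecirc_add: "ecirc k (s + t) = ecirc k s * ecirc k t"
  by (simp add: ecirc_def cis_mult algebra_simps)

lemma ecirc_add_index: "ecirc (j + k) t = ecirc j t * ecirc k t"
  by (simp add: ecirc_def cis_mult algebra_simps)

lemma ecirc_0 [simp]: "ecirc 0 t = 1" "ecirc k 0 = 1"
  by (simp_all add: ecirc_def)

lemma ecirc_1 [simp]: "ecirc k 1 = 1"
  by (simp add: ecirc_def complex_eq_iff)

lemma norm_ecirc [simp]: "norm (ecirc k t) = 1"
  by (simp add: ecirc_def)

lemma continuous_on_ecirc [continuous_intros]: "continuous_on S (ecirc k)"
  unfolding ecirc_def by (intro continuous_intros)

lemma Cinf_ecirc: "Cinf UNIV (ecirc k)"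
  unfolding ecirc_def by (rule Cinf_cis_linear)

text \<open>Polynomials in \<open>cos\<close> and \<open>sin\<close> are combinations of the characters. By induction over the
  polynomial this is phrased as: multiplication by such a polynomial keeps all Fourier coefficients
  zero.\<close>

lemma fourier_coeffs_zero_mult_poly:
  fixes q :: "real \<Rightarrow> complex"
  assumes "real_polynomial_function r" "continuous_on {0..1} q"
    and "\<And>k. integral {0..1} (\<lambda>t. ecirc k t * q t) = 0"
  shows "integral {0..1} (\<lambda>t. ecirc k t * (of_real (r (ecirc 1 t)) * q t)) = 0"
  using assms
proof (induction r arbitrary: q k)
  case (linear r)
  let ?\<alpha> = "(of_real (r 1) - \<i> * of_real (r \<i>)) / 2" and ?\<beta> = "(of_real (r 1) + \<i> * of_real (r \<i>)) / 2"
  \<comment> \<open>A real-linear form on \<open>\<complex>\<close> is a combination of \<open>z\<close> and its conjugate, and these are the characters \<open>1\<close> and \<open>-1\<close>.\<close>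
  have r: "of_real (r (ecirc 1 t)) = ?\<alpha> * ecirc 1 t + ?\<beta> * ecirc (-1) t" for t
  proof -
    have "ecirc 1 t = cos (2 * pi * t) *\<^sub>R 1 + sin (2 * pi * t) *\<^sub>R \<i>"
      by (simp add: ecirc_def complex_eq_iff)
    then have "r (ecirc 1 t) = cos (2 * pi * t) * r 1 + sin (2 * pi * t) * r \<i>"
      using linear(1) by (simp add: bounded_linear.linear linear_add linear_cmul)
    then show ?thesis
      by (simp add: ecirc_def complex_eq_iff field_simps)
  qed
  then obtain a b where r: "\<And>t. of_real (r (ecirc 1 t)) = a * ecirc 1 t + b * ecirc (-1) t" by blast
  have int: "(\<lambda>t. c * (ecirc j t * q t)) integrable_on {0..1}" for c j
    by (intro integrable_continuous_real continuous_intros linear)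
  have "(\<lambda>t. ecirc k t * (of_real (r (ecirc 1 t)) * q t))
      = (\<lambda>t. a * (ecirc (k + 1) t * q t) + b * (ecirc (k - 1) t * q t))"
    unfolding r diff_conv_add_uminus ecirc_add_index by (simp add: algebra_simps)
  then show ?case
    by (simp add: Henstock_Kurzweil_Integration.integral_add[OF int int] linear(3))
next
  case (const c)
  have "(\<lambda>t. ecirc k t * (of_real c * q t)) = (\<lambda>t. of_real c * (ecirc k t * q t))" by auto
  then show ?case using const by simp
next
  case (add f g)
  have cont: "continuous_on {0..1} (\<lambda>t. of_real (h (ecirc 1 t)) :: complex)" if "real_polynomial_function h" for h
    by (intro continuous_intros continuous_on_compose2[OF continuous_on_polymonial_function[of h UNIV]])
       (use that in \<open>auto simp: real_polynomial_function_eq\<close>)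
  have "integral {0..1} (\<lambda>t. ecirc k t * (of_real (f (ecirc 1 t)) * q t) + ecirc k t * (of_real (g (ecirc 1 t)) * q t)) = 0"
    by (subst Henstock_Kurzweil_Integration.integral_add)
       (auto intro!: integrable_continuous_real continuous_intros add cont simp: add)
  then show ?case by (simp add: algebra_simps)
next
  case (mult f g)
  have cont: "continuous_on {0..1} (\<lambda>t. of_real (g (ecirc 1 t)) :: complex)"
    by (intro continuous_intros continuous_on_compose2[OF continuous_on_polymonial_function[of g UNIV]])
       (use mult in \<open>auto simp: real_polynomial_function_eq\<close>)
  have "integral {0..1} (\<lambda>t. ecirc k t * (of_real (f (ecirc 1 t)) * (of_real (g (ecirc 1 t)) * q t))) = 0"
    by (rule mult.IH(1)) (auto intro!: continuous_intros cont mult)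
  then show ?case by (simp add: algebra_simps)
qed

text \<open>A continuous function on the circle is a uniform limit of such polynomials by the
  Stone--Weierstrass theorem, hence it is orthogonal to itself if all its coefficients vanish.\<close>

lemma fourier_coeffs_zero_imp_zero:
  fixes q :: "real \<Rightarrow> complex"
  assumes cont: "continuous_on {0..1} q" and per: "q 0 = q 1"
    and coeff: "\<And>k. integral {0..1} (\<lambda>t. ecirc k t * q t) = 0" and t: "t \<in> {0..1}"
  shows "q t = 0"
proof -
  define S where "S = sphere (0::complex) 1"
  \<comment> \<open>\<open>q\<close> as a function on the unit circle; it is continuous since the circle is a quotient of \<open>[0, 1]\<close>.\<close>
  define Q where "Q z = q (Arg2pi z / (2 * pi))" for z
  have Qe: "Q (ecirc 1 t) = q t" if "t \<in> {0..1}" for t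
  proof (cases "t = 1")
    case True
    then show ?thesis using per by (simp add: Q_def Arg2pi_of_real[of 1, simplified])
  next
    case False
    have "Arg2pi (ecirc 1 t) = 2 * pi * t"
      by (rule Arg2pi_unique[of 1]) (use that False in \<open>auto simp: ecirc_def cis_conv_exp\<close>)
    then show ?thesis by (simp add: Q_def)
  qed
  have img: "ecirc 1 ` {0..1} = S"
  proof
    show "ecirc 1 ` {0..1} \<subseteq> S" by (auto simp: S_def)
    show "S \<subseteq> ecirc 1 ` {0..1}"
    proof
      fix z assume "z \<in> S"
      then have n: "norm z = 1" by (simp add: S_def)
      have "z = ecirc 1 (Arg2pi z / (2 * pi))"
        using Arg2pi_eq[of z] n by (simp add: ecirc_def cis_conv_exp mult.commute)
      moreover have "Arg2pi z / (2 * pi) \<in> {0..1}"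
        using Arg2pi_ge_0[of z] Arg2pi_lt_2pi[of z] by auto
      ultimately show "z \<in> ecirc 1 ` {0..1}" by blast
    qed
  qed
  have contQ: "continuous_on S Q"
  proof (subst continuous_on_closed_vimage)
    show "closed S" by (simp add: S_def)
    show "\<forall>C. closed C \<longrightarrow> closed (Q -` C \<inter> S)"
    proof (intro allI impI)
      fix C :: "complex set" assume C: "closed C"
      have "Q -` C \<inter> S = ecirc 1 ` ({0..1} \<inter> q -` C)"
        using Qe by (auto simp: img[symmetric])
      moreover have "compact ({0..1} \<inter> q -` C)"
        using continuous_closed_preimage[OF cont _ C] by (simp add: compact_eq_bounded_closed bounded_Int)
      ultimately show "closed (Q -` C \<inter> S)"
        by (simp add: compact_imp_closed compact_continuous_image continuous_on_ecirc)
    qed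
  qed
  have orth: "integral {0..1} (\<lambda>t. g (ecirc 1 t) * q t) = 0" if g: "polynomial_function g" for g :: "complex \<Rightarrow> complex"
  proof -
    have rp: "real_polynomial_function (\<lambda>z. Re (g z))" "real_polynomial_function (\<lambda>z. Im (g z))"
      using g polynomial_function_def[of g] bounded_linear_Re bounded_linear_Im by (auto simp: o_def)
    have c: "continuous_on {0..1} (\<lambda>t. h (ecirc 1 t))" if "real_polynomial_function h" for h
      by (intro continuous_intros continuous_on_compose2[OF continuous_on_polymonial_function[of h UNIV]])
         (use that in \<open>auto simp: real_polynomial_function_eq\<close>)
    have "integral {0..1} (\<lambda>t. of_real (Re (g (ecirc 1 t))) * q t + \<i> * (of_real (Im (g (ecirc 1 t))) * q t)) = 0"
      using fourier_coeffs_zero_mult_poly[OF rp(1) cont coeff, of 0]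
        fourier_coeffs_zero_mult_poly[OF rp(2) cont coeff, of 0]
      by (subst Henstock_Kurzweil_Integration.integral_add)
         (auto intro!: integrable_continuous_real continuous_intros cont c rp)
    moreover have "of_real (Re z) * w + \<i> * (of_real (Im z) * w) = z * w" for z w
      by (metis complex_eq distrib_right mult.assoc)
    ultimately show ?thesis by simp
  qed
  have intq: "(\<lambda>t. (norm (q t))\<^sup>2) integrable_on {0..1}" "(\<lambda>t. norm (q t)) integrable_on {0..1}"
    by (intro integrable_continuous_real continuous_intros cont)+
  define I where "I = integral {0..1} (\<lambda>t. (norm (q t))\<^sup>2)"
  define J where "J = integral {0..1} (\<lambda>t. norm (q t))"
  have J: "J \<ge> 0" unfolding J_def by (rule integral_nonneg[OF intq(2)]) auto
  have bound: "I \<le> e * J" if e: "e > 0" for e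
  proof -
    have "continuous_on S (\<lambda>z. cnj (Q z))" by (intro continuous_intros contQ)
    then obtain g where g: "polynomial_function g" "\<And>z. z \<in> S \<Longrightarrow> norm (cnj (Q z) - g z) < e"
      using Stone_Weierstrass_polynomial_function[of S "\<lambda>z. cnj (Q z)" e] e by (auto simp: S_def)
    have gc: "continuous_on {0..1} (\<lambda>t. g (ecirc 1 t))"
      by (intro continuous_intros continuous_on_compose2[OF continuous_on_polymonial_function[OF g(1), of UNIV]]) auto
    have "of_real I = integral {0..1} (\<lambda>t. of_real ((norm (q t))\<^sup>2) :: complex)"
      unfolding I_def
      using integral_linear[OF intq(1) bounded_linear_of_real[where ?'a = complex]] by (simp add: o_def)
    also have "\<dots> = integral {0..1} (\<lambda>t. cnj (q t) * q t)"
      by (rule integral_cong) (metis complex_norm_square mult.commute)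
    also have "\<dots> = integral {0..1} (\<lambda>t. cnj (q t) * q t) - integral {0..1} (\<lambda>t. g (ecirc 1 t) * q t)"
      using orth[OF g(1)] by simp
    also have "\<dots> = integral {0..1} (\<lambda>t. cnj (q t) * q t - g (ecirc 1 t) * q t)"
      by (rule Henstock_Kurzweil_Integration.integral_diff[symmetric])
         (auto intro!: integrable_continuous_real continuous_intros cont gc)
    finally have "norm (of_real I :: complex) = norm (integral {0..1} (\<lambda>t. cnj (q t) * q t - g (ecirc 1 t) * q t))"
      by simp
    also have "\<dots> \<le> integral {0..1} (\<lambda>t. e * norm (q t))"
    proof (rule integral_norm_bound_integral)
      fix t :: real assume t: "t \<in> {0..1}"
      have "ecirc 1 t \<in> S" using t img by blast
      then have "norm (cnj (q t) - g (ecirc 1 t)) \<le> e"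
        using g(2) Qe[OF t] by (metis less_imp_le)
      then show "norm (cnj (q t) * q t - g (ecirc 1 t) * q t) \<le> e * norm (q t)"
        by (metis left_diff_distrib mult_right_mono norm_ge_zero norm_mult)
    qed (auto intro!: integrable_continuous_real continuous_intros cont gc)
    finally show ?thesis by (simp add: J_def)
  qed
  have "I \<le> 0"
  proof (rule ccontr)
    assume "\<not> I \<le> 0"
    then have "I > 0" by simp
    then have "I \<le> (I / (2 * (J + 1))) * J" using J by (intro bound) auto
    also have "\<dots> < I"
      using \<open>I > 0\<close> J add_nonneg_pos[of "I * J" "I * 2"] by (simp add: field_simps)
    finally show False by simp
  qed
  moreover have "I \<ge> 0" unfolding I_def by (rule integral_nonneg[OF intq(1)]) auto
  ultimately have "((\<lambda>t. (norm (q t))\<^sup>2) has_integral 0) {0..1}"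
    using integrable_integral[OF intq(1)] by (simp add: I_def)
  moreover have "continuous_on (cbox 0 1) (\<lambda>t. (norm (q t))\<^sup>2)"
    using cont by (auto intro!: continuous_intros)
  ultimately have "(norm (q t))\<^sup>2 = 0"
    using has_integral_0_cbox_imp_0[of 0 1 "\<lambda>t. (norm (q t))\<^sup>2" t] t by auto
  then show ?thesis by simp
qed

section \<open>Orthogonal projections\<close>

text \<open>Charts take values in a linear subspace. Composing their inverses with the orthogonal projection makes
  coordinate expressions into functions on open subsets of the ambient space, where derivatives make sense.\<close>

definition oproj :: "'a::euclidean_space set \<Rightarrow> 'a \<Rightarrow> 'a" where
  "oproj S x = (SOME y. y \<in> S \<and> (\<forall>w\<in>S. (x - y) \<bullet> w = 0))"

lemma oproj:
  assumes "subspace S"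
  shows oproj_in: "oproj S x \<in> S" and oproj_orth: "w \<in> S \<Longrightarrow> (x - oproj S x) \<bullet> w = 0"
proof -
  obtain y z where "y \<in> span S" "\<And>w. w \<in> span S \<Longrightarrow> orthogonal z w" "x = y + z"
    using orthogonal_subspace_decomp_exists[of S x] by metis
  moreover have "span S = S" using assms by (simp add: span_eq_iff)
  ultimately have "\<exists>y. y \<in> S \<and> (\<forall>w\<in>S. (x - y) \<bullet> w = 0)"
    by (intro exI[of _ y]) (simp add: orthogonal_def)
  then have "oproj S x \<in> S \<and> (\<forall>w\<in>S. (x - oproj S x) \<bullet> w = 0)"
    unfolding oproj_def by (rule someI_ex)
  then show "oproj S x \<in> S" "w \<in> S \<Longrightarrow> (x - oproj S x) \<bullet> w = 0" by auto
qed

lemma oproj_unique: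
  assumes "subspace S" "y \<in> S" "\<And>w. w \<in> S \<Longrightarrow> (x - y) \<bullet> w = 0"
  shows "oproj S x = y"
proof -
  let ?d = "oproj S x - y"
  have d: "?d \<in> S" using assms oproj_in subspace_diff by blast
  have "?d \<bullet> ?d = (x - y) \<bullet> ?d - (x - oproj S x) \<bullet> ?d" by (simp add: inner_diff_left)
  also have "\<dots> = 0" using assms(3)[OF d] oproj_orth[OF assms(1) d, of x] by simp
  finally show ?thesis by simp
qed

lemma oproj_id: "subspace S \<Longrightarrow> x \<in> S \<Longrightarrow> oproj S x = x"
  by (rule oproj_unique) auto

lemma linear_oproj: assumes "subspace S" shows "linear (oproj S)"
proof (rule linearI)
  fix x y
  show "oproj S (x + y) = oproj S x + oproj S y"
  proof (rule oproj_unique[OF assms])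
    show "oproj S x + oproj S y \<in> S" using assms oproj_in subspace_add by blast
    fix w assume "w \<in> S"
    then have "(x - oproj S x) \<bullet> w = 0" "(y - oproj S y) \<bullet> w = 0" using oproj_orth[OF assms] by auto
    then show "(x + y - (oproj S x + oproj S y)) \<bullet> w = 0" by (simp add: inner_diff_left inner_add_left)
  qed
next
  fix c x
  show "oproj S (c *\<^sub>R x) = c *\<^sub>R oproj S x"
  proof (rule oproj_unique[OF assms])
    show "c *\<^sub>R oproj S x \<in> S" using assms oproj_in subspace_scale by blast
    fix w assume "w \<in> S"
    then have "(x - oproj S x) \<bullet> w = 0" using oproj_orth[OF assms] by auto
    then show "(c *\<^sub>R x - c *\<^sub>R oproj S x) \<bullet> w = 0" by (simp add: inner_diff_left)
  qed
qed

lemma bounded_linear_oproj: "subspace S \<Longrightarrow> bounded_linear (oproj S)"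
  by (simp add: linear_conv_bounded_linear[symmetric] linear_oproj)

lemma continuous_on_oproj: "subspace S \<Longrightarrow> continuous_on T (oproj S)"
  by (simp add: linear_continuous_on bounded_linear_oproj)

section \<open>Smooth maps from open subsets of Euclidean spaces into manifolds\<close>

lemma open_by_nbhds: "(\<And>x. x \<in> S \<Longrightarrow> \<exists>T. open T \<and> x \<in> T \<and> T \<subseteq> S) \<Longrightarrow> open S"
  by (subst open_subopen) blast

lemma smooth_manifold_charts:
  assumes "smooth_manifold M" "(U, \<phi>) \<in> atlas M"
  shows chart_open: "openin (mf_top M) U" and chart_subset: "U \<subseteq> points M"
    and chart_image_openin: "openin (top_of_set (model M)) (\<phi> ` U)"
    and chart_image_subset: "\<phi> ` U \<subseteq> model M"
    and chart_homeo: "homeomorphic_map (subtopology (mf_top M) U) (top_of_set (\<phi> ` U)) \<phi>"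
    and chart_inj: "inj_on \<phi> U"
    and chart_transition: "(V, \<psi>) \<in> atlas M \<Longrightarrow> smooth_on (\<phi> ` (U \<inter> V)) (\<psi> \<circ> inv_into U \<phi>)"
proof -
  show o: "openin (mf_top M) U" and i: "openin (top_of_set (model M)) (\<phi> ` U)"
    and h: "homeomorphic_map (subtopology (mf_top M) U) (top_of_set (\<phi> ` U)) \<phi>"
    and "(V, \<psi>) \<in> atlas M \<Longrightarrow> smooth_on (\<phi> ` (U \<inter> V)) (\<psi> \<circ> inv_into U \<phi>)"
    using assms unfolding smooth_manifold_def by blast+
  show s: "U \<subseteq> points M" using o openin_subset by blast
  show "\<phi> ` U \<subseteq> model M" using i openin_imp_subset by blast
  show "inj_on \<phi> U"
    using homeomorphic_imp_injective_map[OF h] s by (simp add: Int_absorb1)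
qed

lemma chart_cover:
  assumes "smooth_manifold M" "x \<in> points M"
  obtains U \<phi> where "(U, \<phi>) \<in> atlas M" "x \<in> U"
  using assms unfolding smooth_manifold_def by blast

lemma chart_inverse_continuous:
  assumes "smooth_manifold M" "(U, \<phi>) \<in> atlas M"
  shows "continuous_map (top_of_set (\<phi> ` U)) (mf_top M) (inv_into U \<phi>)"
proof -
  have top: "topspace (subtopology (mf_top M) U) = U"
    using chart_subset[OF assms] by (simp add: Int_absorb1)
  obtain g where g: "homeomorphic_maps (subtopology (mf_top M) U) (top_of_set (\<phi> ` U)) \<phi> g"
    using chart_homeo[OF assms] homeomorphic_map_maps by blast
  then have "continuous_map (top_of_set (\<phi> ` U)) (subtopology (mf_top M) U) g"
    and gx: "\<And>x. x \<in> U \<Longrightarrow> g (\<phi> x) = x"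
    using top by (auto simp: homeomorphic_maps_def)
  moreover have "g y = inv_into U \<phi> y" if "y \<in> \<phi> ` U" for y
    using that gx chart_inj[OF assms] by auto
  ultimately show ?thesis
    by (metis (mono_tags, lifting) continuous_map_eq continuous_map_in_subtopology topspace_euclidean_subtopology)
qed

text \<open>Continuity is included and all charts are considered at once, so that this notion is visibly
  compatible with pairing and with reparametrization.\<close>

definition smooth_into :: "('m, 'e::euclidean_space) mfd \<Rightarrow> 'a::euclidean_space set \<Rightarrow> ('a \<Rightarrow> 'm) \<Rightarrow> bool" where
  "smooth_into M W h \<longleftrightarrow> open W \<and> continuous_map (top_of_set W) (mf_top M) h \<and>
     (\<forall>(U, \<phi>)\<in>atlas M. Cinf {p \<in> W. h p \<in> U} (\<lambda>p. \<phi> (h p)))"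

lemma smooth_into_open: "smooth_into M W h \<Longrightarrow> open W"
  and smooth_into_continuous: "smooth_into M W h \<Longrightarrow> continuous_map (top_of_set W) (mf_top M) h"
  and smooth_into_chart: "smooth_into M W h \<Longrightarrow> (U, \<phi>) \<in> atlas M \<Longrightarrow> Cinf {p \<in> W. h p \<in> U} (\<lambda>p. \<phi> (h p))"
  by (auto simp: smooth_into_def)

lemma smooth_into_points: "smooth_into M W h \<Longrightarrow> p \<in> W \<Longrightarrow> h p \<in> points M"
  using smooth_into_continuous continuous_map_image_subset_topspace by fastforce

lemma smooth_into_vimage_open:
  assumes "smooth_into M W h" "openin (mf_top M) S"
  shows "open {p \<in> W. h p \<in> S}"
proof -
  have "openin (top_of_set W) {p \<in> topspace (top_of_set W). h p \<in> S}"
    using openin_continuous_map_preimage[OF smooth_into_continuous[OF assms(1)] assms(2)] .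
  then show ?thesis using smooth_into_open[OF assms(1)] by (simp add: openin_open_eq)
qed

lemma Cinf_vimage_open:
  assumes "open W" "Cinf W f" "open T" shows "open {p \<in> W. f p \<in> T}"
  using continuous_open_preimage[OF Cinf_continuous_on[OF assms(2)] assms(1,3)]
  by (simp add: vimage_def Int_def)

text \<open>Compatibility of the charts enters here: they are smooth functions of each other, so one chart around
  each point is enough.\<close>

lemma smooth_into_local:
  assumes N: "smooth_manifold N" and W: "open W"
    and loc: "\<And>p. p \<in> W \<Longrightarrow> \<exists>V \<psi> T. (V, \<psi>) \<in> atlas N \<and> open T \<and> p \<in> T \<and> T \<subseteq> W \<and> h ` T \<subseteq> V \<and> Cinf T (\<lambda>p. \<psi> (h p))"
  shows "smooth_into N W h"
  unfolding smooth_into_def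
proof (intro conjI ballI)
  show "open W" by fact
  show "continuous_map (top_of_set W) (mf_top N) h"
    unfolding continuous_map_def
  proof (intro conjI allI impI)
    show "h \<in> topspace (top_of_set W) \<rightarrow> points N"
      using loc chart_subset[OF N] by (fastforce simp: image_subset_iff)
    fix S assume S: "openin (mf_top N) S"
    have "open {p \<in> W. h p \<in> S}"
    proof (rule open_by_nbhds)
      fix p assume p: "p \<in> {p \<in> W. h p \<in> S}"
      then obtain V \<psi> T where T: "(V, \<psi>) \<in> atlas N" "open T" "p \<in> T" "T \<subseteq> W" "h ` T \<subseteq> V" "Cinf T (\<lambda>p. \<psi> (h p))"
        using loc by blast
      have "continuous_map (top_of_set T) (top_of_set (\<psi> ` V)) (\<lambda>p. \<psi> (h p))"
        using Cinf_continuous_on[OF T(6)] T(5) by (auto simp: continuous_map_in_subtopology)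
      then have "continuous_map (top_of_set T) (mf_top N) (inv_into V \<psi> \<circ> (\<lambda>p. \<psi> (h p)))"
        using chart_inverse_continuous[OF N T(1)] by (rule continuous_map_compose)
      then have "openin (top_of_set T) {q \<in> T. inv_into V \<psi> (\<psi> (h q)) \<in> S}"
        using openin_continuous_map_preimage[OF _ S] by fastforce
      moreover have "{q \<in> T. inv_into V \<psi> (\<psi> (h q)) \<in> S} = {q \<in> T. h q \<in> S}"
        using T(5) chart_inj[OF N T(1)] by (auto simp: image_subset_iff)
      ultimately have "open {q \<in> T. h q \<in> S}" using T(2) by (simp add: openin_open_eq)
      then show "\<exists>T. open T \<and> p \<in> T \<and> T \<subseteq> {p \<in> W. h p \<in> S}"
        using T p by (intro exI[of _ "{q \<in> T. h q \<in> S}"]) auto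
    qed
    then show "openin (top_of_set W) {x \<in> topspace (top_of_set W). h x \<in> S}"
      using W by (simp add: openin_open_eq)
  qed
  then have vop: "open {p \<in> W. h p \<in> S}" if "openin (mf_top N) S" for S
    using openin_continuous_map_preimage[OF _ that] W by (fastforce simp: openin_open_eq)
  fix c assume "c \<in> atlas N"
  then obtain U \<phi> where c: "c = (U, \<phi>)" "(U, \<phi>) \<in> atlas N" by (cases c) auto
  have "Cinf {p \<in> W. h p \<in> U} (\<lambda>p. \<phi> (h p))"
  proof (rule Cinf_local)
    fix p assume p: "p \<in> {p \<in> W. h p \<in> U}"
    then obtain V \<psi> T where T: "(V, \<psi>) \<in> atlas N" "open T" "p \<in> T" "T \<subseteq> W" "h ` T \<subseteq> V" "Cinf T (\<lambda>p. \<psi> (h p))"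
      using loc by blast
    have "\<psi> (h p) \<in> \<psi> ` (V \<inter> U)" using p T by auto
    then obtain Q F where Q: "open Q" "\<psi> (h p) \<in> Q" "Cinf Q F"
      "\<And>y. y \<in> \<psi> ` (V \<inter> U) \<inter> Q \<Longrightarrow> F y = (\<phi> \<circ> inv_into V \<psi>) y"
      using chart_transition[OF N T(1) c(2)] unfolding smooth_on_def Cinf_def by metis
    let ?T = "{q \<in> T. \<psi> (h q) \<in> Q} \<inter> {q \<in> W. h q \<in> U}"
    have oT: "open ?T"
      using Cinf_vimage_open[OF T(2,6) Q(1)] vop[OF chart_open[OF N c(2)]] by (rule open_Int)
    have "Cinf ?T (\<lambda>q. F (\<psi> (h q)))"
      by (rule Cinf_compose[OF oT _ Q(3)]) (auto intro: Cinf_subset[OF T(6)])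
    then have "Cinf ?T (\<lambda>q. \<phi> (h q))"
      by (rule Cinf_cong[OF _ oT]) (use T(5) Q(4) chart_inj[OF N T(1)] in \<open>auto simp: image_subset_iff\<close>)
    then show "\<exists>T. open T \<and> p \<in> T \<and> Cinf T (\<lambda>p. \<phi> (h p))"
      using oT p T(3) Q(2) by blast
  qed
  then show "case c of (U, \<phi>) \<Rightarrow> Cinf {p \<in> W. h p \<in> U} (\<lambda>p. \<phi> (h p))" using c by simp
qed

lemma smooth_into_compose:
  assumes N: "smooth_manifold N" and h: "smooth_into M W h"
    and inj: "\<And>U \<phi>. (U, \<phi>) \<in> atlas M \<Longrightarrow> inj_on \<phi> U"
    and F: "smooth_map M N F"
  shows "smooth_into N W (\<lambda>p. F (h p))"
proof (rule smooth_into_local[OF N smooth_into_open[OF h]])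
  fix p assume p: "p \<in> W"
  have "h p \<in> points M" using smooth_into_points[OF h p] .
  then obtain U \<phi> V \<psi> S where S: "(U, \<phi>) \<in> atlas M" "(V, \<psi>) \<in> atlas N" "openin (mf_top M) S"
    "h p \<in> S" "S \<subseteq> U" "F ` S \<subseteq> V" "smooth_on (\<phi> ` S) (\<psi> \<circ> F \<circ> inv_into U \<phi>)"
    using F unfolding smooth_map_on_def by fast
  then obtain Q G where Q: "open Q" "\<phi> (h p) \<in> Q" "Cinf Q G"
      "\<And>y. y \<in> \<phi> ` S \<inter> Q \<Longrightarrow> G y = (\<psi> \<circ> F \<circ> inv_into U \<phi>) y"
    unfolding smooth_on_def Cinf_def by (metis imageI)
  let ?A = "{q \<in> W. h q \<in> S}"
  have oA: "open ?A" using smooth_into_vimage_open[OF h S(3)] .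
  have CA: "Cinf ?A (\<lambda>p. \<phi> (h p))"
    by (rule Cinf_subset[OF smooth_into_chart[OF h S(1)]]) (use S(5) in auto)
  let ?T = "{q \<in> ?A. \<phi> (h q) \<in> Q}"
  have oT: "open ?T" using Cinf_vimage_open[OF oA CA Q(1)] .
  have "Cinf ?T (\<lambda>q. G (\<phi> (h q)))"
    by (rule Cinf_compose[OF oT _ Q(3)]) (auto intro: Cinf_subset[OF CA])
  then have "Cinf ?T (\<lambda>q. \<psi> (F (h q)))"
    by (rule Cinf_cong[OF _ oT]) (use S(5) Q(4) inj[OF S(1)] in \<open>auto simp: subset_iff\<close>)
  then show "\<exists>V \<psi> T. (V, \<psi>) \<in> atlas N \<and> open T \<and> p \<in> T \<and> T \<subseteq> W \<and> (\<lambda>p. F (h p)) ` T \<subseteq> V \<and> Cinf T (\<lambda>p. \<psi> (F (h p)))"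
    using oT S p Q(2) by (intro exI[of _ V] exI[of _ \<psi>] exI[of _ ?T]) auto
qed

lemma smooth_into_Pair:
  assumes M: "smooth_manifold M" and N: "smooth_manifold N"
    and h: "smooth_into M W h" and k: "smooth_into N W k"
  shows "smooth_into (prod_mfd M N) W (\<lambda>p. (h p, k p))"
  unfolding smooth_into_def
proof (intro conjI ballI)
  show "open W" using smooth_into_open[OF h] .
  show "continuous_map (top_of_set W) (mf_top (prod_mfd M N)) (\<lambda>p. (h p, k p))"
    using smooth_into_continuous[OF h] smooth_into_continuous[OF k]
    by (simp add: prod_mfd_def continuous_map_pairedI)
  fix c assume "c \<in> atlas (prod_mfd M N)"
  then obtain U \<phi> V \<psi> where c: "c = (U \<times> V, map_prod \<phi> \<psi>)" "(U, \<phi>) \<in> atlas M" "(V, \<psi>) \<in> atlas N"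
    by (auto simp: prod_mfd_def)
  have o: "open ({p \<in> W. h p \<in> U} \<inter> {p \<in> W. k p \<in> V})"
    by (intro open_Int smooth_into_vimage_open[OF h] smooth_into_vimage_open[OF k]
        chart_open[OF M c(2)] chart_open[OF N c(3)])
  have "Cinf ({p \<in> W. h p \<in> U} \<inter> {p \<in> W. k p \<in> V}) (\<lambda>p. (\<phi> (h p), \<psi> (k p)))"
    by (intro Cinf_Pair[OF o] Cinf_subset[OF smooth_into_chart[OF h c(2)]]
        Cinf_subset[OF smooth_into_chart[OF k c(3)]]) auto
  also have "{p \<in> W. h p \<in> U} \<inter> {p \<in> W. k p \<in> V} = {p \<in> W. (h p, k p) \<in> U \<times> V}" by auto
  finally have "Cinf {p \<in> W. (h p, k p) \<in> U \<times> V} (\<lambda>p. (\<phi> (h p), \<psi> (k p)))" .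
  then show "case c of (U, \<phi>) \<Rightarrow> Cinf {p \<in> W. (h p, k p) \<in> U} (\<lambda>p. \<phi> (h p, k p))"
    using c by simp
qed

lemma prod_mfd_chart_inj:
  assumes "smooth_manifold M" "smooth_manifold N" "(U, \<phi>) \<in> atlas (prod_mfd M N)"
  shows "inj_on \<phi> U"
  using assms chart_inj[OF assms(1)] chart_inj[OF assms(2)]
  by (auto simp: prod_mfd_def intro!: map_prod_inj_on)

lemma smooth_into_const:
  assumes "open W" "c \<in> points M"
  shows "smooth_into M W (\<lambda>_. c)"
  using assms by (auto simp: smooth_into_def Cinf_const)

lemma smooth_into_euclid:
  assumes "open W" "Cinf W h" "h ` W \<subseteq> E"
  shows "smooth_into (euclid E) W h"
proof -
  have "{p \<in> W. h p \<in> E} = W" using assms by auto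
  then show ?thesis
    using assms by (auto simp: smooth_into_def euclid_def continuous_map_in_subtopology Cinf_continuous_on)
qed

lemma smooth_manifold_euclid_UNIV: "smooth_manifold (euclid UNIV)"
proof -
  obtain \<B> :: "'a set set" where "countable \<B>" "topological_basis \<B>"
    using ex_countable_basis by blast
  then have "second_countable (euclidean :: 'a topology)"
    unfolding second_countable_def open_openin[symmetric]
    by (metis topological_basisE topological_basis_open)
  moreover have "smooth_on UNIV (id :: 'a \<Rightarrow> 'a)"
    unfolding smooth_on_def id_def using Cinf_id[of UNIV] by (auto simp: Cinf_def)
  ultimately show ?thesis
    by (auto simp: smooth_manifold_def euclid_def homeomorphic_map_id o_def Hausdorff_space_euclidean)
qed

lemma smooth_into_euclid_UNIV: "smooth_into (euclid UNIV) W h \<longleftrightarrow> open W \<and> Cinf W h"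
  using smooth_into_euclid[of W h UNIV] smooth_into_open[of "euclid UNIV" W h]
    smooth_into_chart[of "euclid UNIV" W h UNIV id]
  by (auto simp: euclid_def)

lemma smooth_map_real_line_iff:
  assumes N: "smooth_manifold N"
  shows "smooth_map real_line N h \<longleftrightarrow> smooth_into N UNIV h"
proof
  assume "smooth_map real_line N h"
  moreover have "smooth_into real_line UNIV (\<lambda>t. t)"
    unfolding smooth_into_euclid_UNIV by (simp add: Cinf_id)
  moreover have "inj_on \<phi> U" if "(U, \<phi>) \<in> atlas real_line" for U and \<phi> :: "real \<Rightarrow> real"
    using that by (auto simp: euclid_def)
  ultimately show "smooth_into N UNIV h"
    using smooth_into_compose[OF N, of real_line UNIV "\<lambda>t. t" h] by blast
next
  assume h: "smooth_into N UNIV h"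
  show "smooth_map real_line N h"
    unfolding smooth_map_on_def
  proof (intro conjI ballI)
    show "h ` points real_line \<subseteq> points N" using smooth_into_points[OF h] by auto
    fix t :: real
    obtain V \<psi> where V: "(V, \<psi>) \<in> atlas N" "h t \<in> V"
      using chart_cover[OF N smooth_into_points[OF h]] by blast
    have o: "open {t. h t \<in> V}" using smooth_into_vimage_open[OF h chart_open[OF N V(1)]] by simp
    have "Cinf {t. h t \<in> V} (\<lambda>t. \<psi> (h t))" using smooth_into_chart[OF h V(1)] by simp
    then have "smooth_on {t. h t \<in> V} (\<lambda>t. \<psi> (h t))"
      using o unfolding smooth_on_def Cinf_def by blast
    then show "\<exists>(U, \<phi>)\<in>atlas real_line. \<exists>(V, \<psi>)\<in>atlas N. \<exists>S.
        openin (mf_top real_line) S \<and> t \<in> S \<and> S \<subseteq> U \<inter> points real_line \<and> h ` S \<subseteq> V \<and>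
        smooth_on (\<phi> ` S) (\<psi> \<circ> h \<circ> inv_into U \<phi>)"
      using V o by (intro bexI[of _ "(UNIV, id)"] bexI[OF _ V(1)] , clarsimp)
        (auto simp: euclid_def o_def intro!: exI[of _ "{t. h t \<in> V}"])
  qed
qed

lemma smooth_into_reparam:
  assumes M: "smooth_manifold M" and h: "smooth_into M W h" and k: "open T" "Cinf T k" "k ` T \<subseteq> W"
  shows "smooth_into M T (\<lambda>p. h (k p))"
  unfolding smooth_into_def
proof (intro conjI ballI)
  have "continuous_map (top_of_set T) (top_of_set W) k"
    using Cinf_continuous_on[OF k(2)] k(3) by (simp add: continuous_map_in_subtopology image_subset_iff_funcset)
  then show cont: "continuous_map (top_of_set T) (mf_top M) (\<lambda>p. h (k p))"
    using continuous_map_compose[OF _ smooth_into_continuous[OF h], of "top_of_set T" k] by (simp only: o_def)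
  fix c assume "c \<in> atlas M"
  then obtain U \<phi> where c: "c = (U, \<phi>)" "(U, \<phi>) \<in> atlas M" by (cases c) auto
  have "openin (top_of_set T) {p \<in> T. h (k p) \<in> U}"
    using openin_continuous_map_preimage[OF cont chart_open[OF M c(2)]] by simp
  then have o: "open {p \<in> T. h (k p) \<in> U}" using k(1) by (simp add: openin_open_eq)
  have "Cinf {p \<in> T. h (k p) \<in> U} (\<lambda>p. \<phi> (h (k p)))"
    by (rule Cinf_compose[OF o Cinf_subset[OF k(2)] smooth_into_chart[OF h c(2)]]) (use k(3) in auto)
  then show "case c of (U, \<phi>) \<Rightarrow> Cinf {p \<in> T. h (k p) \<in> U} (\<lambda>p. \<phi> (h (k p)))" using c by simp
qed fact

section \<open>Smooth functions on a manifold in charts\<close>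

abbreviation smooth_fun :: "('m, 'e::euclidean_space) mfd \<Rightarrow> ('m \<Rightarrow> 'b::euclidean_space) \<Rightarrow> bool" where
  "smooth_fun M f \<equiv> smooth_map M (euclid UNIV) f"

text \<open>The inverse of a chart, extended to be constant orthogonally to the model space, and the open set on
  which it parametrizes the chart domain.\<close>

definition cdom :: "('m, 'e::euclidean_space) mfd \<Rightarrow> 'm set \<Rightarrow> ('m \<Rightarrow> 'e) \<Rightarrow> 'e set" where
  "cdom M U \<phi> = {u. oproj (model M) u \<in> \<phi> ` U}"

definition cpar :: "('m, 'e::euclidean_space) mfd \<Rightarrow> 'm set \<Rightarrow> ('m \<Rightarrow> 'e) \<Rightarrow> 'e \<Rightarrow> 'm" where
  "cpar M U \<phi> u = inv_into U \<phi> (oproj (model M) u)"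

context
  fixes M :: "('m, 'e::euclidean_space) mfd"
  assumes M: "smooth_manifold M"
begin

lemma model_subspace: "subspace (model M)"
  using M by (simp add: smooth_manifold_def)

lemma cpar_in: "u \<in> cdom M U \<phi> \<Longrightarrow> cpar M U \<phi> u \<in> U"
  by (simp add: cdom_def cpar_def inv_into_into)

lemma chart_cpar: "u \<in> cdom M U \<phi> \<Longrightarrow> \<phi> (cpar M U \<phi> u) = oproj (model M) u"
  by (simp add: cdom_def cpar_def f_inv_into_f)

lemma chart_in_model: "(U, \<phi>) \<in> atlas M \<Longrightarrow> x \<in> U \<Longrightarrow> \<phi> x \<in> model M"
  using chart_image_subset[OF M] by blast

lemma cpar_chart: "(U, \<phi>) \<in> atlas M \<Longrightarrow> x \<in> U \<Longrightarrow> cpar M U \<phi> (\<phi> x) = x"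
  using chart_in_model chart_inj[OF M] by (simp add: cpar_def oproj_id[OF model_subspace])

lemma chart_in_cdom: "(U, \<phi>) \<in> atlas M \<Longrightarrow> x \<in> U \<Longrightarrow> \<phi> x \<in> cdom M U \<phi>"
  using chart_in_model by (simp add: cdom_def oproj_id[OF model_subspace])

lemma open_cdom:
  assumes c: "(U, \<phi>) \<in> atlas M" shows "open (cdom M U \<phi>)"
proof -
  obtain T where T: "open T" "\<phi> ` U = model M \<inter> T"
    using chart_image_openin[OF M c] by (auto simp: openin_open)
  have "cdom M U \<phi> = oproj (model M) -` T"
    using oproj_in[OF model_subspace] by (auto simp: cdom_def T(2))
  then show ?thesis
    using continuous_on_oproj[OF model_subspace, of UNIV] T(1)
    by (simp add: continuous_on_open_vimage)
qed

lemma smooth_into_cpar: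
  assumes c: "(U, \<phi>) \<in> atlas M" shows "smooth_into M (cdom M U \<phi>) (cpar M U \<phi>)"
proof (rule smooth_into_local[OF M open_cdom[OF c]])
  fix u assume "u \<in> cdom M U \<phi>"
  have "Cinf (cdom M U \<phi>) (\<lambda>u. \<phi> (cpar M U \<phi> u))"
    by (rule Cinf_cong[OF Cinf_bounded_linear[OF bounded_linear_oproj[OF model_subspace]] open_cdom[OF c]])
       (simp add: chart_cpar)
  then show "\<exists>V \<psi> T. (V, \<psi>) \<in> atlas M \<and> open T \<and> u \<in> T \<and> T \<subseteq> cdom M U \<phi> \<and> cpar M U \<phi> ` T \<subseteq> V \<and>
      Cinf T (\<lambda>p. \<psi> (cpar M U \<phi> p))"
    using c open_cdom[OF c] \<open>u \<in> _\<close> cpar_in by blast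
qed

lemma chart_vimage_open:
  assumes c: "(U, \<phi>) \<in> atlas M" and W: "open W"
  shows "openin (mf_top M) {y \<in> U. \<phi> y \<in> W}"
proof -
  have cont: "continuous_map (subtopology (mf_top M) U) euclidean \<phi>"
    using homeomorphic_imp_continuous_map[OF chart_homeo[OF M c]] by (simp add: continuous_map_in_subtopology)
  have "openin (subtopology (mf_top M) U) {y \<in> U. \<phi> y \<in> W}"
    using openin_continuous_map_preimage[OF cont, of W] W chart_subset[OF M c]
    by (simp add: Int_absorb1)
  then show ?thesis
    using chart_open[OF M c] openin_trans_full by blast
qed

lemma smooth_into_smooth_fun:
  assumes "smooth_into M W h" "smooth_fun M f" shows "Cinf W (\<lambda>p. f (h p))"
  using smooth_into_compose[OF smooth_manifold_euclid_UNIV assms(1) chart_inj[OF M] assms(2)]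
  by (simp add: smooth_into_euclid_UNIV)

lemma smooth_fun_cpar:
  "(U, \<phi>) \<in> atlas M \<Longrightarrow> smooth_fun M f \<Longrightarrow> Cinf (cdom M U \<phi>) (\<lambda>u. f (cpar M U \<phi> u))"
  by (rule smooth_into_smooth_fun[OF smooth_into_cpar])

lemma smooth_fun_localI:
  fixes f :: "'m \<Rightarrow> 'b::euclidean_space"
  assumes loc: "\<And>x. x \<in> points M \<Longrightarrow> \<exists>U \<phi> W. (U, \<phi>) \<in> atlas M \<and> x \<in> U \<and> open W \<and> \<phi> x \<in> W \<and>
      Cinf (W \<inter> cdom M U \<phi>) (\<lambda>u. f (cpar M U \<phi> u))"
  shows "smooth_fun M f"
  unfolding smooth_map_on_def
proof (intro conjI ballI)
  show "f ` points M \<subseteq> points (euclid UNIV)" by (simp add: euclid_def)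
  fix x assume "x \<in> points M"
  then obtain U \<phi> W where U: "(U, \<phi>) \<in> atlas M" "x \<in> U" "open W" "\<phi> x \<in> W"
      "Cinf (W \<inter> cdom M U \<phi>) (\<lambda>u. f (cpar M U \<phi> u))" using loc by blast
  let ?S = "{y \<in> U. \<phi> y \<in> W}"
  have oS: "openin (mf_top M) ?S" using chart_vimage_open[OF U(1,3)] .
  have "smooth_on (\<phi> ` ?S) (id \<circ> f \<circ> inv_into U \<phi>)"
    unfolding smooth_on_def
  proof
    fix u assume u: "u \<in> \<phi> ` ?S"
    show "\<exists>V F. open V \<and> u \<in> V \<and> (\<forall>k. Ck_on k V F) \<and>
        (\<forall>y\<in>\<phi> ` ?S \<inter> V. F y = (id \<circ> f \<circ> inv_into U \<phi>) y)"
    proof (intro exI conjI)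
      show "open (W \<inter> cdom M U \<phi>)" using U(3) open_cdom[OF U(1)] by blast
      show "u \<in> W \<inter> cdom M U \<phi>" using u chart_in_cdom[OF U(1)] by auto
      show "\<forall>k. Ck_on k (W \<inter> cdom M U \<phi>) (\<lambda>u. f (cpar M U \<phi> u))"
        using U(5) by (simp add: Cinf_def)
      show "\<forall>y\<in>\<phi> ` ?S \<inter> (W \<inter> cdom M U \<phi>). f (cpar M U \<phi> y) = (id \<circ> f \<circ> inv_into U \<phi>) y"
        using chart_in_model[OF U(1)] by (auto simp: cpar_def oproj_id[OF model_subspace])
    qed
  qed
  moreover have "(UNIV, id) \<in> atlas (euclid UNIV)" by (simp add: euclid_def)
  moreover have "?S \<subseteq> U \<inter> points M" using chart_subset[OF M U(1)] by auto
  moreover have "f ` ?S \<subseteq> UNIV" by simp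
  moreover have "x \<in> ?S" using U by simp
  ultimately show "\<exists>(U, \<phi>)\<in>atlas M. \<exists>(V, \<psi>)\<in>atlas (euclid UNIV). \<exists>S.
      openin (mf_top M) S \<and> x \<in> S \<and> S \<subseteq> U \<inter> points M \<and> f ` S \<subseteq> V \<and>
      smooth_on (\<phi> ` S) (\<psi> \<circ> f \<circ> inv_into U \<phi>)"
    using U(1) oS by blast
qed

lemma smooth_fun_chartI:
  assumes "\<And>U \<phi>. (U, \<phi>) \<in> atlas M \<Longrightarrow> Cinf (cdom M U \<phi>) (\<lambda>u. f (cpar M U \<phi> u))"
  shows "smooth_fun M f"
proof (rule smooth_fun_localI)
  fix x assume "x \<in> points M"
  then obtain U \<phi> where "(U, \<phi>) \<in> atlas M" "x \<in> U" using chart_cover[OF M] by blast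
  then show "\<exists>U \<phi> W. (U, \<phi>) \<in> atlas M \<and> x \<in> U \<and> open W \<and> \<phi> x \<in> W \<and>
      Cinf (W \<inter> cdom M U \<phi>) (\<lambda>u. f (cpar M U \<phi> u))"
    using assms by (intro exI[of _ U] exI[of _ \<phi>] exI[of _ UNIV]) auto
qed

lemma smooth_fun_const: "smooth_fun M (\<lambda>_. c)"
  by (rule smooth_fun_chartI) (rule Cinf_const)

lemma smooth_fun_mult:
  fixes f g :: "'m \<Rightarrow> 'b::{euclidean_space, real_normed_algebra}"
  shows "smooth_fun M f \<Longrightarrow> smooth_fun M g \<Longrightarrow> smooth_fun M (\<lambda>x. f x * g x)"
  by (rule smooth_fun_chartI) (intro Cinf_mult open_cdom smooth_fun_cpar)

lemma smooth_fun_sum: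
  shows "(\<And>i. i \<in> I \<Longrightarrow> smooth_fun M (f i)) \<Longrightarrow> smooth_fun M (\<lambda>x. \<Sum>i\<in>I. f i x)"
  by (rule smooth_fun_chartI) (intro Cinf_sum open_cdom smooth_fun_cpar)

lemma smooth_fun_compose:
  shows "smooth_fun M f \<Longrightarrow> Cinf W F \<Longrightarrow> (\<And>x. x \<in> points M \<Longrightarrow> f x \<in> W) \<Longrightarrow> smooth_fun M (\<lambda>x. F (f x))"
  by (rule smooth_fun_chartI)
     (rule Cinf_compose[OF open_cdom smooth_fun_cpar], auto dest!: cpar_in chart_subset[OF M])

lemma smooth_fun_continuous:
  fixes f :: "'m \<Rightarrow> 'b::euclidean_space"
  assumes f: "smooth_fun M f" shows "continuous_map (mf_top M) euclidean f"
  unfolding continuous_map_def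
proof (intro conjI allI impI)
  fix T :: "'b set" assume "openin euclidean T"
  then have T: "open T" by simp
  show "openin (mf_top M) {x \<in> points M. f x \<in> T}"
  proof (subst openin_subopen, rule ballI)
    fix x assume x: "x \<in> {x \<in> points M. f x \<in> T}"
    then obtain U \<phi> where U: "(U, \<phi>) \<in> atlas M" "x \<in> U" using chart_cover[OF M] by blast
    let ?W = "{u \<in> cdom M U \<phi>. f (cpar M U \<phi> u) \<in> T}"
    have "openin (mf_top M) {y \<in> U. \<phi> y \<in> ?W}"
      by (rule chart_vimage_open[OF U(1)]) (rule Cinf_vimage_open[OF open_cdom[OF U(1)] smooth_fun_cpar[OF U(1) f] T])
    moreover have "{y \<in> U. \<phi> y \<in> ?W} \<subseteq> {x \<in> points M. f x \<in> T}"
      using chart_subset[OF M U(1)] cpar_chart[OF U(1)] by auto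
    moreover have "x \<in> {y \<in> U. \<phi> y \<in> ?W}"
      using U x cpar_chart[OF U] chart_in_cdom[OF U] by auto
    ultimately show "\<exists>T'. openin (mf_top M) T' \<and> x \<in> T' \<and> T' \<subseteq> {x \<in> points M. f x \<in> T}" by blast
  qed
qed simp

end

section \<open>Bump functions\<close>

text \<open>The support lies in the image of a compact set, which is closed because \<open>M\<close> is Hausdorff. So the function
  vanishes near every point outside the chart.\<close>

lemma smooth_fun_extend_by_zero:
  fixes M :: "('m, 'e::euclidean_space) mfd" and g :: "'e \<Rightarrow> 'b::euclidean_space"
  assumes M: "smooth_manifold M" and c: "(U, \<phi>) \<in> atlas M" and g: "Cinf UNIV g"
    and r: "cball p r \<inter> model M \<subseteq> \<phi> ` U" and supp: "\<And>u. u \<in> model M \<Longrightarrow> r \<le> dist p u \<Longrightarrow> g u = 0"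
  shows "smooth_fun M (\<lambda>x. if x \<in> U then g (\<phi> x) else 0)" (is "smooth_fun M ?f")
proof (rule smooth_fun_localI[OF M])
  fix x assume x: "x \<in> points M"
  let ?K = "inv_into U \<phi> ` (cball p r \<inter> model M)"
  have "compactin (top_of_set (\<phi> ` U)) (cball p r \<inter> model M)"
    using r closed_subspace[OF model_subspace[OF M]]
    by (simp add: compactin_subtopology compact_Int_closed)
  then have "compactin (mf_top M) ?K"
    using image_compactin chart_inverse_continuous[OF M c] by blast
  then have K: "closedin (mf_top M) ?K"
    using M by (simp add: compactin_imp_closedin smooth_manifold_def)
  have 0: "?f y = 0" if y: "y \<in> points M - ?K" for y
  proof (cases "y \<in> U")
    case True
    have "\<not> dist p (\<phi> y) \<le> r"
    proof
      assume "dist p (\<phi> y) \<le> r"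
      then have "\<phi> y \<in> cball p r \<inter> model M" using chart_in_model[OF M c True] by simp
      moreover have "inv_into U \<phi> (\<phi> y) = y" using chart_inj[OF M c] True by simp
      ultimately show False using y by (metis DiffD2 imageI)
    qed
    then show ?thesis using supp chart_in_model[OF M c True] True by simp
  qed simp
  show "\<exists>V \<psi> W. (V, \<psi>) \<in> atlas M \<and> x \<in> V \<and> open W \<and> \<psi> x \<in> W \<and>
      Cinf (W \<inter> cdom M V \<psi>) (\<lambda>u. ?f (cpar M V \<psi> u))"
  proof (cases "x \<in> U")
    case True
    have "Cinf (cdom M U \<phi>) (\<lambda>u. g (oproj (model M) u))"
      by (rule Cinf_compose[OF open_cdom[OF M c] Cinf_bounded_linear[OF bounded_linear_oproj[OF model_subspace[OF M]]] g]) simp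
    then have "Cinf (cdom M U \<phi>) (\<lambda>u. ?f (cpar M U \<phi> u))"
      by (rule Cinf_cong[OF _ open_cdom[OF M c]]) (simp add: cpar_in[OF M] chart_cpar[OF M])
    then show ?thesis using True c by (intro exI[of _ U] exI[of _ \<phi>] exI[of _ UNIV]) auto
  next
    case False
    obtain V \<psi> where V: "(V, \<psi>) \<in> atlas M" "x \<in> V" using chart_cover[OF M x] .
    have "openin (mf_top M) (points M - ?K)" using K by blast
    from smooth_into_vimage_open[OF smooth_into_cpar[OF M V(1)] this]
    have o: "open {u \<in> cdom M V \<psi>. cpar M V \<psi> u \<in> points M - ?K}" (is "open ?W") .
    have "x \<notin> ?K" using False r by (auto simp: inv_into_into dest!: subsetD)
    then have "\<psi> x \<in> ?W" using V x by (simp add: chart_in_cdom[OF M] cpar_chart[OF M])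
    moreover have "Cinf ?W (\<lambda>u. ?f (cpar M V \<psi> u))"
      by (rule Cinf_cong[OF Cinf_const[of _ 0] o]) (use 0 in auto)
    ultimately show ?thesis
      using V o Cinf_subset[of ?W _ "?W \<inter> cdom M V \<psi>"] by blast
  qed
qed

text \<open>The last property yields the bump function itself (for \<open>F = 1\<close>), but also global smooth functions
  with a prescribed differential at \<open>m\<close>.\<close>

lemma bump_function:
  fixes M :: "('m, 'e::euclidean_space) mfd"
  assumes M: "smooth_manifold M" and c: "(U, \<phi>) \<in> atlas M" "m \<in> U"
    and W: "openin (mf_top M) W" "m \<in> W"
  obtains \<beta> :: "'e \<Rightarrow> real" where "Cinf UNIV \<beta>" "\<beta> (\<phi> m) > 0"
    "\<forall>x\<in>U. \<beta> (\<phi> x) \<noteq> 0 \<longrightarrow> x \<in> W"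
    "\<forall>F :: 'e \<Rightarrow> 'b::euclidean_space. Cinf UNIV F \<longrightarrow>
       smooth_fun M (\<lambda>x. if x \<in> U then \<beta> (\<phi> x) *\<^sub>R F (\<phi> x) else 0)"
proof -
  have "openin (mf_top M) (U \<inter> W)" using chart_open[OF M c(1)] W by blast
  then have "open {u \<in> cdom M U \<phi>. cpar M U \<phi> u \<in> U \<inter> W}"
    by (rule smooth_into_vimage_open[OF smooth_into_cpar[OF M c(1)]])
  moreover have "\<phi> m \<in> {u \<in> cdom M U \<phi>. cpar M U \<phi> u \<in> U \<inter> W}"
    using c W by (simp add: chart_in_cdom[OF M] cpar_chart[OF M])
  ultimately obtain r where r: "r > 0" "cball (\<phi> m) r \<subseteq> {u \<in> cdom M U \<phi>. cpar M U \<phi> u \<in> U \<inter> W}"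
    using open_contains_cball by blast
  define \<beta> where "\<beta> u = cutoff (r\<^sup>2 - (u - \<phi> m) \<bullet> (u - \<phi> m))" for u
  have \<beta>: "Cinf UNIV \<beta>"
    unfolding \<beta>_def
    by (rule Cinf_compose[OF _ _ Cinf_cutoff])
       (intro Cinf_diff Cinf_inner Cinf_const Cinf_id open_UNIV | simp)+
  have pos: "\<beta> u \<noteq> 0 \<longleftrightarrow> dist (\<phi> m) u < r" for u
  proof -
    have "\<beta> u \<noteq> 0 \<longleftrightarrow> (norm (u - \<phi> m))\<^sup>2 < r\<^sup>2"
      by (simp add: \<beta>_def cutoff_eq_0_iff power2_norm_eq_inner not_le)
    also have "\<dots> \<longleftrightarrow> dist (\<phi> m) u < r"
      using r(1) by (auto intro: power2_less_imp_less power_strict_mono simp: dist_norm norm_minus_commute)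
    finally show ?thesis .
  qed
  have zero: "\<beta> u = 0" if "r \<le> dist (\<phi> m) u" for u
    using pos[of u] that by (meson not_less)
  have sub: "cball (\<phi> m) r \<inter> model M \<subseteq> \<phi> ` U"
    using r(2) by (auto simp: cdom_def oproj_id[OF model_subspace[OF M]])
  show ?thesis
  proof (rule that[of \<beta>])
    show "Cinf UNIV \<beta>" by fact
    have "\<beta> (\<phi> m) \<ge> 0" by (simp add: \<beta>_def cutoff_nonneg)
    then show "\<beta> (\<phi> m) > 0" using pos[of "\<phi> m"] r(1) by simp
    show "\<forall>x\<in>U. \<beta> (\<phi> x) \<noteq> 0 \<longrightarrow> x \<in> W"
    proof (intro ballI impI)
      fix x assume x: "x \<in> U" "\<beta> (\<phi> x) \<noteq> 0"
      then have "\<phi> x \<in> cball (\<phi> m) r" using pos by simp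
      then show "x \<in> W" using r(2) cpar_chart[OF M c(1) x(1)] by auto
    qed
    show "\<forall>F :: 'e \<Rightarrow> 'b. Cinf UNIV F \<longrightarrow>
       smooth_fun M (\<lambda>x. if x \<in> U then \<beta> (\<phi> x) *\<^sub>R F (\<phi> x) else 0)"
    proof (intro allI impI)
      fix F :: "'e \<Rightarrow> 'b" assume F: "Cinf UNIV F"
      show "smooth_fun M (\<lambda>x. if x \<in> U then \<beta> (\<phi> x) *\<^sub>R F (\<phi> x) else 0)"
        by (rule smooth_fun_extend_by_zero[OF M c(1) _ sub, of "\<lambda>u. \<beta> u *\<^sub>R F u"])
           (use zero in \<open>auto intro!: Cinf_scaleR \<beta> F\<close>)
    qed
  qed
qed

section \<open>Torus actions\<close>

text \<open>In the application \<open>\<pi>\<close> is the universal covering of the torus and \<open>B\<close> a lattice basis of its kernel. The elements \<open>b\<close>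
  of \<open>B\<close> are periods of \<open>\<pi>\<close>, and the circles \<open>t \<mapsto> \<pi> (t b)\<close> generate \<open>G\<close> because \<open>B\<close> spans.\<close>

locale torus_action =
  fixes G :: "('g, 'r) monoid_scheme" (structure)
    and \<G> :: "('g, 'e::euclidean_space) mfd"
    and M :: "('m, 'f::euclidean_space) mfd"
    and \<rho> :: "'g \<Rightarrow> 'm \<Rightarrow> 'm"
    and B :: "'e set" and \<pi> :: "'e \<Rightarrow> 'g"
  assumes lie: "lie_group G \<G>"
    and fin_B: "finite B" and span_B: "span B = model \<G>"
    and \<pi>_smooth: "smooth_map (euclid (model \<G>)) \<G> \<pi>"
    and \<pi>_add: "\<And>x y. x \<in> model \<G> \<Longrightarrow> y \<in> model \<G> \<Longrightarrow> \<pi> (x + y) = \<pi> x \<otimes> \<pi> y"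
    and \<pi>_onto: "\<pi> ` model \<G> = carrier G"
    and \<pi>_B: "\<And>b. b \<in> B \<Longrightarrow> \<pi> b = \<one>"
    and M: "smooth_manifold M"
    and act: "smooth_action G \<G> M \<rho>"
begin

lemma group: "group G" and \<G>: "smooth_manifold \<G>" and points_\<G>: "points \<G> = carrier G"
  and mult_smooth: "smooth_map (prod_mfd \<G> \<G>) \<G> (\<lambda>(x, y). x \<otimes> y)"
  using lie by (auto simp: lie_group_def)

sublocale group G by (rule group)

lemma act_smooth: "smooth_map (prod_mfd \<G> M) M (\<lambda>(g, m). \<rho> g m)"
  and act_one: "x \<in> points M \<Longrightarrow> \<rho> \<one> x = x"
  and act_mult: "g \<in> carrier G \<Longrightarrow> h \<in> carrier G \<Longrightarrow> x \<in> points M \<Longrightarrow> \<rho> (g \<otimes> h) x = \<rho> g (\<rho> h x)"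
  using act by (auto simp: smooth_action_def)

lemma act_points: "g \<in> carrier G \<Longrightarrow> x \<in> points M \<Longrightarrow> \<rho> g x \<in> points M"
  using act_smooth points_\<G> by (fastforce simp: smooth_map_on_def prod_mfd_def)

lemma subspace_model: "subspace (model \<G>)"
  using model_subspace[OF \<G>] .

lemma \<pi>_carrier: "v \<in> model \<G> \<Longrightarrow> \<pi> v \<in> carrier G"
  using \<pi>_onto by blast

lemma \<pi>_zero: "\<pi> 0 = \<one>"
proof -
  have 0: "0 \<in> model \<G>" using subspace_0[OF subspace_model] .
  then have "\<pi> 0 \<otimes> \<pi> 0 = \<pi> 0" using \<pi>_add[OF 0 0] by simp
  then show ?thesis using \<pi>_carrier[OF 0] by (simp add: l_cancel_one)
qed

lemma commutative: "g \<in> carrier G \<Longrightarrow> h \<in> carrier G \<Longrightarrow> g \<otimes> h = h \<otimes> g"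
proof -
  assume "g \<in> carrier G" "h \<in> carrier G"
  then obtain v w where "v \<in> model \<G>" "w \<in> model \<G>" "g = \<pi> v" "h = \<pi> w" using \<pi>_onto by blast
  then show ?thesis by (metis \<pi>_add add.commute)
qed

lemma act_commute:
  "g \<in> carrier G \<Longrightarrow> h \<in> carrier G \<Longrightarrow> x \<in> points M \<Longrightarrow> \<rho> g (\<rho> h x) = \<rho> h (\<rho> g x)"
  by (metis act_mult commutative)

lemma act_inv: "g \<in> carrier G \<Longrightarrow> x \<in> points M \<Longrightarrow> \<rho> (inv g) (\<rho> g x) = x"
  by (metis act_mult act_one inv_closed l_inv)

abbreviation \<gg> :: "(real \<Rightarrow> 'g) set" where
  "\<gg> \<equiv> lie_alg G \<G>"

lemma lie_alg_iff: "\<xi> \<in> \<gg> \<longleftrightarrow> smooth_into \<G> UNIV \<xi> \<and> (\<forall>s t. \<xi> (s + t) = \<xi> s \<otimes> \<xi> t)"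
  by (simp add: lie_alg_def smooth_map_real_line_iff[OF \<G>])

lemma lie_alg_smooth: "\<xi> \<in> \<gg> \<Longrightarrow> smooth_into \<G> UNIV \<xi>"
  and lie_alg_add: "\<xi> \<in> \<gg> \<Longrightarrow> \<xi> (s + t) = \<xi> s \<otimes> \<xi> t"
  by (auto simp: lie_alg_iff)

lemma lie_alg_carrier: "\<xi> \<in> \<gg> \<Longrightarrow> \<xi> t \<in> carrier G"
  using smooth_into_points[OF lie_alg_smooth] points_\<G> by blast

lemma lie_alg_zero: "\<xi> \<in> \<gg> \<Longrightarrow> \<xi> 0 = \<one>"
  using lie_alg_add[of \<xi> 0 0] lie_alg_carrier[of \<xi> 0] by (simp add: l_cancel_one)

lemma one_param:
  assumes v: "v \<in> model \<G>" shows "(\<lambda>t. \<pi> (t *\<^sub>R v)) \<in> \<gg>"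
  unfolding lie_alg_iff
proof (intro conjI allI)
  have tv: "t *\<^sub>R v \<in> model \<G>" for t using subspace_scale[OF subspace_model v] .
  have "smooth_into (euclid (model \<G>)) UNIV (\<lambda>t. t *\<^sub>R v)"
    by (rule smooth_into_euclid)
       (use tv in \<open>auto intro: Cinf_bounded_linear bounded_linear_scaleR_left\<close>)
  then show "smooth_into \<G> UNIV (\<lambda>t. \<pi> (t *\<^sub>R v))"
    using smooth_into_compose[OF \<G> _ _ \<pi>_smooth] by (fastforce simp: euclid_def)
  show "\<pi> ((s + t) *\<^sub>R v) = \<pi> (s *\<^sub>R v) \<otimes> \<pi> (t *\<^sub>R v)" for s t
    using \<pi>_add tv by (simp add: scaleR_left_distrib)
qed

lemma smooth_into_act:
  assumes "smooth_into \<G> W g" "smooth_into M W h"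
  shows "smooth_into M W (\<lambda>p. \<rho> (g p) (h p))"
  using smooth_into_compose[OF M smooth_into_Pair[OF \<G> M assms] prod_mfd_chart_inj[OF \<G> M] act_smooth] by simp

lemma smooth_into_flow:
  assumes \<xi>: "\<xi> \<in> \<gg>" and h: "smooth_into M W h"
  shows "smooth_into M (UNIV \<times> W) (\<lambda>p. \<rho> (\<xi> (fst p)) (h (snd p)))"
proof -
  have o: "open (UNIV \<times> W :: (real \<times> _) set)" using smooth_into_open[OF h] by (simp add: open_Times)
  show ?thesis
    by (rule smooth_into_act)
       (auto intro!: smooth_into_reparam[OF \<G> lie_alg_smooth[OF \<xi>] o] smooth_into_reparam[OF M h o]
         Cinf_bounded_linear bounded_linear_fst bounded_linear_snd)
qed

lemma smooth_into_orbit: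
  assumes \<xi>: "\<xi> \<in> \<gg>" and x: "x \<in> points M"
  shows "smooth_into M UNIV (\<lambda>t. \<rho> (\<xi> t) x)"
  by (rule smooth_into_act[OF lie_alg_smooth[OF \<xi>] smooth_into_const[OF open_UNIV x]])

lemma smooth_into_translate:
  "g \<in> carrier G \<Longrightarrow> smooth_into M W h \<Longrightarrow> smooth_into M W (\<lambda>p. \<rho> g (h p))"
  by (rule smooth_into_act) (auto intro: smooth_into_const smooth_into_open simp: points_\<G>)

lemma smooth_fun_translate:
  "g \<in> carrier G \<Longrightarrow> smooth_fun M f \<Longrightarrow> smooth_fun M (\<lambda>x. f (\<rho> g x))"
  by (rule smooth_fun_chartI[OF M])
     (rule smooth_into_smooth_fun[OF M smooth_into_translate[OF _ smooth_into_cpar[OF M]]])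

text \<open>Composing \<open>f\<close> with the action of \<open>\<xi> t\<close> moves the vanishing derivative from time \<open>0\<close> to time \<open>t\<close>, so every
  smooth function is constant along the orbit. Smooth functions separate points.\<close>

lemma inf_stab_eq:
  assumes m: "m \<in> points M"
  shows "inf_stab G \<G> M \<rho> m = {\<xi> \<in> \<gg>. \<forall>t. \<rho> (\<xi> t) m = m}"
proof (intro Set.set_eqI iffI)
  fix \<xi> assume "\<xi> \<in> {\<xi> \<in> \<gg>. \<forall>t. \<rho> (\<xi> t) m = m}"
  then show "\<xi> \<in> inf_stab G \<G> M \<rho> m"
    by (simp add: inf_stab_def gen_field_def)
next
  fix \<xi> assume a: "\<xi> \<in> inf_stab G \<G> M \<rho> m"
  then have \<xi>: "\<xi> \<in> \<gg>" by (simp add: inf_stab_def)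
  have "\<rho> (\<xi> t1) m = m" for t1
  proof (rule ccontr)
    assume ne: "\<rho> (\<xi> t1) m \<noteq> m"
    let ?W = "points M - {\<rho> (\<xi> t1) m}"
    have "closedin (mf_top M) {\<rho> (\<xi> t1) m}"
      using M act_points[OF lie_alg_carrier[OF \<xi>] m]
      by (simp add: smooth_manifold_def closedin_Hausdorff_sing_eq)
    then have W: "openin (mf_top M) ?W" "m \<in> ?W" using m ne by auto
    obtain U \<phi> where U: "(U, \<phi>) \<in> atlas M" "m \<in> U" using chart_cover[OF M m] .
    obtain \<beta> where "Cinf UNIV \<beta>" and \<beta>: "\<beta> (\<phi> m) > 0" "\<forall>x\<in>U. \<beta> (\<phi> x) \<noteq> 0 \<longrightarrow> x \<in> ?W"
      "\<forall>F :: 'f \<Rightarrow> real. Cinf UNIV F \<longrightarrow> smooth_fun M (\<lambda>x. if x \<in> U then \<beta> (\<phi> x) *\<^sub>R F (\<phi> x) else 0)"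
      by (rule bump_function[OF M U W, where ?'b = real])
    define f where "f x = (if x \<in> U then \<beta> (\<phi> x) *\<^sub>R (1::real) else 0)" for x
    have f: "smooth_fun M f" unfolding f_def by (rule \<beta>(3)[rule_format]) (rule Cinf_const)
    define F where "F t = f (\<rho> (\<xi> t) m)" for t
    have CF: "Cinf UNIV F"
      unfolding F_def by (rule smooth_into_smooth_fun[OF M smooth_into_orbit[OF \<xi> m] f])
    have "(F has_real_derivative 0) (at t)" for t
    proof -
      have "F differentiable (at t)"
        using Cinf_has_derivative[OF CF] differentiable_def by blast
      then obtain d where d: "(F has_real_derivative d) (at t)"
        using real_differentiable_def by blast
      then have "((\<lambda>s. F (t + s)) has_real_derivative d) (at 0)"
        using DERIV_shift[of F d 0 t] by (simp add: add.commute)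
      then have "d = deriv (\<lambda>s. F (t + s)) 0" by (simp add: DERIV_imp_deriv)
      also have "\<dots> = gen_field \<rho> \<xi> m (\<lambda>x. f (\<rho> (\<xi> t) x))"
        by (simp add: gen_field_def F_def lie_alg_add[OF \<xi>] act_mult lie_alg_carrier[OF \<xi>] m)
      also have "\<dots> = 0"
        using a smooth_fun_translate[OF lie_alg_carrier[OF \<xi>] f] by (simp add: inf_stab_def)
      finally show ?thesis using d by simp
    qed
    then have "F t1 = F 0" using DERIV_isconst_all by blast
    moreover have "F t1 = 0" using \<beta>(2) by (auto simp: F_def f_def)
    moreover have "F 0 > 0" using \<beta>(1) U by (simp add: F_def f_def lie_alg_zero[OF \<xi>] act_one m)
    ultimately show False by simp
  qed
  then show "\<xi> \<in> {\<xi> \<in> \<gg>. \<forall>t. \<rho> (\<xi> t) m = m}" using \<xi> by simp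
qed

end

section \<open>Weight functions\<close>

context torus_action
begin

definition weight_fun :: "('m \<Rightarrow> complex) \<Rightarrow> bool" where
  "weight_fun f \<longleftrightarrow> smooth_fun M f \<and>
     (\<forall>g\<in>carrier G. \<exists>c. cmod c = 1 \<and> (\<forall>x\<in>points M. f (\<rho> g x) = c * f x))"

text \<open>For \<open>v \<in> B\<close> this is a Fourier coefficient of \<open>f\<close> along the circle through \<open>v\<close>, as a function of the base
  point of the orbit.\<close>

definition circ_coeff :: "'e \<Rightarrow> int \<Rightarrow> ('m \<Rightarrow> complex) \<Rightarrow> 'm \<Rightarrow> complex" where
  "circ_coeff v k f x = integral {0..1} (\<lambda>t. ecirc k t * f (\<rho> (\<pi> (t *\<^sub>R v)) x))"

lemma Cinf_circ_integrand:
  assumes v: "v \<in> model \<G>" and f: "smooth_fun M f" and h: "smooth_into M W h"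
  shows "Cinf (UNIV \<times> W) (\<lambda>p. ecirc k (fst p) * f (\<rho> (\<pi> (fst p *\<^sub>R v)) (h (snd p))))"
proof -
  have o: "open (UNIV \<times> W :: (real \<times> _) set)" using smooth_into_open[OF h] by (simp add: open_Times)
  show ?thesis
    by (intro Cinf_mult o smooth_into_smooth_fun[OF M smooth_into_flow[OF one_param[OF v] h] f]
        Cinf_compose[OF o Cinf_bounded_linear[OF bounded_linear_fst] Cinf_ecirc]) simp
qed

lemma smooth_fun_circ_coeff:
  assumes v: "v \<in> model \<G>" and f: "smooth_fun M f"
  shows "smooth_fun M (circ_coeff v k f)"
proof (rule smooth_fun_chartI[OF M])
  fix U \<phi> assume c: "(U, \<phi>) \<in> atlas M"
  show "Cinf (cdom M U \<phi>) (\<lambda>u. circ_coeff v k f (cpar M U \<phi> u))"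
    using Cinf_integral_parameter[OF open_cdom[OF M c] Cinf_circ_integrand[OF v f smooth_into_cpar[OF M c]], of k]
    by (simp add: circ_coeff_def)
qed

lemma continuous_on_orbit:
  fixes f :: "'m \<Rightarrow> 'c::euclidean_space"
  assumes v: "v \<in> model \<G>" and f: "smooth_fun M f" and x: "x \<in> points M"
  shows "continuous_on S (\<lambda>t. f (\<rho> (\<pi> (t *\<^sub>R v)) x))"
  using Cinf_continuous_on[OF smooth_into_smooth_fun[OF M smooth_into_orbit[OF one_param[OF v] x] f]]
  by (rule continuous_on_subset) simp

lemma \<pi>_circ_period:
  assumes "b \<in> B" shows "\<pi> ((t + 1) *\<^sub>R b) = \<pi> (t *\<^sub>R b)"
proof -
  have b: "b \<in> model \<G>" using assms span_base span_B by blast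
  then have "t *\<^sub>R b \<in> model \<G>" using subspace_scale[OF subspace_model] by blast
  then show ?thesis
    using \<pi>_add[of "t *\<^sub>R b" b] b \<pi>_B[OF assms] \<pi>_carrier by (simp add: scaleR_left_distrib)
qed

text \<open>Moving the base point along the circle shifts the integrand, which multiplies a Fourier coefficient by
  a character.\<close>

lemma circ_coeff_shift:
  assumes b: "b \<in> B" and f: "smooth_fun M f" and x: "x \<in> points M"
  shows "circ_coeff b k f (\<rho> (\<pi> (s *\<^sub>R b)) x) = ecirc k (- s) * circ_coeff b k f x"
proof -
  have bm: "b \<in> model \<G>" using b span_base span_B by blast
  then have tb: "t *\<^sub>R b \<in> model \<G>" for t using subspace_scale[OF subspace_model] by blast
  define p where "p t = ecirc k t * f (\<rho> (\<pi> (t *\<^sub>R b)) x)" for t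
  have "ecirc k t * f (\<rho> (\<pi> (t *\<^sub>R b)) (\<rho> (\<pi> (s *\<^sub>R b)) x)) = ecirc k (- s) * p (t + s)" for t
  proof -
    have "\<rho> (\<pi> (t *\<^sub>R b)) (\<rho> (\<pi> (s *\<^sub>R b)) x) = \<rho> (\<pi> ((t + s) *\<^sub>R b)) x"
      using \<pi>_add tb \<pi>_carrier x by (simp add: scaleR_left_distrib act_mult)
    moreover have "ecirc k t = ecirc k (- s) * ecirc k (t + s)"
      by (simp flip: ecirc_add)
    ultimately show ?thesis by (simp add: p_def)
  qed
  then have "circ_coeff b k f (\<rho> (\<pi> (s *\<^sub>R b)) x) = ecirc k (- s) * integral {0..1} (\<lambda>t. p (t + s))"
    by (simp add: circ_coeff_def)
  also have "integral {0..1} (\<lambda>t. p (t + s)) = integral {0..1} p"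
  proof (rule integral_periodic_shift)
    show "continuous_on UNIV p"
      unfolding p_def by (intro continuous_intros continuous_on_orbit[OF bm f x])
    have "ecirc k (t + 1) = ecirc k t" for t by (simp add: ecirc_add)
    then show "p (t + 1) = p t" for t by (simp add: p_def \<pi>_circ_period[OF b])
  qed
  finally show ?thesis by (simp add: circ_coeff_def p_def[abs_def])
qed

text \<open>Since the torus is commutative, averaging along one circle preserves the weight along the others.\<close>

lemma circ_coeff_translate:
  assumes v: "v \<in> model \<G>" and g: "g \<in> carrier G" and x: "x \<in> points M"
    and c: "\<And>y. y \<in> points M \<Longrightarrow> f (\<rho> g y) = c * f y"
  shows "circ_coeff v k f (\<rho> g x) = c * circ_coeff v k f x"
proof -
  have "\<pi> (t *\<^sub>R v) \<in> carrier G" for t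
    using \<pi>_carrier subspace_scale[OF subspace_model v] by blast
  then have eq: "(\<lambda>t. ecirc k t * f (\<rho> (\<pi> (t *\<^sub>R v)) (\<rho> g x))) = (\<lambda>t. c * (ecirc k t * f (\<rho> (\<pi> (t *\<^sub>R v)) x)))"
    using act_commute[OF _ g x] c act_points x by (simp add: mult.left_commute)
  show ?thesis unfolding circ_coeff_def eq by simp
qed

text \<open>Fourier decomposition along one circle of the torus after the other. Applied to the translates of \<open>h\<close>
  along a circle, \<open>L\<close> gives a continuous periodic function with the non-zero value \<open>L h\<close> at \<open>0\<close>. One of its
  Fourier coefficients is non-zero, and it is the value of \<open>L\<close> at a Fourier component of \<open>h\<close>. Fourier
  components vanish on the orbits on which the original function vanishes.\<close>

lemma weight_fun_detects:
  fixes L :: "('m \<Rightarrow> complex) \<Rightarrow> complex"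
  assumes int: "\<And>f v k. smooth_fun M f \<Longrightarrow> v \<in> model \<G> \<Longrightarrow>
        L (circ_coeff v k f) = integral {0..1} (\<lambda>t. ecirc k t * L (\<lambda>x. f (\<rho> (\<pi> (t *\<^sub>R v)) x)))"
    and cont: "\<And>f v. smooth_fun M f \<Longrightarrow> v \<in> model \<G> \<Longrightarrow>
        continuous_on {0..1} (\<lambda>t. L (\<lambda>x. f (\<rho> (\<pi> (t *\<^sub>R v)) x)))"
    and cong: "\<And>f g. (\<And>x. x \<in> points M \<Longrightarrow> f x = g x) \<Longrightarrow> L f = L g"
    and f: "smooth_fun M f" "L f \<noteq> 0"
  obtains h where "weight_fun h" "L h \<noteq> 0"
    "\<forall>x\<in>points M. h x \<noteq> 0 \<longrightarrow> (\<exists>g\<in>carrier G. f (\<rho> g x) \<noteq> 0)"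
proof -
  define wt where "wt h v \<longleftrightarrow> (\<exists>c. cmod c = 1 \<and> (\<forall>x\<in>points M. h (\<rho> (\<pi> v) x) = c * h x))" for h v
  have bm: "b \<in> model \<G>" if "b \<in> B" for b using that span_base span_B by blast
  have tm: "t *\<^sub>R b \<in> model \<G>" if "b \<in> B" for t b using bm[OF that] subspace_scale[OF subspace_model] by blast
  have "\<exists>h. smooth_fun M h \<and> L h \<noteq> 0 \<and> (\<forall>x\<in>points M. h x \<noteq> 0 \<longrightarrow> (\<exists>g\<in>carrier G. f (\<rho> g x) \<noteq> 0)) \<and>
      (\<forall>b\<in>C. \<forall>t. wt h (t *\<^sub>R b))" if "finite C" "C \<subseteq> B" for C
    using that
  proof (induction C rule: finite_induct)
    case empty
    then show ?case using f act_one one_closed by (intro exI[of _ f]) (auto intro!: bexI[of _ \<one>])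
  next
    case (insert b C)
    then obtain h where h: "smooth_fun M h" "L h \<noteq> 0"
      "\<And>x. x \<in> points M \<Longrightarrow> h x \<noteq> 0 \<Longrightarrow> \<exists>g\<in>carrier G. f (\<rho> g x) \<noteq> 0" "\<And>c t. c \<in> C \<Longrightarrow> wt h (t *\<^sub>R c)"
      by auto
    have b: "b \<in> B" using insert by simp
    define q where "q t = L (\<lambda>x. h (\<rho> (\<pi> (t *\<^sub>R b)) x))" for t
    have q0: "q 0 = L h" unfolding q_def by (rule cong) (simp add: \<pi>_zero act_one)
    have q1: "q 1 = L h" unfolding q_def by (rule cong) (simp add: \<pi>_B[OF b] act_one)
    have "continuous_on {0..1} q" unfolding q_def by (rule cont[OF h(1) bm[OF b]])
    then obtain k where k: "integral {0..1} (\<lambda>t. ecirc k t * q t) \<noteq> 0"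
      using fourier_coeffs_zero_imp_zero[of q 0] q0 q1 h(2) by auto
    let ?h = "circ_coeff b k h"
    show ?case
    proof (intro exI[of _ ?h] conjI ballI allI impI)
      show "smooth_fun M ?h" using smooth_fun_circ_coeff[OF bm[OF b] h(1)] .
      show "L ?h \<noteq> 0" using k int[OF h(1) bm[OF b]] by (simp add: q_def)
    next
      fix x assume x: "x \<in> points M" "?h x \<noteq> 0"
      obtain t where t: "h (\<rho> (\<pi> (t *\<^sub>R b)) x) \<noteq> 0"
      proof (rule ccontr)
        assume "\<not> thesis"
        then have "\<And>t. h (\<rho> (\<pi> (t *\<^sub>R b)) x) = 0" using that by blast
        then show False using x(2) by (simp add: circ_coeff_def)
      qed
      have c: "\<pi> (t *\<^sub>R b) \<in> carrier G" using \<pi>_carrier tm[OF b] by blast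
      obtain g where "g \<in> carrier G" "f (\<rho> g (\<rho> (\<pi> (t *\<^sub>R b)) x)) \<noteq> 0"
        using h(3)[OF act_points[OF c x(1)] t] by blast
      then show "\<exists>g\<in>carrier G. f (\<rho> g x) \<noteq> 0"
        using act_mult[OF _ c x(1)] c by (metis m_closed)
    next
      fix c t assume "c \<in> insert b C"
      then consider "c = b" | "c \<in> C" by blast
      then show "wt ?h (t *\<^sub>R c)"
      proof cases
        case 1
        show ?thesis unfolding wt_def 1
          by (rule exI[of _ "ecirc k (- t)"]) (simp add: circ_coeff_shift[OF b h(1)])
      next
        case 2
        then obtain d where d: "cmod d = 1" "\<And>x. x \<in> points M \<Longrightarrow> h (\<rho> (\<pi> (t *\<^sub>R c)) x) = d * h x"
          using h(4)[of c t] by (auto simp: wt_def)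
        have "\<pi> (t *\<^sub>R c) \<in> carrier G" using 2 insert.prems tm \<pi>_carrier by blast
        then show ?thesis
          unfolding wt_def using d circ_coeff_translate[OF bm[OF b], of "\<pi> (t *\<^sub>R c)" _ h d k] by blast
      qed
    qed
  qed
  from this[OF fin_B] obtain h where h: "smooth_fun M h" "L h \<noteq> 0"
      "\<And>x. x \<in> points M \<Longrightarrow> h x \<noteq> 0 \<Longrightarrow> \<exists>g\<in>carrier G. f (\<rho> g x) \<noteq> 0" "\<And>b t. b \<in> B \<Longrightarrow> wt h (t *\<^sub>R b)"
    by auto
  have wt: "wt h v \<and> v \<in> model \<G>" if "v \<in> span B" for v
    using that
  proof (induction rule: span_induct_alt)
    case base
    then show ?case
      using subspace_0[OF subspace_model] by (auto simp: wt_def \<pi>_zero act_one intro!: exI[of _ 1])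
  next
    case (step t b w)
    obtain c where c: "cmod c = 1" "\<And>x. x \<in> points M \<Longrightarrow> h (\<rho> (\<pi> (t *\<^sub>R b)) x) = c * h x"
      using h(4)[OF step(1), of t] unfolding wt_def by blast
    obtain d where d: "cmod d = 1" "\<And>x. x \<in> points M \<Longrightarrow> h (\<rho> (\<pi> w) x) = d * h x"
      using step(2) unfolding wt_def by blast
    have w: "w \<in> model \<G>" using step(2) by simp
    have "h (\<rho> (\<pi> (t *\<^sub>R b + w)) x) = (c * d) * h x" if x: "x \<in> points M" for x
      using \<pi>_add[OF tm[OF step(1)] w] act_mult x act_points \<pi>_carrier w tm[OF step(1)] c d by simp
    then show ?case
      unfolding wt_def using c(1) d(1) subspace_add[OF subspace_model tm[OF step(1)] w]
      by (intro conjI exI[of _ "c * d"]) (simp_all add: norm_mult)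
  qed
  have "weight_fun h"
    unfolding weight_fun_def
  proof (intro conjI ballI)
    fix g assume "g \<in> carrier G"
    then obtain v where "g = \<pi> v" "v \<in> span B" using span_B \<pi>_onto by blast
    then show "\<exists>c. cmod c = 1 \<and> (\<forall>x\<in>points M. h (\<rho> g x) = c * h x)"
      using wt unfolding wt_def by blast
  qed (fact h(1))
  then show thesis using that h by blast
qed

text \<open>With evaluation at \<open>m\<close> for \<open>L\<close>, a bump function has a weight component that does not vanish at \<open>m\<close>.
  Its squared modulus is invariant.\<close>

lemma invariant_bump:
  assumes m: "m \<in> points M" and W: "openin (mf_top M) W" "m \<in> W"
  obtains f :: "'m \<Rightarrow> real" where "smooth_fun M f" "f m > 0" "\<forall>x\<in>points M. f x \<ge> 0"
    "\<forall>g\<in>carrier G. \<forall>x\<in>points M. f (\<rho> g x) = f x"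
    "\<forall>x\<in>points M. f x \<noteq> 0 \<longrightarrow> (\<exists>g\<in>carrier G. \<rho> g x \<in> W)"
proof -
  obtain U \<phi> where U: "(U, \<phi>) \<in> atlas M" "m \<in> U" using chart_cover[OF M m] .
  obtain \<beta> where "Cinf UNIV \<beta>" and \<beta>: "\<beta> (\<phi> m) > 0" "\<forall>x\<in>U. \<beta> (\<phi> x) \<noteq> 0 \<longrightarrow> x \<in> W"
      "\<forall>F :: 'f \<Rightarrow> complex. Cinf UNIV F \<longrightarrow> smooth_fun M (\<lambda>x. if x \<in> U then \<beta> (\<phi> x) *\<^sub>R F (\<phi> x) else 0)"
    by (rule bump_function[OF M U W, where ?'b = complex])
  define b where "b x = (if x \<in> U then \<beta> (\<phi> x) *\<^sub>R (1::complex) else 0)" for x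
  have b: "smooth_fun M b" unfolding b_def by (rule \<beta>(3)[rule_format]) (rule Cinf_const)
  have bm: "b m \<noteq> 0" using \<beta>(1) U by (simp add: b_def)
  obtain h where h: "weight_fun h" "h m \<noteq> 0" "\<forall>x\<in>points M. h x \<noteq> 0 \<longrightarrow> (\<exists>g\<in>carrier G. b (\<rho> g x) \<noteq> 0)"
    by (rule weight_fun_detects[of "\<lambda>f. f m" b])
       (use continuous_on_orbit[OF _ _ m] b bm m in \<open>auto simp: circ_coeff_def\<close>)
  have hs: "smooth_fun M h" using h(1) by (simp add: weight_fun_def)
  show thesis
  proof (rule that[of "\<lambda>x. (cmod (h x))\<^sup>2"])
    have "smooth_fun M (\<lambda>x. h x \<bullet> h x)"
      by (rule smooth_fun_compose[OF M hs, of UNIV "\<lambda>z. z \<bullet> z"]) (intro Cinf_inner Cinf_id open_UNIV, simp)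
    then show "smooth_fun M (\<lambda>x. (cmod (h x))\<^sup>2)" by (simp add: power2_norm_eq_inner)
    show "(cmod (h m))\<^sup>2 > 0" using h(2) by simp
    show "\<forall>g\<in>carrier G. \<forall>x\<in>points M. (cmod (h (\<rho> g x)))\<^sup>2 = (cmod (h x))\<^sup>2"
      using h(1) unfolding weight_fun_def by (metis mult_1 norm_mult)
    show "\<forall>x\<in>points M. (cmod (h x))\<^sup>2 \<noteq> 0 \<longrightarrow> (\<exists>g\<in>carrier G. \<rho> g x \<in> W)"
    proof (intro ballI impI)
      fix x assume "x \<in> points M" "(cmod (h x))\<^sup>2 \<noteq> 0"
      then obtain g where "g \<in> carrier G" "b (\<rho> g x) \<noteq> 0" using h(3) by auto
      then show "\<exists>g\<in>carrier G. \<rho> g x \<in> W" using \<beta>(2) by (auto simp: b_def split: if_splits)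
    qed
  qed simp
qed

text \<open>With the derivative in direction \<open>u\<close> at \<open>m\<close> for \<open>L\<close>, applied to a cut-off linear coordinate.
  Compatibility with averaging is differentiation under the integral sign.\<close>

lemma weight_funs_separate_tangents:
  assumes U: "(U, \<phi>) \<in> atlas M" "m \<in> U" and u: "u \<in> model M" "u \<noteq> 0"
  obtains h where "weight_fun h" "frechet_derivative (\<lambda>y. h (cpar M U \<phi> y)) (at (\<phi> m)) u \<noteq> 0"
proof -
  let ?c = "cpar M U \<phi>" and ?W = "cdom M U \<phi>" and ?p = "\<phi> m" and ?P = "oproj (model M)"
  let ?D = "\<lambda>f. frechet_derivative (\<lambda>y. f (?c y) :: complex) (at ?p) u"
  let ?H = "\<lambda>f v k p. ecirc k (fst p) * f (\<rho> (\<pi> (fst p *\<^sub>R v)) (?c (snd p)))"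
  have m: "m \<in> points M" using U chart_subset[OF M] by blast
  have p: "?p \<in> ?W" using chart_in_cdom[OF M U] .
  note od = open_cdom[OF M U(1)] and sc = smooth_into_cpar[OF M U(1)]
  obtain \<beta> where \<beta>: "Cinf UNIV \<beta>" "\<beta> ?p > 0" and "\<forall>x\<in>U. \<beta> (\<phi> x) \<noteq> 0 \<longrightarrow> x \<in> points M"
      and \<beta>': "\<forall>F :: 'f \<Rightarrow> complex. Cinf UNIV F \<longrightarrow> smooth_fun M (\<lambda>x. if x \<in> U then \<beta> (\<phi> x) *\<^sub>R F (\<phi> x) else 0)"
    by (rule bump_function[OF M U openin_topspace m, where ?'b = complex])
  define F where "F y = complex_of_real ((y - ?p) \<bullet> u)" for y
  define f where "f x = (if x \<in> U then \<beta> (\<phi> x) *\<^sub>R F (\<phi> x) else 0)" for x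
  have CF: "Cinf UNIV F"
    unfolding F_def
    by (rule Cinf_linear_compose[OF bounded_linear_of_real])
       (intro open_UNIV Cinf_inner Cinf_diff Cinf_id Cinf_const)+
  have f: "smooth_fun M f" unfolding f_def by (rule \<beta>'[rule_format, OF CF])
  have "((\<lambda>y. \<beta> y *\<^sub>R F y) has_derivative (\<lambda>w. \<beta> ?p *\<^sub>R complex_of_real (w \<bullet> u) + frechet_derivative \<beta> (at ?p) w *\<^sub>R F ?p)) (at ?p)"
    unfolding F_def
    by (intro has_derivative_scaleR Cinf_has_derivative[OF \<beta>(1)] UNIV_I)
       (auto intro!: derivative_eq_intros)
  moreover have "(?P has_derivative ?P) (at ?p)"
    using bounded_linear_oproj[OF model_subspace[OF M]] by (rule bounded_linear_imp_has_derivative)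
  moreover have Pp: "?P ?p = ?p" using oproj_id[OF model_subspace[OF M] chart_in_model[OF M U]] .
  ultimately have "((\<lambda>y. \<beta> (?P y) *\<^sub>R F (?P y)) has_derivative (\<lambda>w. \<beta> ?p *\<^sub>R complex_of_real (?P w \<bullet> u) + frechet_derivative \<beta> (at ?p) (?P w) *\<^sub>R F ?p)) (at ?p)"
    using has_derivative_compose[of ?P ?P ?p UNIV] by fastforce
  then have "((\<lambda>y. f (?c y)) has_derivative (\<lambda>w. \<beta> ?p *\<^sub>R complex_of_real (?P w \<bullet> u) + frechet_derivative \<beta> (at ?p) (?P w) *\<^sub>R F ?p)) (at ?p)"
    by (rule has_derivative_transform_within_open[OF _ od p])
       (simp add: f_def cpar_in[OF M] chart_cpar[OF M])
  then have "?D f = \<beta> ?p *\<^sub>R complex_of_real (?P u \<bullet> u) + frechet_derivative \<beta> (at ?p) (?P u) *\<^sub>R F ?p"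
    by (simp flip: frechet_derivative_at)
  also have "\<dots> = \<beta> ?p *\<^sub>R complex_of_real (u \<bullet> u)"
    using oproj_id[OF model_subspace[OF M] u(1)] by (simp add: F_def)
  finally have Df: "?D f \<noteq> 0" using u(2) \<beta>(2) by simp
  have flow: "Cinf (UNIV \<times> ?W) (?H f v k)"
    if "smooth_fun M f" "v \<in> model \<G>" for f :: "'m \<Rightarrow> complex" and v k
    by (rule Cinf_circ_integrand[OF that(2,1) sc])
  have part: "frechet_derivative (?H f v k) (at (t, ?p)) (0, u)
      = ecirc k t * ?D (\<lambda>x. f (\<rho> (\<pi> (t *\<^sub>R v)) x))" 
    if fv: "smooth_fun M f" "v \<in> model \<G>" for f :: "'m \<Rightarrow> complex" and v k t
  proof -
    have H: "(?H f v k has_derivative frechet_derivative (?H f v k) (at (t, ?p))) (at (t, ?p))"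
      using Cinf_has_derivative[OF flow[OF fv]] p by simp
    have "(Pair t has_derivative Pair 0) (at ?p)" by (auto intro!: derivative_eq_intros)
    from has_derivative_compose[OF this H]
    have 1: "((\<lambda>y. ecirc k t * f (\<rho> (\<pi> (t *\<^sub>R v)) (?c y))) has_derivative
        (\<lambda>w. frechet_derivative (?H f v k) (at (t, ?p)) (0, w))) (at ?p)" by simp
    have "\<pi> (t *\<^sub>R v) \<in> carrier G" using \<pi>_carrier subspace_scale[OF subspace_model fv(2)] by blast
    then have "Cinf (?W) (\<lambda>y. f (\<rho> (\<pi> (t *\<^sub>R v)) (?c y)))"
      using smooth_into_smooth_fun[OF M smooth_into_translate[OF _ sc] fv(1)] by blast
    from has_derivative_mult_right[OF Cinf_has_derivative[OF this p], of "ecirc k t"]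
    have "((\<lambda>y. ecirc k t * f (\<rho> (\<pi> (t *\<^sub>R v)) (?c y))) has_derivative
        (\<lambda>w. ecirc k t * frechet_derivative (\<lambda>y. f (\<rho> (\<pi> (t *\<^sub>R v)) (?c y))) (at ?p) w)) (at ?p)" .
    from has_derivative_unique[OF 1 this] show ?thesis by metis
  qed
  obtain h where "weight_fun h" "?D h \<noteq> 0"
  proof (rule weight_fun_detects[of ?D f])
    fix f :: "'m \<Rightarrow> complex" and v k assume fv: "smooth_fun M f" "v \<in> model \<G>"
    have "Ck_on (Suc 0) (UNIV \<times> ?W) (?H f v k)"
      using flow[OF fv] unfolding Cinf_def by blast
    from integral_has_derivative_parameter[OF od this p]
    show "?D (circ_coeff v k f) = integral {0..1} (\<lambda>t. ecirc k t * ?D (\<lambda>x. f (\<rho> (\<pi> (t *\<^sub>R v)) x)))"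
      by (simp add: circ_coeff_def part[OF fv] flip: frechet_derivative_at)
  next
    fix f :: "'m \<Rightarrow> complex" and v assume fv: "smooth_fun M f" "v \<in> model \<G>"
    have "continuous_on (UNIV \<times> ?W) (\<lambda>q. frechet_derivative (?H f v 0) (at q) (0, u))"
      by (intro Cinf_continuous_on Cinf_frechet_derivative flow fv)
    then have "continuous_on {0..1} (\<lambda>t. frechet_derivative (?H f v 0) (at (t, ?p)) (0, u))"
      by (rule continuous_on_compose2) (use p in \<open>auto intro!: continuous_intros\<close>)
    then show "continuous_on {0..1} (\<lambda>t. ?D (\<lambda>x. f (\<rho> (\<pi> (t *\<^sub>R v)) x)))"
      unfolding part[OF fv] by simp
  next
    fix f g :: "'m \<Rightarrow> complex" assume eq: "\<And>x. x \<in> points M \<Longrightarrow> f x = g x"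
    have *: "((\<lambda>y. f (?c y)) has_derivative D) (at ?p) \<longleftrightarrow> ((\<lambda>y. g (?c y)) has_derivative D) (at ?p)" for D
      using has_derivative_transform_within_open[OF _ od p, of "\<lambda>y. f (?c y)" D UNIV "\<lambda>y. g (?c y)"]
        has_derivative_transform_within_open[OF _ od p, of "\<lambda>y. g (?c y)" D UNIV "\<lambda>y. f (?c y)"]
        eq cpar_in[OF M] chart_subset[OF M U(1)] by (metis subsetD)
    show "?D f = ?D g" unfolding frechet_derivative_def * ..
  qed (use f Df in auto)
  then show thesis using that by blast
qed

end

section \<open>Linearization near a point\<close>

text \<open>A finite subfamily whose common kernel has minimal dimension does the job.\<close>

lemma finite_separating_family:
  fixes D :: "'i \<Rightarrow> 'a::euclidean_space \<Rightarrow> 'b::real_vector"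
  assumes S: "subspace S" and lin: "\<And>h. h \<in> H \<Longrightarrow> linear (D h)"
    and sep: "\<And>u. u \<in> S \<Longrightarrow> u \<noteq> 0 \<Longrightarrow> \<exists>h\<in>H. D h u \<noteq> 0"
  obtains F where "finite F" "F \<subseteq> H" "\<forall>u\<in>S. (\<forall>h\<in>F. D h u = 0) \<longrightarrow> u = 0"
proof -
  define K where "K F = {u \<in> S. \<forall>h\<in>F. D h u = 0}" for F
  have sub: "subspace (K F)" if "F \<subseteq> H" for F
    using that S lin by (auto simp: subspace_def K_def linear_add linear_cmul linear_0 subset_iff)
  obtain F where F: "finite F \<and> F \<subseteq> H" and min: "\<And>F'. finite F' \<and> F' \<subseteq> H \<Longrightarrow> dim (K F) \<le> dim (K F')"
    using ex_has_least_nat[of "\<lambda>F. finite F \<and> F \<subseteq> H" "{}" "\<lambda>F. dim (K F)"] by auto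
  have "u = 0" if u: "u \<in> S" "\<forall>h\<in>F. D h u = 0" for u
  proof (rule ccontr)
    assume "u \<noteq> 0"
    then obtain h where h: "h \<in> H" "D h u \<noteq> 0" using sep u(1) by blast
    have "K (insert h F) \<subset> K F" using u h by (auto simp: K_def)
    then have "span (K (insert h F)) \<subset> span (K F)"
      using sub[of F] sub[of "insert h F"] F h by (metis insert_subset span_eq_iff)
    then have "dim (K (insert h F)) < dim (K F)" by (rule dim_psubset)
    then show False using min[of "insert h F"] F h by simp
  qed
  then show thesis using that[of F] F by blast
qed

lemma Cinf_local_homeomorphism:
  fixes f :: "'a::euclidean_space \<Rightarrow> 'a"
  assumes W: "open W" "p \<in> W" and f: "Cinf W f"
    and inj: "\<And>w. frechet_derivative f (at p) w = 0 \<Longrightarrow> w = 0"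
  obtains T V g where "open T" "T \<subseteq> W" "p \<in> T" "open V" "f p \<in> V" "homeomorphism T V f g"
proof -
  let ?D = "\<lambda>x. frechet_derivative f (at x)"
  have der: "(f has_derivative ?D x) (at x)" if "x \<in> W" for x
    using Cinf_has_derivative[OF f that] .
  have app: "blinfun_apply (Blinfun (?D x)) = ?D x" if "x \<in> W" for x
    using has_derivative_bounded_linear[OF der[OF that]] by (rule bounded_linear_Blinfun_apply)
  have lin: "linear (?D p)"
    using has_derivative_bounded_linear[OF der[OF W(2)]] by (simp add: bounded_linear.linear)
  then have "inj (?D p)" using inj by (simp add: linear_injective_0)
  then obtain l where l: "linear l" "l \<circ> ?D p = id"
    using linear_injective_left_inverse[OF lin] by auto
  have bl: "blinfun_apply (Blinfun l) = l"
    using l(1) by (simp add: bounded_linear_Blinfun_apply linear_conv_bounded_linear)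
  have cont: "continuous_on W (\<lambda>x. Blinfun (?D x))"
  proof (rule continuous_on_blinfun_componentwise)
    fix i :: 'a
    have "continuous_on W (\<lambda>x. ?D x i)"
      by (rule Cinf_continuous_on[OF Cinf_frechet_derivative[OF f]])
    then show "continuous_on W (\<lambda>x. blinfun_apply (Blinfun (?D x)) i)"
      by (rule continuous_on_eq) (simp add: app)
  qed
  have inv: "Blinfun l o\<^sub>L Blinfun (?D p) = id_blinfun"
    using l(2) by (intro blinfun_eqI) (simp add: bl app[OF W(2)] fun_eq_iff)
  show thesis
    by (rule inverse_function_theorem[OF W(1) _ cont W(2) inv])
       (use der app that in auto)
qed

context torus_action
begin

text \<open>For small times the orbit stays in \<open>N\<close>, and every time is a multiple of a small one.\<close>

lemma flow_fixes_if_near: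
  assumes \<xi>: "\<xi> \<in> \<gg>" and x: "x \<in> points M" and N: "openin (mf_top M) N" "x \<in> N"
    and near: "\<And>t. \<rho> (\<xi> t) x \<in> N \<Longrightarrow> \<rho> (\<xi> t) x = x"
  shows "\<rho> (\<xi> t) x = x"
proof -
  have "open {t \<in> UNIV. \<rho> (\<xi> t) x \<in> N}"
    using smooth_into_vimage_open[OF smooth_into_orbit[OF \<xi> x] N(1)] .
  moreover have "0 \<in> {t \<in> UNIV. \<rho> (\<xi> t) x \<in> N}"
    using N(2) by (simp add: lie_alg_zero[OF \<xi>] act_one x)
  ultimately obtain e where e: "e > 0" "\<And>t. \<bar>t\<bar> < e \<Longrightarrow> \<rho> (\<xi> t) x \<in> N"
    unfolding open_dist by (auto simp: dist_real_def)
  obtain n :: nat where n: "\<bar>t\<bar> / e < real n" using reals_Archimedean2 by blast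
  then have "n > 0" using e(1) by (cases n) (auto simp: divide_less_0_iff not_less)
  let ?s = "t / real n"
  have "\<bar>?s\<bar> < e" using n e(1) \<open>n > 0\<close> by (simp add: field_simps)
  then have s: "\<rho> (\<xi> ?s) x = x" using near e(2) by blast
  have "\<rho> (\<xi> (real k * ?s)) x = x" for k
  proof (induction k)
    case 0
    then show ?case by (simp add: lie_alg_zero[OF \<xi>] act_one x)
  next
    case (Suc k)
    have "\<xi> (real (Suc k) * ?s) = \<xi> (real k * ?s) \<otimes> \<xi> ?s"
      using lie_alg_add[OF \<xi>, of "real k * ?s" ?s] by (simp add: algebra_simps add_divide_distrib)
    then show ?case using Suc s act_mult lie_alg_carrier[OF \<xi>] x by simp
  qed
  from this[of n] show ?thesis using \<open>n > 0\<close> by simp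
qed

text \<open>For a weight function \<open>h\<close> with differential \<open>D\<close> at \<open>m\<close>, the adjoint of \<open>D\<close> intertwines the
  character of \<open>h\<close> with the transpose of the isotropy representation on the tangent space.\<close>

lemma weight_fun_adjoint_equivariant:
  assumes U: "(U, \<phi>) \<in> atlas M" "m \<in> U" and h: "weight_fun h"
    and g: "g \<in> carrier G" "\<rho> g m = m" and x: "x \<in> points M"
  defines "D \<equiv> frechet_derivative (\<lambda>y. h (cpar M U \<phi> y)) (at (\<phi> m))"
    and "T \<equiv> frechet_derivative (\<lambda>y. \<phi> (\<rho> (inv g) (cpar M U \<phi> y))) (at (\<phi> m))"
  shows "linear T" and "adjoint D (h (\<rho> g x)) = adjoint T (adjoint D (h x))"
proof -
  let ?p = "\<phi> m"
  have m: "m \<in> points M" using U chart_subset[OF M] by blast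
  have p: "?p \<in> cdom M U \<phi>" using chart_in_cdom[OF M U] .
  note od = open_cdom[OF M U(1)] and sc = smooth_into_cpar[OF M U(1)]
  have cp: "cpar M U \<phi> ?p = m" using cpar_chart[OF M U] .
  have ig: "inv g \<in> carrier G" using g by simp
  have igm: "\<rho> (inv g) m = m" using act_inv[OF g(1) m] g(2) by simp
  obtain c where c: "cmod c = 1" "\<And>x. x \<in> points M \<Longrightarrow> h (\<rho> g x) = c * h x"
    using h g(1) unfolding weight_fun_def by blast
  have cc: "cnj c * c = 1" using c(1) by (metis complex_norm_square mult.commute of_real_1 one_power2)
  have ci: "h (\<rho> (inv g) x) = cnj c * h x" if x: "x \<in> points M" for x
  proof -
    have "h x = c * h (\<rho> (inv g) x)"
      using c(2)[OF act_points[OF ig x]] act_mult[OF g(1) ig x] act_one[OF x] g(1) by simp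
    then show ?thesis using cc by (metis mult.assoc mult_1)
  qed
  let ?t = "\<lambda>y. \<phi> (\<rho> (inv g) (cpar M U \<phi> y))" and ?Q = "{y \<in> cdom M U \<phi>. \<rho> (inv g) (cpar M U \<phi> y) \<in> U}"
  note st = smooth_into_translate[OF ig sc]
  have oQ: "open ?Q" using smooth_into_vimage_open[OF st chart_open[OF M U(1)]] .
  have pQ: "?p \<in> ?Q" using p cp igm U by simp
  have T: "(?t has_derivative T) (at ?p)"
    unfolding T_def by (rule Cinf_has_derivative[OF smooth_into_chart[OF st U(1)] pQ])
  show linT: "linear T" using has_derivative_bounded_linear[OF T] by (simp add: bounded_linear.linear)
  have hs: "smooth_fun M h" using h by (simp add: weight_fun_def)
  have D: "((\<lambda>y. h (cpar M U \<phi> y)) has_derivative D) (at ?p)"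
    unfolding D_def by (rule Cinf_has_derivative[OF smooth_fun_cpar[OF M U(1) hs] p])
  have linD: "linear D" using has_derivative_bounded_linear[OF D] by (simp add: bounded_linear.linear)
  have "?t ?p = ?p" by (simp add: cp igm)
  then have "((\<lambda>y. h (cpar M U \<phi> (?t y))) has_derivative (\<lambda>w. D (T w))) (at ?p)"
    using has_derivative_compose[OF T] D by simp
  then have "((\<lambda>y. cnj c * h (cpar M U \<phi> y)) has_derivative (\<lambda>w. D (T w))) (at ?p)"
  proof (rule has_derivative_transform_within_open[OF _ oQ pQ])
    fix y assume y: "y \<in> ?Q"
    then have "cpar M U \<phi> y \<in> points M" using cpar_in[OF M] chart_subset[OF M U(1)] by blast
    then show "h (cpar M U \<phi> (?t y)) = cnj c * h (cpar M U \<phi> y)"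
      using y ci cpar_chart[OF M U(1)] by simp
  qed
  from has_derivative_unique[OF this has_derivative_mult_right[OF D]]
  have DT: "D (T w) = cnj c * D w" for w by metis
  have "w \<bullet> adjoint D (h (\<rho> g x)) = w \<bullet> adjoint T (adjoint D (h x))" for w
  proof -
    have "w \<bullet> adjoint D (h (\<rho> g x)) = D w \<bullet> (c * h x)"
      using adjoint_works[OF linD] c(2)[OF x] by simp
    also have "\<dots> = (cnj c * D w) \<bullet> h x"
      by (simp add: inner_complex_def algebra_simps)
    also have "\<dots> = w \<bullet> adjoint T (adjoint D (h x))"
      using adjoint_works[OF linT] adjoint_works[OF linD] by (simp add: DT)
    finally show ?thesis .
  qed
  then show "adjoint D (h (\<rho> g x)) = adjoint T (adjoint D (h x))"
    by (rule vector_eq_ldot[THEN iffD1, rule_format])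
qed

text \<open>The coordinates are \<open>\<psi>\<close>, the sum of \<open>D\<^sub>h\<^sup>* h\<close> over finitely many weight functions \<open>h\<close> with
  differentials \<open>D\<^sub>h\<close> at \<open>m\<close>, and \<open>\<theta>\<close> is their inverse on the convex set \<open>C\<close>. The map \<open>L g\<close> is the transpose of
  the isotropy representation of \<open>g\<^sup>-\<^sup>1\<close>. Injectivity of \<open>\<psi>\<close> on \<open>N\<close> is what turns an identity for \<open>\<psi>\<close> along an
  orbit into a fixed point.\<close>

lemma linearization:
  assumes m: "m \<in> points M"
  obtains N C and \<psi> :: "'m \<Rightarrow> 'f" and \<theta> L where
    "openin (mf_top M) N" "m \<in> N" "convex C" "continuous_map (top_of_set C) (mf_top M) \<theta>"
    "\<forall>x\<in>N. \<psi> x \<in> C \<and> \<theta> (\<psi> x) = x" "\<forall>w\<in>C. \<theta> w \<in> N \<and> \<psi> (\<theta> w) = w"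
    "\<forall>g\<in>carrier G. \<rho> g m = m \<longrightarrow> linear (L g)"
    "\<forall>x\<in>N. \<forall>\<xi>\<in>\<gg>. (\<forall>t. \<rho> (\<xi> t) x = x) \<longleftrightarrow>
        (\<forall>t. \<rho> (\<xi> t) m = m \<and> L (\<xi> t) (\<psi> x) = \<psi> x)"
proof -
  obtain U \<phi> where U: "(U, \<phi>) \<in> atlas M" "m \<in> U" using chart_cover[OF M m] .
  let ?p = "\<phi> m" and ?P = "oproj (model M)" and ?W = "cdom M U \<phi>" and ?c = "cpar M U \<phi>"
  note mod = model_subspace[OF M] and od = open_cdom[OF M U(1)] and sc = smooth_into_cpar[OF M U(1)]
  have p: "?p \<in> ?W" using chart_in_cdom[OF M U] .
  have cp: "?c ?p = m" using cpar_chart[OF M U] .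
  have Pp: "?P ?p = ?p" using oproj_id[OF mod chart_in_model[OF M U]] .
  have linP: "linear ?P" using linear_oproj[OF mod] .
  have PP: "?P (?P u) = ?P u" for u using oproj_id[OF mod oproj_in[OF mod]] .
  define D where "D h = frechet_derivative (\<lambda>y. h (?c y) :: complex) (at ?p)" for h
  have D: "((\<lambda>y. h (?c y)) has_derivative D h) (at ?p)" and CD: "Cinf ?W (\<lambda>y. h (?c y))" if "weight_fun h" for h
    using that Cinf_has_derivative[OF smooth_fun_cpar[OF M U(1)] p] smooth_fun_cpar[OF M U(1)]
    by (auto simp: D_def weight_fun_def)
  have linD: "linear (D h)" if "weight_fun h" for h
    using has_derivative_bounded_linear[OF D[OF that]] by (simp add: bounded_linear.linear)
  have DP: "D h (?P w) = D h w" if h: "weight_fun h" for h w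
  proof -
    have "(?P has_derivative ?P) (at ?p)"
      using bounded_linear_oproj[OF mod] by (rule bounded_linear_imp_has_derivative)
    then have "((\<lambda>y. h (?c (?P y))) has_derivative (\<lambda>w. D h (?P w))) (at ?p)"
      using has_derivative_compose[of ?P ?P ?p UNIV "\<lambda>y. h (?c y)" "D h"] D[OF h] Pp by simp
    then have "((\<lambda>y. h (?c y)) has_derivative (\<lambda>w. D h (?P w))) (at ?p)"
      by (simp add: cpar_def PP)
    then show ?thesis using has_derivative_unique[OF D[OF h]] by metis
  qed
  obtain F where F: "finite F" "F \<subseteq> Collect weight_fun" "\<forall>u\<in>model M. (\<forall>h\<in>F. D h u = 0) \<longrightarrow> u = 0"
  proof (rule finite_separating_family[OF mod, of "Collect weight_fun" D])
    show "\<exists>h\<in>Collect weight_fun. D h u \<noteq> 0" if "u \<in> model M" "u \<noteq> 0" for u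
      using weight_funs_separate_tangents[OF U that] unfolding D_def by blast
  qed (use linD in auto)
  have wF: "weight_fun h" if "h \<in> F" for h using that F(2) by blast
  have adj: "u \<bullet> adjoint (D h) z = D h u \<bullet> z" if "h \<in> F" for u h z
    using adjoint_works[OF linD[OF wF[OF that]]] .
  have lin_adj: "linear (adjoint (D h))" if "h \<in> F" for h
    using adjoint_linear[OF linD[OF wF[OF that]]] .
  define \<psi> where "\<psi> x = (\<Sum>h\<in>F. adjoint (D h) (h x))" for x
  have adj_model: "adjoint (D h) z \<in> model M" if h: "h \<in> F" for h z
  proof -
    let ?y = "adjoint (D h) z"
    have "(?y - ?P ?y) \<bullet> (?y - ?P ?y) = (?y - ?P ?y) \<bullet> ?y"
      using oproj_orth[OF mod oproj_in[OF mod], of ?y ?y] by (simp add: inner_diff_right)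
    also have "\<dots> = D h (?P (?y - ?P ?y)) \<bullet> z"
      using adj[OF h] DP[OF wF[OF h]] by simp
    also have "?P (?y - ?P ?y) = 0" by (simp add: linear_diff[OF linP] PP)
    finally have "?y = ?P ?y" using linear_0[OF linD[OF wF[OF h]]] by simp
    then show ?thesis using oproj_in[OF mod] by metis
  qed
  have \<psi>_model: "\<psi> x \<in> model M" for x
    unfolding \<psi>_def by (rule subspace_sum[OF mod adj_model])
  \<comment> \<open>The first summand fills up the directions orthogonal to the model space, in order that the inverse function theorem applies.\<close>
  define f where "f u = (u - ?P u) + \<psi> (?c u)" for u
  have bl_adj: "bounded_linear (adjoint (D h))" if "h \<in> F" for h
    using lin_adj[OF that] by (simp add: linear_conv_bounded_linear)
  have Cs: "Cinf ?W (\<lambda>u. \<psi> (?c u))"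
    unfolding \<psi>_def
  proof (rule Cinf_sum[OF od])
    fix h assume "h \<in> F"
    then show "Cinf ?W (\<lambda>u. adjoint (D h) (h (?c u)))"
      using Cinf_linear_compose[OF bl_adj od CD] wF by blast
  qed
  have Cf: "Cinf ?W f"
    unfolding f_def
    by (rule Cinf_add[OF od Cinf_diff[OF od Cinf_id Cinf_bounded_linear[OF bounded_linear_oproj[OF mod]]] Cs])
  have ds: "((\<lambda>u. \<psi> (?c u)) has_derivative (\<lambda>w. \<Sum>h\<in>F. adjoint (D h) (D h w))) (at ?p)"
    unfolding \<psi>_def
  proof (rule has_derivative_sum)
    fix h assume "h \<in> F"
    then show "((\<lambda>u. adjoint (D h) (h (?c u))) has_derivative (\<lambda>w. adjoint (D h) (D h w))) (at ?p)"
      using bounded_linear.has_derivative[OF bl_adj D] wF by blast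
  qed
  have df: "(f has_derivative (\<lambda>w. (w - ?P w) + (\<Sum>h\<in>F. adjoint (D h) (D h w)))) (at ?p)"
    unfolding f_def
    by (rule has_derivative_add[OF has_derivative_diff[OF has_derivative_ident
          bounded_linear_imp_has_derivative[OF bounded_linear_oproj[OF mod]]] ds])
  have inj: "w = 0" if "frechet_derivative f (at ?p) w = 0" for w
  proof -
    have "(w - ?P w) + (\<Sum>h\<in>F. adjoint (D h) (D h w)) = 0"
      using that unfolding frechet_derivative_at[OF df, symmetric] .
    then have "0 = w \<bullet> ((w - ?P w) + (\<Sum>h\<in>F. adjoint (D h) (D h w)))" by simp
    also have "\<dots> = w \<bullet> (w - ?P w) + (\<Sum>h\<in>F. D h w \<bullet> D h w)"
      by (simp add: inner_add_right inner_sum_right adj)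
    also have "w \<bullet> (w - ?P w) = (w - ?P w) \<bullet> (w - ?P w)"
      using oproj_orth[OF mod oproj_in[OF mod], of w w] by (simp add: inner_diff_left inner_commute)
    finally have s: "(w - ?P w) \<bullet> (w - ?P w) + (\<Sum>h\<in>F. D h w \<bullet> D h w) = 0" by simp
    have nn: "(\<Sum>h\<in>F. D h w \<bullet> D h w) \<ge> 0" by (rule sum_nonneg) simp
    then have "w - ?P w = 0" "(\<Sum>h\<in>F. D h w \<bullet> D h w) = 0"
      using s inner_ge_zero[of "w - ?P w"] by (auto simp: add_nonneg_eq_0_iff)
    then have "w \<in> model M" "\<forall>h\<in>F. D h w = 0"
      using oproj_in[OF mod, of w] F(1) by (auto simp: sum_nonneg_eq_0_iff)
    then show ?thesis using F(3) by blast
  qed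
  obtain T V g where T: "open T" "T \<subseteq> ?W" "?p \<in> T" "open V" "f ?p \<in> V" "homeomorphism T V f g"
    using Cinf_local_homeomorphism[OF od p Cf inj] by blast
  have gf: "g (f u) = u" if "u \<in> T" for u using T(6) that by (simp add: homeomorphism_def)
  have fg: "f (g v) = v" "g v \<in> T" if "v \<in> V" for v using T(6) that by (auto simp: homeomorphism_def)
  have cg: "continuous_on V g" using T(6) by (simp add: homeomorphism_def)
  \<comment> \<open>On \<open>N0\<close> the weight functions in \<open>F\<close> that do not vanish at \<open>m\<close> still do not vanish.\<close>
  define N0 where "N0 = {x \<in> points M. \<forall>h\<in>F. h m \<noteq> 0 \<longrightarrow> h x \<noteq> 0}"
  have "openin (mf_top M) {x \<in> points M. h m \<noteq> 0 \<longrightarrow> h x \<noteq> 0}" if "h \<in> F" for h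
  proof (cases "h m = 0")
    case False
    have "openin (mf_top M) {x \<in> points M. h x \<in> - {0}}"
      by (rule openin_continuous_map_preimage[OF smooth_fun_continuous[OF M]])
         (use wF[OF that] in \<open>auto simp: weight_fun_def\<close>)
    then show ?thesis using False by simp
  qed simp
  then have "openin (mf_top M) (points M \<inter> (\<Inter>h\<in>F. {x \<in> points M. h m \<noteq> 0 \<longrightarrow> h x \<noteq> 0}))"
    using F(1) by (cases "F = {}") (auto intro: openin_INT2)
  also have "points M \<inter> (\<Inter>h\<in>F. {x \<in> points M. h m \<noteq> 0 \<longrightarrow> h x \<noteq> 0}) = N0"
    by (auto simp: N0_def)
  finally have N0: "openin (mf_top M) N0" .
  let ?T = "T \<inter> {u \<in> ?W. ?c u \<in> N0}"
  have oT: "open ?T" using T(1) smooth_into_vimage_open[OF sc N0] by blast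
  have "open {v \<in> V. g v \<in> ?T}"
    using continuous_open_preimage[OF cg T(4) oT] by (simp add: vimage_def Int_def)
  moreover have "f ?p \<in> {v \<in> V. g v \<in> ?T}"
    using T gf[OF T(3)] p cp m by (auto simp: N0_def)
  ultimately obtain r where r: "r > 0" "ball (f ?p) r \<subseteq> {v \<in> V. g v \<in> ?T}"
    using open_contains_ball by blast
  define C where "C = ball (f ?p) r \<inter> model M"
  define \<theta> where "\<theta> w = ?c (g w)" for w
  define N where "N = {x \<in> U. \<phi> x \<in> {u \<in> ?T. f u \<in> ball (f ?p) r}}"
  have "open {u \<in> ?T. f u \<in> ball (f ?p) r}"
    by (rule Cinf_vimage_open[OF oT Cinf_subset[OF Cf]]) (use T in auto)
  then have oN: "openin (mf_top M) N" unfolding N_def by (rule chart_vimage_open[OF M U(1)])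
  have f\<phi>: "f (\<phi> x) = \<psi> x" if "x \<in> U" for x
    using cpar_chart[OF M U(1) that] oproj_id[OF mod chart_in_model[OF M U(1) that]] by (simp add: f_def)
  have mN: "m \<in> N" using U T(2,3) p cp m r(1) by (auto simp: N_def N0_def)
  have NM: "N \<subseteq> points M" using oN openin_subset by blast
  have \<psi>N: "\<psi> x \<in> C \<and> \<theta> (\<psi> x) = x" if "x \<in> N" for x
  proof -
    have x: "x \<in> U" "\<phi> x \<in> T" "f (\<phi> x) \<in> ball (f ?p) r" using that by (auto simp: N_def)
    then show ?thesis
      using f\<phi>[OF x(1)] gf[OF x(2)] \<psi>_model cpar_chart[OF M U(1) x(1)] by (simp add: C_def \<theta>_def)
  qed
  have \<theta>C: "\<theta> w \<in> N \<and> \<psi> (\<theta> w) = w" if w: "w \<in> C" for w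
  proof -
    let ?u = "g w"
    have wV: "w \<in> V" "?u \<in> ?T" "w \<in> model M" "w \<in> ball (f ?p) r" using w r by (auto simp: C_def)
    have fu: "f ?u = w" using fg(1)[OF wV(1)] .
    \<comment> \<open>Preimages of points of the model space lie in the model space, hence come from points of \<open>M\<close>.\<close>
    have "?u - ?P ?u = w - \<psi> (?c ?u)" using fu by (simp add: f_def algebra_simps)
    then have "?u - ?P ?u \<in> model M" using wV(3) \<psi>_model subspace_diff[OF mod] by metis
    then have "(?u - ?P ?u) \<bullet> (?u - ?P ?u) = 0" by (rule oproj_orth[OF mod])
    then have Pu: "?P ?u = ?u" by simp
    have cU: "?c ?u \<in> U" using cpar_in[OF M] wV(2) by blast
    have \<phi>c: "\<phi> (?c ?u) = ?u" using chart_cpar[OF M] wV(2) Pu by auto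
    then show ?thesis
      using f\<phi>[OF cU] fu wV cU by (simp add: N_def \<theta>_def)
  qed
  have "continuous_map (top_of_set C) (top_of_set ?W) g"
    using r(2) T(2) by (auto simp: C_def continuous_map_in_subtopology intro!: continuous_on_subset[OF cg])
  then have c\<theta>: "continuous_map (top_of_set C) (mf_top M) \<theta>"
    using continuous_map_compose[OF _ smooth_into_continuous[OF sc], of "top_of_set C" g]
    by (simp add: o_def \<theta>_def[abs_def])
  define L where "L g = adjoint (frechet_derivative (\<lambda>y. \<phi> (\<rho> (inv g) (?c y))) (at ?p))" for g
  obtain h0 where h0: "weight_fun h0"
    by (rule that) (auto simp: weight_fun_def intro!: smooth_fun_const[OF M, of 0] exI[of _ 1])
  have linL: "linear (L g)" if "g \<in> carrier G" "\<rho> g m = m" for g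
    unfolding L_def using adjoint_linear[OF weight_fun_adjoint_equivariant(1)[OF U h0 that m]] .
  have L: "\<psi> (\<rho> g x) = L g (\<psi> x)" if g: "g \<in> carrier G" "\<rho> g m = m" and x: "x \<in> points M" for g x
  proof -
    have "adjoint (D h) (h (\<rho> g x)) = L g (adjoint (D h) (h x))" if "h \<in> F" for h
      using weight_fun_adjoint_equivariant(2)[OF U wF[OF that] g x] by (simp add: L_def D_def)
    then show ?thesis by (simp add: \<psi>_def linear_sum[OF linL[OF g]])
  qed
  have esc: "\<rho> (\<xi> t) x = x" if \<xi>: "\<xi> \<in> \<gg>" and x: "x \<in> N" and eq: "\<And>t. \<psi> (\<rho> (\<xi> t) x) = \<psi> x" for \<xi> x t
  proof (rule flow_fixes_if_near[OF \<xi> _ oN x])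
    show "x \<in> points M" using x NM by blast
    fix t assume "\<rho> (\<xi> t) x \<in> N"
    then have "\<rho> (\<xi> t) x = \<theta> (\<psi> (\<rho> (\<xi> t) x))" using \<psi>N by simp
    also have "\<dots> = x" using eq \<psi>N[OF x] by simp
    finally show "\<rho> (\<xi> t) x = x" .
  qed
  have stab: "(\<forall>t. \<rho> (\<xi> t) x = x) \<longleftrightarrow> (\<forall>t. \<rho> (\<xi> t) m = m \<and> L (\<xi> t) (\<psi> x) = \<psi> x)"
    if x: "x \<in> N" and \<xi>: "\<xi> \<in> \<gg>" for x \<xi>
  proof
    have xM: "x \<in> points M" using x NM by blast
    note \<xi>c = lie_alg_carrier[OF \<xi>]
    {
      assume fx: "\<forall>t. \<rho> (\<xi> t) x = x"
      have heq: "h (\<rho> (\<xi> t) m) = h m" if h: "h \<in> F" for h t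
      proof -
        obtain c where c: "\<And>x. x \<in> points M \<Longrightarrow> h (\<rho> (\<xi> t) x) = c * h x"
          using wF[OF h] \<xi>c[of t] unfolding weight_fun_def by blast
        show ?thesis
        proof (cases "h m = 0")
          case True
          then show ?thesis using c[OF m] by simp
        next
          case False
          have "?c (\<phi> x) = x" using x cpar_chart[OF M U(1)] by (simp add: N_def)
          then have "x \<in> N0" using x by (auto simp: N_def)
          then have "h x \<noteq> 0" using False h by (simp add: N0_def)
          \<comment> \<open>The character of \<open>h\<close> is trivial at \<open>\<xi> t\<close>, as \<open>h\<close> does not vanish at the fixed point \<open>x\<close>.\<close>
          then have "c = 1" using c[OF xM] fx by simp
          then show ?thesis using c[OF m] by simp
        qed
      qed
      have "\<psi> (\<rho> (\<xi> t) m) = \<psi> m" for t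
        unfolding \<psi>_def by (rule sum.cong[OF refl]) (rule arg_cong[OF heq])
      then have fm: "\<rho> (\<xi> t) m = m" for t by (rule esc[OF \<xi> mN])
      have "L (\<xi> t) (\<psi> x) = \<psi> x" for t
        using L[OF \<xi>c fm xM, symmetric, of t] fx by simp
      then show "\<forall>t. \<rho> (\<xi> t) m = m \<and> L (\<xi> t) (\<psi> x) = \<psi> x" using fm by blast
    }
    assume "\<forall>t. \<rho> (\<xi> t) m = m \<and> L (\<xi> t) (\<psi> x) = \<psi> x"
    then have "\<psi> (\<rho> (\<xi> t) x) = \<psi> x" for t using L[OF \<xi>c _ xM] by simp
    then show "\<forall>t. \<rho> (\<xi> t) x = x" using esc[OF \<xi> x] by blast
  qed
  show thesis
  proof (rule that[of N C \<theta> \<psi> L])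
    show "convex C" unfolding C_def using mod by (simp add: convex_Int subspace_imp_convex)
    show "\<forall>x\<in>N. \<psi> x \<in> C \<and> \<theta> (\<psi> x) = x" using \<psi>N by blast
    show "\<forall>w\<in>C. \<theta> w \<in> N \<and> \<psi> (\<theta> w) = w" using \<theta>C by blast
    show "\<forall>g\<in>carrier G. \<rho> g m = m \<longrightarrow> linear (L g)" using linL by blast
    show "\<forall>x\<in>N. \<forall>\<xi>\<in>\<gg>. (\<forall>t. \<rho> (\<xi> t) x = x) \<longleftrightarrow>
        (\<forall>t. \<rho> (\<xi> t) m = m \<and> L (\<xi> t) (\<psi> x) = \<psi> x)"
      using stab by blast
  qed (fact oN mN c\<theta>)+
qed

end

section \<open>Infinitesimal orbit type strata\<close>

context torus_action
begin

abbreviation stab :: "'m \<Rightarrow> (real \<Rightarrow> 'g) set" where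
  "stab \<equiv> inf_stab G \<G> M \<rho>"

text \<open>The points \<open>y\<close> in question form the stratum of \<open>m\<close> within \<open>N\<close>, the tip of the cone; \<open>\<gamma>\<close> is a ray from the tip to
  \<open>x\<close>.\<close>

definition conical_nbhd :: "'m \<Rightarrow> 'm set \<Rightarrow> bool" where
  "conical_nbhd m N \<longleftrightarrow> openin (mf_top M) N \<and> m \<in> N \<and> (\<forall>x\<in>N. stab x \<subseteq> stab m) \<and>
     (\<forall>x\<in>N. \<forall>y\<in>N. stab y = stab m \<longrightarrow>
        (\<exists>\<gamma>. continuous_map (top_of_set {0..1}) (mf_top M) \<gamma> \<and> \<gamma> 0 = y \<and> \<gamma> 1 = x \<and>
             (\<forall>s\<in>{0<..1::real}. stab (\<gamma> s) = stab x)))"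

text \<open>In linearizing coordinates the rays are straight segments: an operator that fixes \<open>\<psi> y\<close> fixes an interior
  point of the segment from \<open>\<psi> y\<close> to \<open>\<psi> x\<close> if and only if it fixes \<open>\<psi> x\<close>.\<close>

lemma conical_nbhd_exists:
  assumes m: "m \<in> points M" shows "\<exists>N. conical_nbhd m N"
proof -
  obtain N C and \<psi> :: "'m \<Rightarrow> 'f" and \<theta> L where
    N: "openin (mf_top M) N" "m \<in> N" and C: "convex C" "continuous_map (top_of_set C) (mf_top M) \<theta>"
    and \<psi>: "\<forall>x\<in>N. \<psi> x \<in> C \<and> \<theta> (\<psi> x) = x" and \<theta>: "\<forall>w\<in>C. \<theta> w \<in> N \<and> \<psi> (\<theta> w) = w"
    and linL: "\<forall>g\<in>carrier G. \<rho> g m = m \<longrightarrow> linear (L g)"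
    and fixed: "\<forall>x\<in>N. \<forall>\<xi>\<in>\<gg>. (\<forall>t. \<rho> (\<xi> t) x = x) \<longleftrightarrow>
        (\<forall>t. \<rho> (\<xi> t) m = m \<and> L (\<xi> t) (\<psi> x) = \<psi> x)"
    using linearization[OF m] .
  have NM: "N \<subseteq> points M" using N(1) openin_subset by blast
  have st: "stab x = {\<xi> \<in> stab m. \<forall>t. L (\<xi> t) (\<psi> x) = \<psi> x}" if x: "x \<in> N" for x
  proof -
    have "x \<in> points M" using x NM by blast
    then show ?thesis unfolding inf_stab_eq[OF m] using fixed x by (auto simp: inf_stab_eq)
  qed
  have "\<exists>\<gamma>. continuous_map (top_of_set {0..1}) (mf_top M) \<gamma> \<and> \<gamma> 0 = y \<and> \<gamma> 1 = x \<and>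
            (\<forall>s\<in>{0<..1::real}. stab (\<gamma> s) = stab x)"
    if x: "x \<in> N" and y: "y \<in> N" "stab y = stab m" for x y
  proof -
    define \<sigma> where "\<sigma> s = (1 - s) *\<^sub>R \<psi> y + s *\<^sub>R \<psi> x" for s :: real
    have \<sigma>C: "\<sigma> s \<in> C" if "s \<in> {0..1}" for s
      unfolding \<sigma>_def using C(1) \<psi> x y(1) that by (auto intro: convexD)
    have "continuous_map (top_of_set {0..1}) (top_of_set C) \<sigma>"
      unfolding \<sigma>_def using \<sigma>C
      by (auto simp: continuous_map_in_subtopology \<sigma>_def intro!: continuous_intros)
    then have cont: "continuous_map (top_of_set {0..1}) (mf_top M) (\<lambda>s. \<theta> (\<sigma> s))"
      using continuous_map_compose[OF _ C(2), of "top_of_set {0..1}" \<sigma>] by (simp add: o_def)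
    have "stab (\<theta> (\<sigma> s)) = stab x" if s: "s \<in> {0<..1}" for s
    proof -
      have s0: "s \<in> {0..1}" "s \<noteq> 0" using s by auto
      have \<theta>s: "\<theta> (\<sigma> s) \<in> N" "\<psi> (\<theta> (\<sigma> s)) = \<sigma> s" using \<theta> \<sigma>C[OF s0(1)] by auto
      have "L (\<xi> t) (\<sigma> s) = \<sigma> s \<longleftrightarrow> L (\<xi> t) (\<psi> x) = \<psi> x" if \<xi>: "\<xi> \<in> stab m" for \<xi> t
      proof -
        have "\<xi> t \<in> carrier G" "\<rho> (\<xi> t) m = m"
          using \<xi> m by (auto simp: inf_stab_eq lie_alg_carrier)
        then have l: "linear (L (\<xi> t))" using linL by blast
        have "L (\<xi> t) (\<psi> y) = \<psi> y" using st[OF y(1)] y(2) \<xi> by blast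
        then have "L (\<xi> t) (\<sigma> s) - \<sigma> s = s *\<^sub>R (L (\<xi> t) (\<psi> x) - \<psi> x)"
          by (simp add: \<sigma>_def linear_add[OF l] linear_cmul[OF l] scaleR_diff_right)
        then show ?thesis using s0(2) by (metis diff_self eq_iff_diff_eq_0 scaleR_eq_0_iff)
      qed
      then show ?thesis unfolding st[OF \<theta>s(1)] st[OF x] \<theta>s(2) by blast
    qed
    moreover have "\<theta> (\<sigma> 0) = y" "\<theta> (\<sigma> 1) = x" using \<psi> x y(1) by (auto simp: \<sigma>_def)
    ultimately show ?thesis using cont by blast
  qed
  moreover have "\<forall>x\<in>N. stab x \<subseteq> stab m" using st by blast
  ultimately have "conical_nbhd m N" unfolding conical_nbhd_def using N by (intro conjI ballI impI) simp_all
  then show ?thesis by (rule exI)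
qed

definition orbit_type_set :: "'m \<Rightarrow> 'm set" where
  "orbit_type_set x = {z \<in> points M. stab z = stab x}"

definition stratum :: "'m \<Rightarrow> 'm set" where
  "stratum x = connected_component_of_set (subtopology (mf_top M) (orbit_type_set x)) x"

lemma topspace_orbit_type [simp]: "topspace (subtopology (mf_top M) (orbit_type_set x)) = orbit_type_set x"
  by (auto simp: orbit_type_set_def)

lemma orbit_type_set_eq: "stab x = stab y \<Longrightarrow> orbit_type_set x = orbit_type_set y"
  by (simp add: orbit_type_set_def)

lemma stratum_refl: "x \<in> points M \<Longrightarrow> x \<in> stratum x"
  by (simp add: stratum_def connected_component_of_refl orbit_type_set_def)

lemma stratum_subset: "stratum x \<subseteq> orbit_type_set x"
  using connected_component_of_subset_topspace[of "subtopology (mf_top M) (orbit_type_set x)" x]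
  by (simp add: stratum_def)

lemma stratum_points: "stratum x \<subseteq> points M"
  using stratum_subset by (auto simp: orbit_type_set_def)

lemma stab_stratum: "y \<in> stratum x \<Longrightarrow> stab y = stab x"
  using stratum_subset by (auto simp: orbit_type_set_def)

lemma stratum_connected: "connectedin (mf_top M) (stratum x)"
  using connectedin_connected_component_of[of "subtopology (mf_top M) (orbit_type_set x)" x]
  by (simp add: stratum_def connectedin_subtopology)

lemma stratum_maximal:
  assumes "connectedin (mf_top M) S" "x \<in> S" "\<And>y. y \<in> S \<Longrightarrow> stab y = stab x"
  shows "S \<subseteq> stratum x"
  unfolding stratum_def
proof (rule connected_component_of_maximal[OF _ assms(2)])
  have "S \<subseteq> points M" using assms(1) by (simp add: connectedin_def)
  then have "S \<subseteq> orbit_type_set x" using assms(3) unfolding orbit_type_set_def by blast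
  then show "connectedin (subtopology (mf_top M) (orbit_type_set x)) S"
    using assms(1) by (simp add: connectedin_subtopology)
qed

lemma stratum_eq: assumes "y \<in> stratum x" shows "stratum y = stratum x"
proof -
  have "connected_component_of (subtopology (mf_top M) (orbit_type_set x)) x y"
    using assms by (simp add: stratum_def)
  then have "connected_component_of (subtopology (mf_top M) (orbit_type_set x)) x =
      connected_component_of (subtopology (mf_top M) (orbit_type_set x)) y"
    unfolding connected_component_of_equiv[of _ x y] by blast
  then show ?thesis
    using orbit_type_set_eq[OF stab_stratum[OF assms]] by (simp add: stratum_def)
qed

text \<open>A ray from \<open>y\<close> to \<open>z\<close> runs in the stratum of \<open>z\<close> after time \<open>0\<close>.\<close>

lemma closure_of_stratum_local:
  assumes N: "conical_nbhd m N" and z: "z \<in> N" and y: "y \<in> N" "stab y = stab m"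
  shows "y \<in> mf_top M closure_of stratum z"
proof -
  obtain \<gamma> where \<gamma>: "continuous_map (top_of_set {0..1}) (mf_top M) \<gamma>" "\<gamma> 0 = y" "\<gamma> 1 = z"
    "\<forall>s\<in>{0<..1::real}. stab (\<gamma> s) = stab z"
    using N[unfolded conical_nbhd_def] z y by blast
  have "connectedin (top_of_set {0..1}) {0<..1::real}"
    by (auto simp: connectedin_subtopology)
  then have "connectedin (mf_top M) (\<gamma> ` {0<..1})"
    using connectedin_continuous_map_image[OF \<gamma>(1)] by blast
  moreover have "z \<in> \<gamma> ` {0<..1}" using \<gamma>(3) by (intro image_eqI[of _ _ 1]) auto
  ultimately have sub: "\<gamma> ` {0<..1} \<subseteq> stratum z"
    by (rule stratum_maximal) (use \<gamma>(4) in auto)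
  show ?thesis
    unfolding in_closure_of
  proof (intro conjI allI impI)
    show "y \<in> points M" using y(1) N openin_subset unfolding conical_nbhd_def by blast
    fix T assume T: "y \<in> T \<and> openin (mf_top M) T"
    let ?I = "{s \<in> {0..1}. \<gamma> s \<in> T}"
    have "openin (top_of_set {0..1}) ?I"
      using openin_continuous_map_preimage[OF \<gamma>(1), of T] T by simp
    then have "\<forall>s\<in>?I. \<exists>e>0. \<forall>s'\<in>{0..1}. dist s' s < e \<longrightarrow> s' \<in> ?I"
      unfolding openin_euclidean_subtopology_iff by (rule conjunct2)
    moreover have "0 \<in> ?I" using T \<gamma>(2) by simp
    ultimately have "\<exists>e>0. \<forall>s'\<in>{0..1}. dist s' 0 < e \<longrightarrow> s' \<in> ?I" by (rule bspec)
    then obtain e where e: "e > 0" "\<And>s. s \<in> {0..1} \<Longrightarrow> dist s 0 < e \<Longrightarrow> \<gamma> s \<in> T"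
      by blast
    have "min 1 (e / 2) \<in> {0<..1}" "\<gamma> (min 1 (e / 2)) \<in> T"
      using e(1) by (auto intro!: e(2) simp: dist_real_def)
    then show "\<exists>y. y \<in> stratum z \<and> y \<in> T" using sub by blast
  qed
qed

text \<open>The frontier condition. By the cone structure at its points, the part of the stratum of \<open>m\<close> in the
  closure of the stratum of \<open>x\<close> is open as well as closed in the stratum of \<open>m\<close>, and it contains \<open>m\<close>.\<close>

lemma stratum_subset_closure:
  assumes m: "m \<in> points M"
  obtains N where "openin (mf_top M) N" "m \<in> N" "\<forall>x\<in>N. stab x \<subseteq> stab m"
    "\<forall>x\<in>N. stratum m \<subseteq> mf_top M closure_of stratum x"
proof -
  obtain N where N: "conical_nbhd m N" using conical_nbhd_exists[OF m] by blast
  have "stratum m \<subseteq> mf_top M closure_of stratum x" if x: "x \<in> N" for x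
  proof -
    let ?Y = "stratum x" and ?S = "stratum m"
    let ?T = "?S \<inter> mf_top M closure_of ?Y"
    have "connected_space (subtopology (mf_top M) ?S)"
      using stratum_connected by (simp add: connectedin_def)
    moreover have "closedin (subtopology (mf_top M) ?S) ?T"
      by (metis Int_commute closedin_closure_of closedin_subtopology)
    moreover have "openin (subtopology (mf_top M) ?S) ?T"
    proof (subst openin_subopen, rule ballI)
      fix y assume y: "y \<in> ?T"
      then have yM: "y \<in> points M" using stratum_points by blast
      obtain K where K: "conical_nbhd y K" using conical_nbhd_exists[OF yM] by blast
      then have "openin (mf_top M) K" "y \<in> K" by (auto simp: conical_nbhd_def)
      then obtain z where z: "z \<in> ?Y" "z \<in> K" using y by (auto simp: in_closure_of)
      have "K \<inter> ?S \<subseteq> ?T"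
      proof
        fix w assume w: "w \<in> K \<inter> ?S"
        have "stab w = stab y" using w y stab_stratum by auto
        then have "w \<in> mf_top M closure_of stratum z" using closure_of_stratum_local[OF K z(2)] w by blast
        then show "w \<in> ?T" using w stratum_eq[OF z(1)] by simp
      qed
      moreover have "openin (subtopology (mf_top M) ?S) (K \<inter> ?S)"
        using \<open>openin (mf_top M) K\<close> by (auto simp: openin_subtopology)
      ultimately show "\<exists>T. openin (subtopology (mf_top M) ?S) T \<and> y \<in> T \<and> T \<subseteq> ?T"
        using \<open>y \<in> K\<close> y by blast
    qed
    moreover have "m \<in> ?T"
      using closure_of_stratum_local[OF N x] N stratum_refl[OF m] by (auto simp: conical_nbhd_def)
    ultimately have "?T = topspace (subtopology (mf_top M) ?S)"
      unfolding connected_space_clopen_in by blast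
    then show ?thesis using stratum_points[of m] by auto
  qed
  then show thesis using that[of N] N by (auto simp: conical_nbhd_def)
qed

lemma stab_translate:
  assumes g: "g \<in> carrier G" and x: "x \<in> points M" shows "stab (\<rho> g x) = stab x"
proof -
  have "\<rho> (\<xi> t) (\<rho> g x) = \<rho> g x \<longleftrightarrow> \<rho> (\<xi> t) x = x" if "\<xi> \<in> \<gg>" for \<xi> t
  proof -
    have c: "\<rho> (\<xi> t) (\<rho> g x) = \<rho> g (\<rho> (\<xi> t) x)"
      using act_commute[OF lie_alg_carrier[OF that] g x] .
    show ?thesis
    proof
      assume "\<rho> (\<xi> t) (\<rho> g x) = \<rho> g x"
      then have "\<rho> (inv g) (\<rho> g (\<rho> (\<xi> t) x)) = \<rho> (inv g) (\<rho> g x)" using c by simp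
      then show "\<rho> (\<xi> t) x = x"
        using act_inv[OF g act_points[OF lie_alg_carrier[OF that] x]] act_inv[OF g x] by simp
    qed (use c in simp)
  qed
  then show ?thesis using act_points[OF g x] x by (auto simp: inf_stab_eq)
qed

text \<open>The orbits are connected, as the torus is, and lie in a single infinitesimal orbit type.\<close>

lemma stratum_translate:
  assumes g: "g \<in> carrier G" and x: "x \<in> points M" shows "stratum (\<rho> g x) = stratum x"
proof -
  obtain v where v: "v \<in> model \<G>" "g = \<pi> v" using g \<pi>_onto by blast
  let ?\<gamma> = "\<lambda>t. \<rho> (\<pi> (t *\<^sub>R v)) x"
  have "continuous_map euclideanreal (mf_top M) ?\<gamma>"
    using smooth_into_continuous[OF smooth_into_orbit[OF one_param[OF v(1)] x]] by simp
  then have "connectedin (mf_top M) (range ?\<gamma>)"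
    using connectedin_continuous_map_image[of euclideanreal _ ?\<gamma> UNIV] by simp
  moreover have "x \<in> range ?\<gamma>" by (rule image_eqI[of _ _ 0]) (simp_all add: act_one x \<pi>_zero)
  moreover have "stab y = stab x" if y: "y \<in> range ?\<gamma>" for y
  proof -
    obtain t where "y = ?\<gamma> t" using y by blast
    then show ?thesis
      using stab_translate[OF \<pi>_carrier x] subspace_scale[OF subspace_model v(1)] by blast
  qed
  ultimately have "range ?\<gamma> \<subseteq> stratum x" by (rule stratum_maximal)
  moreover have "\<rho> g x \<in> range ?\<gamma>" by (rule image_eqI[of _ _ 1]) (simp_all add: v(2))
  ultimately show ?thesis using stratum_eq by blast
qed

lemma la_add_lie_alg:
  assumes \<xi>: "\<xi> \<in> \<gg>" and \<eta>: "\<eta> \<in> \<gg>" shows "la_add G \<xi> \<eta> \<in> \<gg>"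
  unfolding lie_alg_iff la_add_def
proof (intro conjI allI)
  show "smooth_into \<G> UNIV (\<lambda>t. \<xi> t \<otimes> \<eta> t)"
    using smooth_into_compose[OF \<G> smooth_into_Pair[OF \<G> \<G> lie_alg_smooth[OF \<xi>] lie_alg_smooth[OF \<eta>]]
        prod_mfd_chart_inj[OF \<G> \<G>] mult_smooth] by simp
  fix s t
  have "\<xi> s \<otimes> \<xi> t \<otimes> (\<eta> s \<otimes> \<eta> t) = \<xi> s \<otimes> (\<xi> t \<otimes> \<eta> s) \<otimes> \<eta> t"
    using lie_alg_carrier \<xi> \<eta> by (simp add: m_assoc)
  also have "\<xi> t \<otimes> \<eta> s = \<eta> s \<otimes> \<xi> t" using lie_alg_carrier \<xi> \<eta> commutative by blast
  finally show "\<xi> (s + t) \<otimes> \<eta> (s + t) = \<xi> s \<otimes> \<eta> s \<otimes> (\<xi> t \<otimes> \<eta> t)"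
    using lie_alg_carrier \<xi> \<eta> by (simp add: lie_alg_add m_assoc)
qed

lemma la_scale_lie_alg:
  assumes \<xi>: "\<xi> \<in> \<gg>" shows "la_scale c \<xi> \<in> \<gg>"
  unfolding lie_alg_iff la_scale_def
proof (intro conjI allI)
  show "smooth_into \<G> UNIV (\<lambda>t. \<xi> (c * t))"
    by (rule smooth_into_reparam[OF \<G> lie_alg_smooth[OF \<xi>]])
       (auto intro: Cinf_bounded_linear bounded_linear_mult_right)
qed (simp add: lie_alg_add[OF \<xi>] distrib_left)

lemma la_zero_lie_alg: "la_zero G \<in> \<gg>"
  using smooth_into_const[OF open_UNIV, where M = \<G> and c = \<one>] points_\<G> by (simp add: lie_alg_iff la_zero_def)

lemma subalgebra_stab:
  assumes x: "x \<in> points M" shows "subalgebra G \<G> (stab x)"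
  unfolding subalgebra_def
proof (intro conjI ballI allI)
  show "stab x \<subseteq> \<gg>" using x by (auto simp: inf_stab_eq)
  show "la_zero G \<in> stab x" using x la_zero_lie_alg by (simp add: inf_stab_eq) (simp add: la_zero_def act_one)
  show "la_add G \<xi> \<eta> \<in> stab x" if "\<xi> \<in> stab x" "\<eta> \<in> stab x" for \<xi> \<eta>
    using that x by (simp add: inf_stab_eq la_add_lie_alg) (simp add: la_add_def act_mult lie_alg_carrier)
  show "la_scale c \<xi> \<in> stab x" if "\<xi> \<in> stab x" for c \<xi>
    using that x by (simp add: inf_stab_eq la_scale_lie_alg) (simp add: la_scale_def)
qed

lemma strata_iff: "X \<in> strata G \<G> M \<rho> \<longleftrightarrow> (\<exists>x\<in>points M. X = stratum x)"
proof
  assume "X \<in> strata G \<G> M \<rho>"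
  then obtain h where "X \<in> connected_components_of (subtopology (mf_top M) {m \<in> points M. stab m = h})"
    by (auto simp: strata_def)
  then obtain x where x: "x \<in> points M" "stab x = h"
      "X = connected_component_of_set (subtopology (mf_top M) {m \<in> points M. stab m = h}) x"
    by (auto simp: connected_components_of_def)
  then have "X = stratum x" by (simp add: stratum_def orbit_type_set_def)
  then show "\<exists>x\<in>points M. X = stratum x" using x(1) by blast
next
  assume "\<exists>x\<in>points M. X = stratum x"
  then obtain x where x: "x \<in> points M" "X = stratum x" by blast
  have "x \<in> orbit_type_set x" using x(1) by (simp add: orbit_type_set_def)
  then have "X \<in> connected_components_of (subtopology (mf_top M) (orbit_type_set x))"
    using x(2) unfolding connected_components_of_def topspace_orbit_type stratum_def by blast
  then show "X \<in> strata G \<G> M \<rho>"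
    using subalgebra_stab[OF x(1)] by (auto simp: strata_def orbit_type_set_def)
qed

lemma stratum_stab_eq:
  assumes "x \<in> points M" shows "stratum_stab G \<G> M \<rho> (stratum x) = stab x"
  unfolding stratum_stab_def
  by (rule the_equality) (use stab_stratum stratum_refl[OF assms] in blast)+

end

section \<open>Extension of functionals on subalgebras\<close>

context torus_action
begin

text \<open>Graphs of linear functionals on subalgebras. A linear relation is the graph of a function if and only if
  its fibre over zero is trivial.\<close>

definition linear_graph :: "((real \<Rightarrow> 'g) \<times> real) set \<Rightarrow> bool" where
  "linear_graph R \<longleftrightarrow> R \<subseteq> \<gg> \<times> UNIV \<and>
     (\<forall>\<xi> a \<eta> b. (\<xi>, a) \<in> R \<longrightarrow> (\<eta>, b) \<in> R \<longrightarrow> (la_add G \<xi> \<eta>, a + b) \<in> R) \<and>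
     (\<forall>\<xi> a c. (\<xi>, a) \<in> R \<longrightarrow> (la_scale c \<xi>, c * a) \<in> R) \<and>
     (\<forall>a. (la_zero G, a) \<in> R \<longrightarrow> a = 0)"

lemma la_diff_self:
  assumes "\<xi> \<in> \<gg>" shows "la_add G \<xi> (la_scale (-1) \<xi>) = la_zero G"
proof
  fix t show "la_add G \<xi> (la_scale (-1) \<xi>) t = la_zero G t"
    using lie_alg_add[OF assms, of t "- t"] lie_alg_zero[OF assms]
    by (simp add: la_add_def la_scale_def la_zero_def)
qed

lemma linear_graph_functional:
  assumes R: "linear_graph R" and "(\<xi>, a) \<in> R" "(\<xi>, b) \<in> R" shows "a = b"
proof -
  have "\<xi> \<in> \<gg>" using R assms(2) by (auto simp: linear_graph_def)
  moreover have "(la_scale (-1) \<xi>, (-1) * b) \<in> R" using R assms(3) unfolding linear_graph_def by blast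
  then have "(la_add G \<xi> (la_scale (-1) \<xi>), a + (-1) * b) \<in> R"
    using R assms(2) unfolding linear_graph_def by blast
  ultimately have "a + (-1) * b = 0" using R unfolding linear_graph_def by (metis la_diff_self)
  then show ?thesis by simp
qed

text \<open>The functional is extended by \<open>0\<close> at \<open>\<xi>\<close>.\<close>

lemma linear_graph_extend:
  assumes R: "linear_graph R" and z: "(la_zero G, 0) \<in> R"
    and \<xi>: "\<xi> \<in> \<gg>" "\<xi> \<notin> Domain R"
  defines "R' \<equiv> {(la_add G \<eta> (la_scale c \<xi>), a) | \<eta> c a. (\<eta>, a) \<in> R}"
  shows "linear_graph R'" "R \<subseteq> R'" "\<xi> \<in> Domain R'"
proof -
  have RL: "\<eta> \<in> \<gg>" if "(\<eta>, a) \<in> R" for \<eta> a using R that by (auto simp: linear_graph_def)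
  have add: "(la_add G \<xi> \<eta>, a + b) \<in> R" if "(\<xi>, a) \<in> R" "(\<eta>, b) \<in> R" for \<xi> \<eta> a b
    using R that unfolding linear_graph_def by blast
  have scale: "(la_scale c \<xi>, c * a) \<in> R" if "(\<xi>, a) \<in> R" for \<xi> a c
    using R that unfolding linear_graph_def by blast
  have zero: "a = 0" if "(la_zero G, a) \<in> R" for a
    using R that unfolding linear_graph_def by blast
  have la0: "la_add G \<eta> (la_scale 0 \<xi>) = \<eta>" if "\<eta> \<in> \<gg>" for \<eta>
    using that lie_alg_carrier[OF that] by (auto simp: la_add_def la_scale_def lie_alg_zero[OF \<xi>(1)])
  show "R \<subseteq> R'"
  proof
    fix p assume "p \<in> R"
    then obtain \<eta> a where p: "p = (\<eta>, a)" "(\<eta>, a) \<in> R" by (cases p) auto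
    then have "p = (la_add G \<eta> (la_scale 0 \<xi>), a)" using la0[OF RL] by simp
    then show "p \<in> R'" unfolding R'_def using p(2) by blast
  qed
  have "\<xi> = la_add G (la_zero G) (la_scale 1 \<xi>)"
    using lie_alg_carrier[OF \<xi>(1)] by (auto simp: la_add_def la_scale_def la_zero_def)
  then show "\<xi> \<in> Domain R'" unfolding R'_def using z by blast
  show "linear_graph R'"
    unfolding linear_graph_def
  proof (intro conjI allI impI)
    show "R' \<subseteq> \<gg> \<times> UNIV"
      unfolding R'_def using RL la_add_lie_alg la_scale_lie_alg[OF \<xi>(1)] by blast
  next
    fix \<eta>1 a1 \<eta>2 a2 assume "(\<eta>1, a1) \<in> R'" "(\<eta>2, a2) \<in> R'"
    then obtain \<zeta>1 c1 \<zeta>2 c2 where \<zeta>: "(\<zeta>1, a1) \<in> R" "\<eta>1 = la_add G \<zeta>1 (la_scale c1 \<xi>)"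
        "(\<zeta>2, a2) \<in> R" "\<eta>2 = la_add G \<zeta>2 (la_scale c2 \<xi>)" unfolding R'_def by blast
    have "la_add G \<eta>1 \<eta>2 = la_add G (la_add G \<zeta>1 \<zeta>2) (la_scale (c1 + c2) \<xi>)"
    proof
      fix t
      note c = lie_alg_carrier[OF RL[OF \<zeta>(1)], of t] lie_alg_carrier[OF RL[OF \<zeta>(3)], of t]
        lie_alg_carrier[OF \<xi>(1), of "c1 * t"] lie_alg_carrier[OF \<xi>(1), of "c2 * t"]
      have "\<xi> ((c1 + c2) * t) = \<xi> (c1 * t) \<otimes> \<xi> (c2 * t)"
        by (simp add: distrib_right lie_alg_add[OF \<xi>(1)])
      moreover have "\<xi> (c1 * t) \<otimes> \<zeta>2 t = \<zeta>2 t \<otimes> \<xi> (c1 * t)" using c commutative by blast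
      then have "(\<zeta>1 t \<otimes> \<xi> (c1 * t)) \<otimes> (\<zeta>2 t \<otimes> \<xi> (c2 * t)) = (\<zeta>1 t \<otimes> \<zeta>2 t) \<otimes> (\<xi> (c1 * t) \<otimes> \<xi> (c2 * t))"
        using c by (metis m_assoc m_closed)
      ultimately show "la_add G \<eta>1 \<eta>2 t = la_add G (la_add G \<zeta>1 \<zeta>2) (la_scale (c1 + c2) \<xi>) t"
        by (simp add: \<zeta>(2,4) la_add_def la_scale_def)
    qed
    then show "(la_add G \<eta>1 \<eta>2, a1 + a2) \<in> R'" unfolding R'_def using add[OF \<zeta>(1,3)] by blast
  next
    fix \<eta> a d assume "(\<eta>, a) \<in> R'"
    then obtain \<zeta> c where \<zeta>: "(\<zeta>, a) \<in> R" "\<eta> = la_add G \<zeta> (la_scale c \<xi>)" unfolding R'_def by blast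
    have "la_scale d \<eta> = la_add G (la_scale d \<zeta>) (la_scale (c * d) \<xi>)"
      by (auto simp: \<zeta>(2) la_add_def la_scale_def mult.assoc)
    then show "(la_scale d \<eta>, d * a) \<in> R'" unfolding R'_def using scale[OF \<zeta>(1)] by blast
  next
    fix a assume "(la_zero G, a) \<in> R'"
    then obtain \<zeta> c where \<zeta>: "(\<zeta>, a) \<in> R" "la_zero G = la_add G \<zeta> (la_scale c \<xi>)" unfolding R'_def by blast
    have "c = 0"
    proof (rule ccontr)
      \<comment> \<open>Otherwise \<open>\<xi>\<close> would be a multiple of \<open>\<zeta>\<close>, on which the functional is defined.\<close>
      assume c: "c \<noteq> 0"
      have "\<xi> t = la_scale (- 1 / c) \<zeta> t" for t
      proof -
        let ?s = "t / c"
        have cs: "\<zeta> ?s \<in> carrier G" "\<zeta> (- ?s) \<in> carrier G" "\<xi> t \<in> carrier G"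
          using lie_alg_carrier RL[OF \<zeta>(1)] \<xi>(1) by auto
        have "\<one> = \<zeta> ?s \<otimes> \<xi> t"
          using fun_cong[OF \<zeta>(2), of ?s] c by (simp add: la_zero_def la_add_def la_scale_def)
        moreover have "\<one> = \<zeta> ?s \<otimes> \<zeta> (- ?s)"
          using lie_alg_add[OF RL[OF \<zeta>(1)], of ?s "- ?s"] lie_alg_zero[OF RL[OF \<zeta>(1)]] by simp
        ultimately have "\<xi> t = \<zeta> (- ?s)" using cs by (metis Units_eq Units_l_cancel)
        then show ?thesis by (simp add: la_scale_def)
      qed
      then have "\<xi> = la_scale (- 1 / c) \<zeta>" by blast
      then show False using scale[OF \<zeta>(1)] \<xi>(2) by blast
    qed
    then have "\<zeta> = la_zero G" using \<zeta>(2) la0[OF RL[OF \<zeta>(1)]] by simp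
    then show "a = 0" using zero \<zeta>(1) by simp
  qed
qed

text \<open>By Zorn's lemma there is a maximal extension, and it is defined everywhere by the previous lemma.\<close>

lemma functional_extends:
  assumes h: "subalgebra G \<G> h" and \<alpha>: "\<alpha> \<in> dual_space G h"
  obtains \<beta> where "\<beta> \<in> dual_space G (\<gg>)" "restrict \<beta> h = \<alpha>"
proof -
  let ?gr = "{(\<xi>, \<alpha> \<xi>) | \<xi>. \<xi> \<in> h}"
  let ?A = "{R. linear_graph R \<and> ?gr \<subseteq> R}"
  have z: "la_zero G \<in> h" using h by (simp add: subalgebra_def)
  have "la_scale 0 (la_zero G) = la_zero G" by (simp add: la_scale_def la_zero_def)
  then have \<alpha>0: "\<alpha> (la_zero G) = 0" using \<alpha> z by (auto simp: dual_space_def) (metis mult_zero_left)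
  have "linear_graph ?gr"
    using h \<alpha> \<alpha>0 by (auto simp: linear_graph_def subalgebra_def dual_space_def)
  then have ne: "?A \<noteq> {}" by blast
  have un: "\<Union>\<C> \<in> ?A" if C: "\<C> \<noteq> {}" "subset.chain ?A \<C>" for \<C>
  proof -
    have mem: "linear_graph R" "?gr \<subseteq> R" if "R \<in> \<C>" for R
      using C(2) that by (auto simp: subset.chain_def)
    have tot: "R \<subseteq> S \<or> S \<subseteq> R" if "R \<in> \<C>" "S \<in> \<C>" for R S
      using C(2) that unfolding subset.chain_def by blast
    have "linear_graph (\<Union>\<C>)"
      unfolding linear_graph_def
    proof (intro conjI allI impI)
      show "\<Union>\<C> \<subseteq> \<gg> \<times> UNIV" using mem(1) unfolding linear_graph_def by blast
    next
      fix \<xi> a \<eta> b assume "(\<xi>, a) \<in> \<Union>\<C>" "(\<eta>, b) \<in> \<Union>\<C>"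
      then obtain R where "R \<in> \<C>" "(\<xi>, a) \<in> R" "(\<eta>, b) \<in> R" using tot by blast
      then show "(la_add G \<xi> \<eta>, a + b) \<in> \<Union>\<C>" using mem(1) unfolding linear_graph_def by blast
    next
      fix \<xi> a c assume "(\<xi>, a) \<in> \<Union>\<C>"
      then show "(la_scale c \<xi>, c * a) \<in> \<Union>\<C>" using mem(1) unfolding linear_graph_def by blast
    next
      fix a assume "(la_zero G, a) \<in> \<Union>\<C>"
      then show "a = 0" using mem(1) unfolding linear_graph_def by blast
    qed
    moreover have "?gr \<subseteq> \<Union>\<C>" using C(1) mem(2) by blast
    ultimately show ?thesis by blast
  qed
  from subset_Zorn_nonempty[OF ne un] obtain R
    where RA: "R \<in> ?A" and max: "\<forall>X\<in>?A. R \<subseteq> X \<longrightarrow> X = R" by (rule bexE)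
  then have R: "linear_graph R" "?gr \<subseteq> R" by simp_all
  have z0: "(la_zero G, 0) \<in> R" using R(2) z \<alpha>0 by force
  have total: "\<xi> \<in> Domain R" if "\<xi> \<in> \<gg>" for \<xi>
  proof (rule ccontr)
    assume "\<xi> \<notin> Domain R"
    note ext = linear_graph_extend[OF R(1) z0 that this]
    have "{(la_add G \<eta> (la_scale c \<xi>), a) | \<eta> c a. (\<eta>, a) \<in> R} = R"
      by (rule max[rule_format, OF _ ext(2)]) (use ext(1) subset_trans[OF R(2) ext(2)] in blast)
    then show False using ext(3) \<open>\<xi> \<notin> Domain R\<close> by simp
  qed
  define b where "b \<xi> = (THE a. (\<xi>, a) \<in> R)" for \<xi>
  have bI: "b \<xi> = a" if "(\<xi>, a) \<in> R" for \<xi> a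
    unfolding b_def using that linear_graph_functional[OF R(1)] by blast
  have bR: "(\<xi>, b \<xi>) \<in> R" if "\<xi> \<in> \<gg>" for \<xi> using total[OF that] bI by auto
  have "restrict b (\<gg>) \<in> dual_space G (\<gg>)"
    unfolding dual_space_def
  proof (intro CollectI conjI ballI allI)
    fix \<xi> \<eta> assume "\<xi> \<in> \<gg>" "\<eta> \<in> \<gg>"
    then show "restrict b (\<gg>) (la_add G \<xi> \<eta>) = restrict b (\<gg>) \<xi> + restrict b (\<gg>) \<eta>"
      using bI[of "la_add G \<xi> \<eta>" "b \<xi> + b \<eta>"] bR R(1) la_add_lie_alg by (simp add: linear_graph_def)
  next
    fix c \<xi> assume "\<xi> \<in> \<gg>"
    then show "restrict b (\<gg>) (la_scale c \<xi>) = c * restrict b (\<gg>) \<xi>"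
      using bI[of "la_scale c \<xi>" "c * b \<xi>"] bR R(1) la_scale_lie_alg by (simp add: linear_graph_def)
  qed simp
  moreover have "restrict (restrict b (\<gg>)) h = \<alpha>"
  proof
    fix \<xi>
    have "h \<subseteq> \<gg>" using h by (simp add: subalgebra_def)
    then show "restrict (restrict b (\<gg>)) h \<xi> = \<alpha> \<xi>"
      using bI[of \<xi> "\<alpha> \<xi>"] R(2) \<alpha> by (cases "\<xi> \<in> h") (auto simp: dual_space_def extensional_def)
  qed
  ultimately show thesis using that by blast
qed

end

section \<open>Locally finite families of smooth functions\<close>

lemma smooth_fun_locally_eq:
  fixes f :: "'m \<Rightarrow> 'b::euclidean_space"
  assumes M: "smooth_manifold M"
    and loc: "\<And>x. x \<in> points M \<Longrightarrow> \<exists>N g. openin (mf_top M) N \<and> x \<in> N \<and> smooth_fun M g \<and> (\<forall>y\<in>N. f y = g y)"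
  shows "smooth_fun M f"
proof (rule smooth_fun_localI[OF M])
  fix x assume x: "x \<in> points M"
  obtain N g where N: "openin (mf_top M) N" "x \<in> N" "smooth_fun M g" "\<forall>y\<in>N. f y = g y" using loc[OF x] by blast
  obtain U \<phi> where U: "(U, \<phi>) \<in> atlas M" "x \<in> U" using chart_cover[OF M x] .
  let ?W = "{u \<in> cdom M U \<phi>. cpar M U \<phi> u \<in> N}"
  have o: "open ?W" using smooth_into_vimage_open[OF smooth_into_cpar[OF M U(1)] N(1)] .
  have "Cinf ?W (\<lambda>u. g (cpar M U \<phi> u))"
    by (rule Cinf_subset[OF smooth_fun_cpar[OF M U(1) N(3)]]) auto
  then have "Cinf ?W (\<lambda>u. f (cpar M U \<phi> u))"
    by (rule Cinf_cong[OF _ o]) (use N(4) in auto)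
  moreover have "?W \<inter> cdom M U \<phi> = ?W" by auto
  moreover have "\<phi> x \<in> ?W" using U N(2) by (simp add: chart_in_cdom[OF M] cpar_chart[OF M])
  ultimately show "\<exists>U \<phi> W. (U, \<phi>) \<in> atlas M \<and> x \<in> U \<and> open W \<and> \<phi> x \<in> W \<and>
      Cinf (W \<inter> cdom M U \<phi>) (\<lambda>u. f (cpar M U \<phi> u))"
    using U o by (intro exI[of _ U] exI[of _ \<phi>] exI[of _ ?W]) simp
qed

definition locally_finite_family :: "('m, 'e) mfd \<Rightarrow> (nat \<Rightarrow> 'm \<Rightarrow> real) \<Rightarrow> bool" where
  "locally_finite_family M \<mu> \<longleftrightarrow>
     (\<forall>x\<in>points M. \<exists>N K. openin (mf_top M) N \<and> x \<in> N \<and> (\<forall>y\<in>N. \<forall>k\<ge>K. \<mu> k y = 0))"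

lemma locally_finite_family_finite:
  assumes "locally_finite_family M \<mu>" "x \<in> points M" shows "finite {k. \<mu> k x \<noteq> 0}"
proof -
  obtain K where "\<forall>k\<ge>K. \<mu> k x = 0" using assms unfolding locally_finite_family_def by blast
  then have "{k. \<mu> k x \<noteq> 0} \<subseteq> {..<K}"
    by (metis (mono_tags) lessThan_iff mem_Collect_eq not_le_imp_less subsetI)
  then show ?thesis by (rule finite_subset) simp
qed

lemma smooth_fun_locally_finite_sum:
  assumes M: "smooth_manifold M" and lf: "locally_finite_family M \<mu>" and sm: "\<And>k. smooth_fun M (\<mu> k)"
  shows "smooth_fun M (\<lambda>x. \<Sum>k | \<mu> k x \<noteq> 0. \<mu> k x * c k)"
proof (rule smooth_fun_locally_eq[OF M])
  fix x assume "x \<in> points M"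
  with lf have "\<exists>N K. openin (mf_top M) N \<and> x \<in> N \<and> (\<forall>y\<in>N. \<forall>k\<ge>K. \<mu> k y = 0)"
    unfolding locally_finite_family_def by (rule bspec)
  then obtain N K where N: "openin (mf_top M) N" "x \<in> N" "\<forall>y\<in>N. \<forall>k\<ge>K. \<mu> k y = 0"
    by (elim exE conjE)
  have "smooth_fun M (\<lambda>y. \<Sum>k<K. \<mu> k y * c k)"
    by (intro smooth_fun_sum[OF M] smooth_fun_mult[OF M] sm smooth_fun_const[OF M])
  moreover have "(\<Sum>k | \<mu> k y \<noteq> 0. \<mu> k y * c k) = (\<Sum>k<K. \<mu> k y * c k)" if "y \<in> N" for y
  proof (rule sum.mono_neutral_left)
    show "{k. \<mu> k y \<noteq> 0} \<subseteq> {..<K}"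
      using N(3) that by (metis (mono_tags) lessThan_iff mem_Collect_eq not_le_imp_less subsetI)
  qed auto
  ultimately show "\<exists>N g. openin (mf_top M) N \<and> x \<in> N \<and> smooth_fun M g \<and> (\<forall>y\<in>N. (\<Sum>k | \<mu> k y \<noteq> 0. \<mu> k y * c k) = g y)"
    using N by blast
qed

text \<open>A sequence of non-negative functions without common zero is made locally finite by smooth factors that
  kill the \<open>k\<close>-th function wherever an earlier one exceeds \<open>1/(k+1)\<close>. The new functions are functions of the
  old ones, so invariance is preserved.\<close>

definition damped :: "(nat \<Rightarrow> 'm \<Rightarrow> real) \<Rightarrow> nat \<Rightarrow> 'm \<Rightarrow> real" where
  "damped l k x = l k x * (\<Prod>j<k. cutoff (1 / (real k + 1) - l j x))"

lemma smooth_fun_damped: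
  assumes M: "smooth_manifold M" and l: "\<And>k. smooth_fun M (l k)"
  shows "smooth_fun M (damped l k)"
proof -
  have c: "smooth_fun M (\<lambda>x. cutoff (1 / (real k + 1) - l j x))" for j
    by (rule smooth_fun_compose[OF M l, of UNIV "\<lambda>y. cutoff (1 / (real k + 1) - y)"])
       (auto intro!: Cinf_compose[OF _ _ Cinf_cutoff] Cinf_diff Cinf_const Cinf_id)
  have "smooth_fun M (\<lambda>x. \<Prod>j<n. cutoff (1 / (real k + 1) - l j x))" for n
    by (induction n) (auto intro: smooth_fun_const[OF M] smooth_fun_mult[OF M] c)
  then show ?thesis unfolding damped_def[abs_def] by (intro smooth_fun_mult[OF M] l)
qed

lemma damped_nonneg: "l k x \<ge> 0 \<Longrightarrow> damped l k x \<ge> 0"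
  by (simp add: damped_def prod_nonneg cutoff_nonneg)

text \<open>The first member of the family that is positive at \<open>x\<close> is not annihilated, as all earlier ones vanish there.\<close>

lemma damped_pos:
  assumes "l i x > 0" "\<And>k. l k x \<ge> 0" shows "\<exists>k. damped l k x > 0"
proof -
  define k where "k = (LEAST k. l k x > 0)"
  have k: "l k x > 0" unfolding k_def using assms(1) by (rule LeastI)
  have "l j x = 0" if "j < k" for j
    using not_less_Least[of j "\<lambda>k. l k x > 0"] that assms(2)[of j] by (simp add: k_def)
  then have "damped l k x > 0"
    unfolding damped_def using k by (intro mult_pos_pos prod_pos) (auto simp: cutoff_pos_iff)
  then show ?thesis by blast
qed

text \<open>If \<open>l i\<close> is positive at \<open>x\<close>, it exceeds some \<open>1/n\<close> near \<open>x\<close> and annihilates there all members of the damped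
  family from some index on.\<close>

lemma locally_finite_damped:
  assumes M: "smooth_manifold M" and l: "\<And>k. smooth_fun M (l k)"
    and cover: "\<And>x. x \<in> points M \<Longrightarrow> \<exists>k. l k x > 0"
  shows "locally_finite_family M (damped l)"
  unfolding locally_finite_family_def
proof
  fix x assume x: "x \<in> points M"
  then obtain i where i: "l i x > 0" using cover by blast
  let ?N = "{y \<in> points M. l i y \<in> {l i x / 2<..}}"
  obtain n where n: "n > i" "1 / real n < l i x / 2"
  proof -
    obtain m where "2 / l i x < real m" using reals_Archimedean2 by blast
    then have "2 / l i x < real (m + i + 1)" by simp
    then have "1 / real (m + i + 1) < l i x / 2"
      using i by (simp add: field_simps)
    then show thesis using that[of "m + i + 1"] by simp
  qed
  have "openin (mf_top M) ?N"
    by (rule openin_continuous_map_preimage[OF smooth_fun_continuous[OF M l]]) simp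
  moreover have "x \<in> ?N" using x i by simp
  moreover have "damped l k y = 0" if "y \<in> ?N" "k \<ge> n" for y k
  proof -
    have "1 / (real k + 1) \<le> 1 / real n" using that(2) n(1) by (intro divide_left_mono) auto
    then have "cutoff (1 / (real k + 1) - l i y) = 0" using that(1) n(2) by (simp add: cutoff_eq_0_iff)
    moreover have "i \<in> {..<k}" using n(1) that(2) by simp
    ultimately have "(\<Prod>j<k. cutoff (1 / (real k + 1) - l j y)) = 0" by (meson finite_lessThan prod_zero)
    then show ?thesis by (simp add: damped_def)
  qed
  ultimately show "\<exists>N K. openin (mf_top M) N \<and> x \<in> N \<and> (\<forall>y\<in>N. \<forall>k\<ge>K. damped l k y = 0)" by blast
qed

section \<open>Abstract moment maps from assignments\<close>

context torus_action
begin

text \<open>By the frontier condition, the compatibility required of an assignment applies to all strata near \<open>m\<close>.\<close>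

lemma assignment_consistent_nbhd:
  assumes A: "assignment G \<G> M \<rho> A" and m: "m \<in> points M"
  obtains N where "openin (mf_top M) N" "m \<in> N"
    "\<forall>x\<in>N. stab x \<subseteq> stab m \<and> A (stratum x) = restrict (A (stratum m)) (stab x)"
proof -
  obtain N where N: "openin (mf_top M) N" "m \<in> N" "\<forall>x\<in>N. stab x \<subseteq> stab m"
    "\<forall>x\<in>N. stratum m \<subseteq> mf_top M closure_of stratum x" using stratum_subset_closure[OF m] .
  have "A (stratum x) = restrict (A (stratum m)) (stab x)" if x: "x \<in> N" for x
  proof -
    have xM: "x \<in> points M" using x openin_subset[OF N(1)] by blast
    have "stratum x \<in> strata G \<G> M \<rho>" "stratum m \<in> strata G \<G> M \<rho>" using strata_iff xM m by blast+
    then have "A (stratum x) = restrict (A (stratum m)) (stratum_stab G \<G> M \<rho> (stratum x))"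
      using A N(4) x unfolding assignment_def by blast
    then show ?thesis by (simp add: stratum_stab_eq[OF xM])
  qed
  then show thesis using that[OF N(1,2)] N(3) by blast
qed

text \<open>The constant functional \<open>\<alpha>\<close> is associated with \<open>A\<close> wherever the invariant bump function \<open>f\<close> at \<open>m\<close> does not
  vanish.\<close>

definition local_model :: "('m set \<Rightarrow> (real \<Rightarrow> 'g) \<Rightarrow> real) \<Rightarrow> 'm \<Rightarrow> ((real \<Rightarrow> 'g) \<Rightarrow> real) \<Rightarrow> ('m \<Rightarrow> real) \<Rightarrow> bool" where
  "local_model A m \<alpha> f \<longleftrightarrow> \<alpha> \<in> dual_space G (\<gg>) \<and> smooth_fun M f \<and> f m > 0 \<and>
    (\<forall>x\<in>points M. f x \<ge> 0) \<and> (\<forall>g\<in>carrier G. \<forall>x\<in>points M. f (\<rho> g x) = f x) \<and>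
    (\<forall>x\<in>points M. f x \<noteq> 0 \<longrightarrow> restrict \<alpha> (stab x) = A (stratum x))"

text \<open>The bump function lives on the orbits through the neighbourhood of \<open>m\<close> on which the assignment is
  consistent. Both sides of the compatibility condition are constant along orbits.\<close>

lemma local_model_exists:
  assumes A: "assignment G \<G> M \<rho> A" and m: "m \<in> points M"
  shows "\<exists>\<alpha> f. local_model A m \<alpha> f"
proof -
  obtain N where N: "openin (mf_top M) N" "m \<in> N"
    "\<forall>x\<in>N. stab x \<subseteq> stab m \<and> A (stratum x) = restrict (A (stratum m)) (stab x)"
    using assignment_consistent_nbhd[OF A m] .
  have "stratum m \<in> strata G \<G> M \<rho>" using strata_iff m by blast
  then have "A (stratum m) \<in> dual_space G (stab m)"
    using A stratum_stab_eq[OF m] unfolding assignment_def by metis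
  then obtain \<alpha> where \<alpha>: "\<alpha> \<in> dual_space G (\<gg>)" "restrict \<alpha> (stab m) = A (stratum m)"
    using functional_extends[OF subalgebra_stab[OF m]] by blast
  obtain f :: "'m \<Rightarrow> real" where f: "smooth_fun M f" "f m > 0" "\<forall>x\<in>points M. f x \<ge> 0"
    "\<forall>g\<in>carrier G. \<forall>x\<in>points M. f (\<rho> g x) = f x"
    "\<forall>x\<in>points M. f x \<noteq> 0 \<longrightarrow> (\<exists>g\<in>carrier G. \<rho> g x \<in> N)"
    by (rule invariant_bump[OF m N(1,2)])
  have "restrict \<alpha> (stab x) = A (stratum x)" if x: "x \<in> points M" "f x \<noteq> 0" for x
  proof -
    obtain g where g: "g \<in> carrier G" "\<rho> g x \<in> N" using f(5) x by blast
    have sub: "stab x \<subseteq> stab m" and eq: "A (stratum x) = restrict (A (stratum m)) (stab x)"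
      using N(3)[rule_format, OF g(2)]
      unfolding stab_translate[OF g(1) x(1)] stratum_translate[OF g(1) x(1)] by blast+
    show ?thesis
      unfolding eq \<alpha>(2)[symmetric] restrict_restrict using sub by (simp add: Int_absorb1)
  qed
  then show ?thesis
    unfolding local_model_def using \<alpha>(1) f(1-4) by (intro exI[of _ \<alpha>] exI[of _ f] conjI ballI impI) blast+
qed

text \<open>Countably many local models cover \<open>M\<close>. Their bump functions are made locally finite by damping and
  normalized, and \<open>\<Psi>\<close> is the weighted mean of their functionals.\<close>

lemma moment_map_exists:
  assumes A: "assignment G \<G> M \<rho> A"
  shows "\<exists>\<Psi>. abstract_moment_map G \<G> M \<rho> \<Psi> \<and> associated G \<G> M \<rho> \<Psi> A"
proof -
  obtain \<alpha> f where "\<forall>m\<in>points M. local_model A m (\<alpha> m) (f m)"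
    using local_model_exists[OF A] by metis
  then have \<alpha>: "\<And>m. m \<in> points M \<Longrightarrow> \<alpha> m \<in> dual_space G (\<gg>)"
    and f: "\<And>m. m \<in> points M \<Longrightarrow> smooth_fun M (f m :: 'm \<Rightarrow> real)" "\<And>m. m \<in> points M \<Longrightarrow> f m m > 0"
      "\<And>m x. m \<in> points M \<Longrightarrow> x \<in> points M \<Longrightarrow> f m x \<ge> 0"
      "\<And>m g x. m \<in> points M \<Longrightarrow> g \<in> carrier G \<Longrightarrow> x \<in> points M \<Longrightarrow> f m (\<rho> g x) = f m x"
    and \<alpha>A: "\<And>m x. m \<in> points M \<Longrightarrow> x \<in> points M \<Longrightarrow> f m x \<noteq> 0 \<Longrightarrow> restrict (\<alpha> m) (stab x) = A (stratum x)"
    unfolding local_model_def by blast+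
  show ?thesis
  proof (cases "points M = {}")
    case True
    then have "abstract_moment_map G \<G> M \<rho> (\<lambda>_ _. 0)"
      by (auto simp: abstract_moment_map_def smooth_map_on_def locally_constant_on_def fixed_points_def)
    moreover have "associated G \<G> M \<rho> (\<lambda>_ _. 0) A"
      using True stratum_points by (auto simp: associated_def strata_iff)
    ultimately show ?thesis by blast
  next
    case False
    let ?P = "\<lambda>m. {x \<in> points M. f m x > 0}"
    have "Lindelof_space (mf_top M)"
      using M by (simp add: smooth_manifold_def second_countable_imp_Lindelof_space)
    moreover have "openin (mf_top M) (?P m)" if "m \<in> points M" for m
      using openin_continuous_map_preimage[OF smooth_fun_continuous[OF M f(1)[OF that]], of "{0<..}"] by simp
    then have "(\<forall>U\<in>?P ` points M. openin (mf_top M) U) \<and> \<Union>(?P ` points M) = points M"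
      using f(2) by auto
    ultimately have "\<exists>\<V>. countable \<V> \<and> \<V> \<subseteq> ?P ` points M \<and> \<Union>\<V> = points M"
      unfolding Lindelof_space_def by (elim allE[of _ "?P ` points M"]) (rule mp)
    then obtain \<V> where \<V>: "countable \<V>" "\<V> \<subseteq> ?P ` points M" "\<Union>\<V> = points M"
      by (elim exE conjE)
    have "\<exists>K. countable K \<and> K \<subseteq> points M \<and> \<V> = ?P ` K"
      by (rule countable_subset_image[THEN iffD1]) (intro conjI \<V>(1,2))
    then obtain K where K: "countable K" "K \<subseteq> points M" "\<V> = ?P ` K" by (elim exE conjE)
    have "K \<noteq> {}" using False \<V>(3) K(3) by blast
    define p where "p = from_nat_into K"
    have pK: "p k \<in> K" for k unfolding p_def using from_nat_into[OF \<open>K \<noteq> {}\<close>] .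
    then have p: "p k \<in> points M" for k using K(2) by blast
    define l where "l k = f (p k)" for k
    have l: "\<And>k. smooth_fun M (l k)" "\<And>k x. x \<in> points M \<Longrightarrow> l k x \<ge> 0"
      "\<And>k g x. g \<in> carrier G \<Longrightarrow> x \<in> points M \<Longrightarrow> l k (\<rho> g x) = l k x"
      using f p by (auto simp: l_def)
    have cover: "\<exists>k. l k x > 0" if x: "x \<in> points M" for x
    proof -
      obtain m where m: "m \<in> K" "f m x > 0" using x \<V>(3) K(3) by blast
      then obtain k where "p k = m" unfolding p_def using from_nat_into_surj[OF K(1)] by blast
      then show ?thesis using m(2) by (auto simp: l_def)
    qed
    define \<mu> where "\<mu> = damped l"
    define I where "I x = {k. \<mu> k x \<noteq> 0}" for x
    \<comment> \<open>For \<open>c = 1\<close> this is the normalizing denominator.\<close>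
    define num where "num c x = (\<Sum>k\<in>I x. \<mu> k x * c k)" for c :: "nat \<Rightarrow> real" and x
    have lf: "locally_finite_family M \<mu>"
      unfolding \<mu>_def using locally_finite_damped[OF M l(1) cover] .
    have smn: "smooth_fun M (num c)" for c
      unfolding num_def I_def using smooth_fun_locally_finite_sum[OF M lf] smooth_fun_damped[OF M l(1)]
      by (simp add: \<mu>_def)
    have fin: "finite (I x)" if "x \<in> points M" for x
      unfolding I_def using locally_finite_family_finite[OF lf that] .
    have den: "num (\<lambda>_. 1) x > 0" if x: "x \<in> points M" for x
    proof -
      obtain i where "l i x > 0" using cover[OF x] by blast
      then obtain k where k: "\<mu> k x > 0" unfolding \<mu>_def using damped_pos[of l i x] l(2)[OF x] by blast
      have "(\<Sum>k\<in>I x. \<mu> k x) > 0"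
        by (rule sum_pos2[OF fin[OF x], of k]) (use k l(2)[OF x] in \<open>auto simp: I_def \<mu>_def damped_nonneg\<close>)
      then show ?thesis by (simp add: num_def)
    qed
    define \<Psi> where "\<Psi> x = (\<lambda>\<xi>\<in>\<gg>. num (\<lambda>k. \<alpha> (p k) \<xi>) x * inverse (num (\<lambda>_. 1) x))" for x
    have \<alpha>add: "\<alpha> (p k) (la_add G \<xi> \<eta>) = \<alpha> (p k) \<xi> + \<alpha> (p k) \<eta>"
      if "\<xi> \<in> \<gg>" "\<eta> \<in> \<gg>" for k \<xi> \<eta>
      using \<alpha>[OF p[of k]] that by (simp add: dual_space_def)
    have \<alpha>scale: "\<alpha> (p k) (la_scale c \<xi>) = c * \<alpha> (p k) \<xi>" if "\<xi> \<in> \<gg>" for k c \<xi>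
      using \<alpha>[OF p[of k]] that by (simp add: dual_space_def)
    have \<Psi>_dual: "\<Psi> x \<in> dual_space G (\<gg>)" for x
      by (auto simp: dual_space_def \<Psi>_def la_add_lie_alg la_scale_lie_alg \<alpha>add \<alpha>scale num_def
          algebra_simps sum.distrib sum_distrib_left)
    have \<Psi>_smooth: "smooth_map M real_line (\<lambda>x. \<Psi> x \<xi>)" if "\<xi> \<in> \<gg>" for \<xi>
    proof -
      have "smooth_fun M (\<lambda>x. inverse (num (\<lambda>_. 1) x))"
        by (rule smooth_fun_compose[OF M smn Cinf_inverse]) (use den in fastforce)
      then have "smooth_fun M (\<lambda>x. num (\<lambda>k. \<alpha> (p k) \<xi>) x * inverse (num (\<lambda>_. 1) x))"
        by (intro smooth_fun_mult[OF M smn])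
      then show ?thesis using that by (simp add: \<Psi>_def)
    qed
    have \<Psi>_inv: "\<Psi> (\<rho> g x) = \<Psi> x" if "g \<in> carrier G" "x \<in> points M" for g x
      using l(3)[OF that] by (simp add: \<Psi>_def num_def I_def \<mu>_def damped_def)
    have \<Psi>A: "restrict (\<Psi> x) (stab x) = A (stratum x)" if x: "x \<in> points M" for x
    proof -
      have *: "restrict (\<alpha> (p k)) (stab x) = A (stratum x)" if "k \<in> I x" for k
        using \<alpha>A[OF p x] that by (auto simp: I_def \<mu>_def damped_def l_def)
      obtain k where k: "k \<in> I x" using den[OF x] by (force simp: num_def)
      show ?thesis
      proof
        fix \<xi>
        show "restrict (\<Psi> x) (stab x) \<xi> = A (stratum x) \<xi>"
        proof (cases "\<xi> \<in> stab x")
          case True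
          then have \<xi>: "\<xi> \<in> \<gg>" using x by (simp add: inf_stab_eq)
          have "\<alpha> (p j) \<xi> = A (stratum x) \<xi>" if "j \<in> I x" for j
            using fun_cong[OF *[OF that], of \<xi>] True by simp
          then have "num (\<lambda>k. \<alpha> (p k) \<xi>) x = num (\<lambda>_. 1) x * A (stratum x) \<xi>"
            by (simp add: num_def sum_distrib_right)
          then show ?thesis using True \<xi> den[OF x] by (simp add: \<Psi>_def)
        next
          case False
          then show ?thesis using fun_cong[OF *[OF k], of \<xi>] by simp
        qed
      qed
    qed
    have "abstract_moment_map G \<G> M \<rho> \<Psi>"
      unfolding abstract_moment_map_def
    proof (intro conjI ballI allI impI)
      fix H assume "subgroup H G"
      show "locally_constant_on (mf_top M) (fixed_points M \<rho> H) (\<lambda>m. restrict (\<Psi> m) (lie_alg_sub G \<G> H))"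
        unfolding locally_constant_on_def
      proof
        fix m assume m: "m \<in> fixed_points M \<rho> H"
        then have mM: "m \<in> points M" by (simp add: fixed_points_def)
        obtain N where N: "openin (mf_top M) N" "m \<in> N"
          "\<forall>x\<in>N. stab x \<subseteq> stab m \<and> A (stratum x) = restrict (A (stratum m)) (stab x)"
          using assignment_consistent_nbhd[OF A mM] .
        let ?U = "N \<inter> fixed_points M \<rho> H"
        have "openin (subtopology (mf_top M) (fixed_points M \<rho> H)) ?U"
          using N(1) by (auto simp: openin_subtopology)
        moreover have "restrict (\<Psi> x) (lie_alg_sub G \<G> H) = restrict (\<Psi> m) (lie_alg_sub G \<G> H)" if x: "x \<in> ?U" for x
        proof
          fix \<xi>
          have xM: "x \<in> points M" using x by (simp add: fixed_points_def)
          have sub: "lie_alg_sub G \<G> H \<subseteq> stab x"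
            using x xM by (auto simp: inf_stab_eq lie_alg_sub_def fixed_points_def)
          show "restrict (\<Psi> x) (lie_alg_sub G \<G> H) \<xi> = restrict (\<Psi> m) (lie_alg_sub G \<G> H) \<xi>"
          proof (cases "\<xi> \<in> lie_alg_sub G \<G> H")
            case True
            then have \<xi>: "\<xi> \<in> stab x" "\<xi> \<in> stab m" using sub N(3) x by auto
            have "\<Psi> x \<xi> = A (stratum x) \<xi>" using fun_cong[OF \<Psi>A[OF xM], of \<xi>] \<xi> by simp
            also have "\<dots> = A (stratum m) \<xi>" using N(3) x \<xi>(1) by auto
            also have "\<dots> = \<Psi> m \<xi>" using fun_cong[OF \<Psi>A[OF mM], of \<xi>] \<xi> by simp
            finally show ?thesis using True by simp
          qed simp
        qed
        ultimately show "\<exists>U. openin (subtopology (mf_top M) (fixed_points M \<rho> H)) U \<and> m \<in> U \<and>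
            (\<forall>x\<in>U. restrict (\<Psi> x) (lie_alg_sub G \<G> H) = restrict (\<Psi> m) (lie_alg_sub G \<G> H))"
          using N(2) m by (intro exI[of _ ?U]) blast
      qed
    qed (use \<Psi>_dual \<Psi>_smooth \<Psi>_inv in auto)
    moreover have "associated G \<G> M \<rho> \<Psi> A"
      unfolding associated_def
    proof (intro ballI)
      fix X m assume X: "X \<in> strata G \<G> M \<rho>" "m \<in> X"
      then obtain x where x: "x \<in> points M" "X = stratum x" using strata_iff by blast
      have m: "m \<in> points M" using X(2) x stratum_points by blast
      have "stratum m = X" "stab m = stab x" using stratum_eq stab_stratum X(2) x(2) by auto
      then show "restrict (\<Psi> m) (stratum_stab G \<G> M \<rho> X) = A X"
        using \<Psi>A[OF m] stratum_stab_eq[OF x(1)] x(2) by simp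
    qed
    ultimately show ?thesis by blast
  qed
qed

end

lemma int_span_generator:
  assumes "finite B" "b \<in> B" shows "b \<in> int_span B"
proof -
  have "(\<Sum>c\<in>B. of_int (if c = b then 1 else 0) *\<^sub>R c) = (\<Sum>c\<in>B. if c = b then b else 0)"
    by (rule sum.cong) auto
  also have "\<dots> = b" using assms by simp
  finally show ?thesis unfolding int_span_def by (intro CollectI exI[of _ "\<lambda>c. if c = b then 1 else 0"]) auto
qed

theorem theorem3p18:
  fixes G :: "('g, 'r) monoid_scheme"
    and \<G> :: "('g, 'e::euclidean_space) mfd"
    and M :: "('m, 'f::euclidean_space) mfd"
    and \<rho> :: "'g \<Rightarrow> 'm \<Rightarrow> 'm"
    and A :: "'m set \<Rightarrow> (real \<Rightarrow> 'g) \<Rightarrow> real"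
  assumes "torus G \<G>"
    and "smooth_manifold M"
    and "smooth_action G \<G> M \<rho>"
    and "assignment G \<G> M \<rho> A"
  shows "\<exists>\<Psi>. abstract_moment_map G \<G> M \<rho> \<Psi> \<and> associated G \<G> M \<rho> \<Psi> A"
proof -
  obtain B \<pi> where B: "lie_group G \<G>" "independent B" "span B = model \<G>"
      "smooth_map (euclid (model \<G>)) \<G> \<pi>"
      "\<forall>x\<in>model \<G>. \<forall>y\<in>model \<G>. \<pi> (x + y) = \<pi> x \<otimes>\<^bsub>G\<^esub> \<pi> y"
      "\<pi> ` model \<G> = carrier G" "{x \<in> model \<G>. \<pi> x = \<one>\<^bsub>G\<^esub>} = int_span B"
    using assms(1) unfolding torus_def by blast
  have fin: "finite B" using B(2) by (rule independent_imp_finite)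
  interpret torus_action G \<G> M \<rho> B \<pi>
  proof
    show "\<pi> b = \<one>\<^bsub>G\<^esub>" if "b \<in> B" for b using int_span_generator[OF fin that] B(7) by blast
  qed (use B fin assms in auto)
  show ?thesis by (rule moment_map_exists[OF assms(4)])
qed

end
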